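(* Up to isomorphism there are exactly $19$ graphs that are $6$-vertex-critical and $(P_5,\text{gem})$-free, namely the following pairwise non-isomorphic graphs: $K_6$; $G_1(4,1,4,1,1)$, $G_1(4,1,3,2,1)$, $G_1(3,2,3,2,1)$, $G_1(3,2,2,3,1)$, $G_1(3,2,2,2,2)$; $G_7(1,3,1,3,1,1,4,2)$, $G_7(1,2,2,3,1,1,4,2)$, $G_7(1,1,3,3,1,1,4,2)$, $G_7(1,2,2,2,1,2,4,2)$, $G_7(2,2,1,2,2,1,3,3)$, $G_7(2,1,2,2,2,1,3,3)$, $G_7(1,1,3,2,2,1,3,3)$, $G_7(2,1,2,2,1,2,3,3)$, $G_7(1,2,2,2,1,1,4,3)$, $G_7(1,1,3,2,1,1,4,3)$, $G_7(1,2,2,1,1,2,4,3)$, $G_7(1,1,3,1,1,1,4,4)$, $G_7(1,1,2,1,1,2,4,4)$.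
   Context: All graphs are finite and simple. $\chi(G)$ denotes the chromatic number. A graph $G$ is $k$-vertex-critical if $\chi(G)=k$ and $\chi(G-v)<k$ for all $v\in V(G)$. $P_n$ is the path on $n$ vertices; the gem is $P_4$ plus a vertex adjacent to all four of its vertices. A graph is $(P_5,\text{gem})$-free if it contains neither $P_5$ nor the gem as an induced subgraph. $G_1$ is the $5$-cycle on $v_1,\dots,v_5$ with edges $v_1v_2,v_2v_3,v_3v_4,v_4v_5,v_5v_1$. $G_7$ is the graph on $v_1,\dots,v_8$ with edges $v_1v_2,v_1v_3,v_1v_4,v_1v_7,v_2v_3,v_2v_5,v_2v_8,v_3v_6,v_4v_5,v_4v_6,v_4v_8,v_5v_6,v_5v_7$. For positive integers $n_j$, $G_1(n_1,\dots,n_5)$ (respectively $G_7(n_1,\dots,n_8)$) denotes the clique expansion of $G_1$ (respectively $G_7$) in which each vertex $v_j$ is replaced by a clique $Q_j$ of order $n_j$, where the $Q_j$ are disjoint and, for $i\ne j$, every vertex of $Q_i$ is adjacent to every vertex of $Q_j$ if $v_iv_j$ is an edge, and there are no edges between $Q_i$ and $Q_j$ otherwise. *)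

theory Defs
  imports Main
begin

record 'a ugraph =
  uverts :: "'a set"
  uedges :: "'a set set"

definition simple_graph :: "'a ugraph \<Rightarrow> bool" where
  "simple_graph G \<longleftrightarrow>
     finite (uverts G) \<and> (\<forall>e\<in>uedges G. e \<subseteq> uverts G \<and> card e = 2)"

definition ugraph_iso :: "'a ugraph \<Rightarrow> 'b ugraph \<Rightarrow> bool" where
  "ugraph_iso G H \<longleftrightarrow>
     (\<exists>f. bij_betw f (uverts G) (uverts H) \<and>
          (\<forall>u\<in>uverts G. \<forall>v\<in>uverts G. {u, v} \<in> uedges G \<longleftrightarrow> {f u, f v} \<in> uedges H))"

definition induced_ugraph :: "'a ugraph \<Rightarrow> 'a set \<Rightarrow> 'a ugraph" where
  "induced_ugraph G S = \<lparr>uverts = S, uedges = {e \<in> uedges G. e \<subseteq> S}\<rparr>"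

definition delete_vertex :: "'a ugraph \<Rightarrow> 'a \<Rightarrow> 'a ugraph" where
  "delete_vertex G v = induced_ugraph G (uverts G - {v})"

definition contains_induced :: "'a ugraph \<Rightarrow> 'b ugraph \<Rightarrow> bool" where
  "contains_induced G H \<longleftrightarrow> (\<exists>S\<subseteq>uverts G. ugraph_iso (induced_ugraph G S) H)"

definition proper_colouring :: "'a ugraph \<Rightarrow> nat \<Rightarrow> ('a \<Rightarrow> nat) \<Rightarrow> bool" where
  "proper_colouring G k c \<longleftrightarrow>
     (\<forall>v\<in>uverts G. c v < k) \<and>
     (\<forall>u\<in>uverts G. \<forall>v\<in>uverts G. {u, v} \<in> uedges G \<longrightarrow> c u \<noteq> c v)"

definition chromatic_number :: "'a ugraph \<Rightarrow> nat" where
  "chromatic_number G = (LEAST k. \<exists>c. proper_colouring G k c)"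

definition vertex_critical :: "nat \<Rightarrow> 'a ugraph \<Rightarrow> bool" where
  "vertex_critical k G \<longleftrightarrow>
     chromatic_number G = k \<and>
     (\<forall>v\<in>uverts G. chromatic_number (delete_vertex G v) < k)"

definition path_ugraph :: "nat \<Rightarrow> nat ugraph" where
  "path_ugraph n = \<lparr>uverts = {1..n}, uedges = {{i, i + 1} | i. 1 \<le> i \<and> i < n}\<rparr>"

definition gem_ugraph :: "nat ugraph" where
  "gem_ugraph = \<lparr>uverts = insert 0 (uverts (path_ugraph 4)),
                 uedges = uedges (path_ugraph 4) \<union> {{0, i} | i. i \<in> uverts (path_ugraph 4)}\<rparr>"

definition P5_gem_free :: "'a ugraph \<Rightarrow> bool" where
  "P5_gem_free G \<longleftrightarrow>
     \<not> contains_induced G (path_ugraph 5) \<and> \<not> contains_induced G gem_ugraph"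

definition complete_ugraph :: "'a set \<Rightarrow> 'a ugraph" where
  "complete_ugraph V = \<lparr>uverts = V, uedges = {e. e \<subseteq> V \<and> card e = 2}\<rparr>"

definition clique_expansion :: "'a ugraph \<Rightarrow> ('a \<Rightarrow> nat) \<Rightarrow> ('a \<times> nat) ugraph" where
  "clique_expansion H n =
     (let V = Sigma (uverts H) (\<lambda>v. {1..n v}) in
      \<lparr>uverts = V,
       uedges = {{x, y} | x y. x \<in> V \<and> y \<in> V \<and> x \<noteq> y \<and>
                   (fst x = fst y \<or> {fst x, fst y} \<in> uedges H)}\<rparr>)"

definition base_G1 :: "nat ugraph" where
  "base_G1 = \<lparr>uverts = {1..5}, uedges = {{1,2}, {2,3}, {3,4}, {4,5}, {5,1}}\<rparr>"

definition base_G7 :: "nat ugraph" where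
  "base_G7 = \<lparr>uverts = {1..8},
     uedges = {{1,2}, {1,3}, {1,4}, {1,7}, {2,3}, {2,5}, {2,8}, {3,6},
               {4,5}, {4,6}, {4,8}, {5,6}, {5,7}}\<rparr>"

(* Vertices are numbered from 1, list positions from 0. *)
definition expansion_G1 :: "nat list \<Rightarrow> (nat \<times> nat) ugraph" where
  "expansion_G1 ns = clique_expansion base_G1 (\<lambda>j. ns ! (j - 1))"

definition expansion_G7 :: "nat list \<Rightarrow> (nat \<times> nat) ugraph" where
  "expansion_G7 ns = clique_expansion base_G7 (\<lambda>j. ns ! (j - 1))"

(* K_6 is placed on pairs only so that it has the same type as the clique expansions. *)
definition critical_graphs_6 :: "(nat \<times> nat) ugraph list" where
  "critical_graphs_6 =
    [complete_ugraph ({1} \<times> {1..6}),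
     expansion_G1 [4,1,4,1,1],
     expansion_G1 [4,1,3,2,1],
     expansion_G1 [3,2,3,2,1],
     expansion_G1 [3,2,2,3,1],
     expansion_G1 [3,2,2,2,2],
     expansion_G7 [1,3,1,3,1,1,4,2],
     expansion_G7 [1,2,2,3,1,1,4,2],
     expansion_G7 [1,1,3,3,1,1,4,2],
     expansion_G7 [1,2,2,2,1,2,4,2],
     expansion_G7 [2,2,1,2,2,1,3,3],
     expansion_G7 [2,1,2,2,2,1,3,3],
     expansion_G7 [1,1,3,2,2,1,3,3],
     expansion_G7 [2,1,2,2,1,2,3,3],
     expansion_G7 [1,2,2,2,1,1,4,3],
     expansion_G7 [1,1,3,2,1,1,4,3],
     expansion_G7 [1,2,2,1,1,2,4,3],
     expansion_G7 [1,1,3,1,1,1,4,4],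
     expansion_G7 [1,1,2,1,1,2,4,4]]"

end

theory Submission
  imports Defs
begin

text \<open>
Let \<open>G\<close> be the graph. If it is not \<open>K\<^sub>6\<close>, it has no clique of size 6. A \<open>(P\<^sub>5, gem)\<close>-free graph without induced
5-cycle is perfect, so \<open>G\<close> has an induced 5-cycle; take one whose vertices have twin classes of maximal total size.
Relative to this cycle every other vertex is of one of three kinds: it sees exactly the two cycle neighbours
of a cycle vertex \<open>v\<close> and possibly \<open>v\<close>; it sees a cycle vertex and the two vertices opposite to it; or it sees no
cycle vertex. Forbidding \<open>P\<^sub>5\<close> and the gem determines most adjacencies between the kinds. Criticality does
the rest: a 5-colouring of the graph minus some homogeneous part could be extended to that part by Hall's condition unless
vertices of the first kind are twins of the cycle vertices and all remaining sets are cliques that are pairwise complete or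
anticomplete. Hence \<open>G\<close> is a clique expansion of \<open>G\<^sub>7\<close>, with some cliques possibly empty.

An expansion of \<open>G\<^sub>7\<close> in which all cliques have size at most 5, both 5-cycles through vertex 7 or 8 carry weight at
most 10 and the total weight is at most 15 is 5-colourable. Conversely the stability numbers of \<open>G\<^sub>1\<close> and \<open>G\<^sub>7\<close> are 2 and 3, so
weight 11 on a 5-cycle or total weight 16 rules out a 5-colouring. So a critical expansion is one of \<open>G\<^sub>1\<close> of weight 11
or one of \<open>G\<^sub>7\<close> of weight 16, and the finitely many weight vectors give the 18 expansions up to automorphisms of the base graphs.
Vertex counts and degree sequences separate the 19 graphs.
\<close>

section \<open>Colourings and cliques\<close>

definition clique :: "('a \<Rightarrow> 'a \<Rightarrow> bool) \<Rightarrow> 'a set \<Rightarrow> bool" where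
  "clique E K \<longleftrightarrow> (\<forall>x\<in>K. \<forall>y\<in>K. x \<noteq> y \<longrightarrow> E x y)"

definition proper :: "('a \<Rightarrow> 'a \<Rightarrow> bool) \<Rightarrow> 'a set \<Rightarrow> ('a \<Rightarrow> nat) \<Rightarrow> nat set \<Rightarrow> bool" where
  "proper E S c P \<longleftrightarrow> (\<forall>v\<in>S. c v \<in> P) \<and> (\<forall>u\<in>S. \<forall>v\<in>S. E u v \<longrightarrow> c u \<noteq> c v)"

definition col :: "('a \<Rightarrow> 'a \<Rightarrow> bool) \<Rightarrow> 'a set \<Rightarrow> nat \<Rightarrow> bool" where
  "col E S k \<longleftrightarrow> (\<exists>c. proper E S c {..<k})"

definition cycle5 :: "('a \<Rightarrow> 'a \<Rightarrow> bool) \<Rightarrow> 'a \<Rightarrow> 'a \<Rightarrow> 'a \<Rightarrow> 'a \<Rightarrow> 'a \<Rightarrow> bool" where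
  "cycle5 E a b c d e \<longleftrightarrow> E a b \<and> E b c \<and> E c d \<and> E d e \<and> E e a \<and>
     \<not> E a c \<and> \<not> E a d \<and> \<not> E b d \<and> \<not> E b e \<and> \<not> E c e"

definition c5_free :: "('a \<Rightarrow> 'a \<Rightarrow> bool) \<Rightarrow> 'a set \<Rightarrow> bool" where
  "c5_free E S \<longleftrightarrow> (\<forall>a\<in>S. \<forall>b\<in>S. \<forall>c\<in>S. \<forall>d\<in>S. \<forall>e\<in>S. \<not> cycle5 E a b c d e)"

lemma clique_subset: "clique E K \<Longrightarrow> L \<subseteq> K \<Longrightarrow> clique E L"
  by (auto simp: clique_def)

lemma cliqueD: "clique E K \<Longrightarrow> x \<in> K \<Longrightarrow> y \<in> K \<Longrightarrow> x \<noteq> y \<Longrightarrow> E x y"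
  by (auto simp: clique_def)

lemma properD: "proper E S c P \<Longrightarrow> u \<in> S \<Longrightarrow> v \<in> S \<Longrightarrow> E u v \<Longrightarrow> c u \<noteq> c v"
  by (auto simp: proper_def)

lemma proper_range: "proper E S c P \<Longrightarrow> u \<in> S \<Longrightarrow> c u \<in> P"
  by (auto simp: proper_def)

lemma proper_subset: "proper E S c P \<Longrightarrow> T \<subseteq> S \<Longrightarrow> proper E T c P"
  by (auto simp: proper_def)

lemma proper_mono: "proper E S c P \<Longrightarrow> P \<subseteq> Q \<Longrightarrow> proper E S c Q"
  by (auto simp: proper_def)

lemma proper_image: "proper E S c P \<Longrightarrow> proper E S c (c ` S)"
  by (auto simp: proper_def)

lemma proper_inj_on_clique: "proper E K c P \<Longrightarrow> clique E K \<Longrightarrow> inj_on c K"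
  unfolding inj_on_def by (meson cliqueD properD)

lemma proper_card_clique: "proper E S c P \<Longrightarrow> K \<subseteq> S \<Longrightarrow> clique E K \<Longrightarrow> card (c ` K) = card K"
  by (meson card_image proper_inj_on_clique proper_subset)

lemma proper_compose: "proper E S c P \<Longrightarrow> inj_on h P \<Longrightarrow> proper E S (h \<circ> c) (h ` P)"
  unfolding proper_def by (auto dest: inj_onD)

lemma col_subset: "col E S k \<Longrightarrow> T \<subseteq> S \<Longrightarrow> col E T k"
  unfolding col_def using proper_subset by metis

lemma proper_imp_col:
  assumes "proper E S c P" "finite P" "card P \<le> k"
  shows "col E S k"
proof -
  obtain f where f: "inj_on f P" "f ` P \<subseteq> {..<k}"
    using inj_on_iff_card_le[of P "{..<k}"] assms by auto
  show ?thesis unfolding col_def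
    using proper_mono[OF proper_compose[OF assms(1) f(1)] f(2)] by blast
qed

lemma col_imp_proper:
  assumes "col E S k" "finite P" "k \<le> card P"
  shows "\<exists>c. proper E S c P"
proof -
  obtain c where c: "proper E S c {..<k}" using assms(1) col_def by metis
  obtain f where f: "inj_on f {..<k}" "f ` {..<k} \<subseteq> P"
    using inj_on_iff_card_le[of "{..<k}" P] assms by auto
  show ?thesis using proper_mono[OF proper_compose[OF c f(1)] f(2)] by blast
qed

lemma proper_glue:
  assumes "proper E A c P" "proper E B d P"
    and "\<And>a b. a \<in> A \<Longrightarrow> b \<in> B \<Longrightarrow> b \<notin> A \<Longrightarrow> E a b \<or> E b a \<Longrightarrow> c a \<noteq> d b"
  shows "proper E (A \<union> B) (\<lambda>x. if x \<in> A then c x else d x) P"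
  unfolding proper_def
proof (intro conjI ballI impI)
  fix v assume "v \<in> A \<union> B" then show "(if v \<in> A then c v else d v) \<in> P"
    using assms(1,2) by (auto simp: proper_def)
next
  fix u v assume uv: "u \<in> A \<union> B" "v \<in> A \<union> B" "E u v"
  show "(if u \<in> A then c u else d u) \<noteq> (if v \<in> A then c v else d v)"
  proof (cases "u \<in> A"; cases "v \<in> A")
    assume "u \<in> A" "v \<in> A" then show ?thesis using assms(1) uv by (auto simp: proper_def)
  next
    assume "u \<in> A" "v \<notin> A" then show ?thesis using assms(3)[of u v] uv by auto
  next
    assume "u \<notin> A" "v \<in> A" then show ?thesis using assms(3)[of v u] uv by force
  next
    assume "u \<notin> A" "v \<notin> A" then show ?thesis using assms(2) uv by (auto simp: proper_def)
  qed
qed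

lemma max_clique_exists:
  assumes "finite S"
  shows "\<exists>K. K \<subseteq> S \<and> clique E K \<and> (\<forall>L. L \<subseteq> S \<longrightarrow> clique E L \<longrightarrow> card L \<le> card K)"
proof -
  have "\<exists>K. (K \<subseteq> S \<and> clique E K) \<and> (\<forall>L. L \<subseteq> S \<and> clique E L \<longrightarrow> card L \<le> card K)"
    by (rule ex_has_greatest_nat[of _ "{}" _ "Suc (card S)"])
      (use assms in \<open>auto simp: clique_def less_Suc_eq_le intro!: card_mono\<close>)
  then show ?thesis by blast
qed

locale P5_gem_free_graph =
  fixes E :: "'a \<Rightarrow> 'a \<Rightarrow> bool"
  assumes sym: "E x y \<Longrightarrow> E y x"
    and irr: "\<not> E x x"
    and P5: "\<lbrakk>E p q; E q r; E r s; E s t; \<not> E p r; \<not> E p s; \<not> E p t; \<not> E q s; \<not> E q t; \<not> E r t\<rbrakk> \<Longrightarrow> False"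
    and gem: "\<lbrakk>E x p; E x q; E x r; E x s; E p q; E q r; E r s; \<not> E p r; \<not> E p s; \<not> E q s\<rbrakk> \<Longrightarrow> False"
begin

lemma com: "E x y \<longleftrightarrow> E y x" using sym by blast

end

locale minimal_imperfect = P5_gem_free_graph +
  fixes S :: "'a set" and k :: nat
  assumes fin: "finite S"
    and c5f: "c5_free E S"
    and cl: "\<And>K. K \<subseteq> S \<Longrightarrow> clique E K \<Longrightarrow> card K \<le> k"
    and ncol: "\<not> col E S k"
    and IH: "\<And>T j. T \<subset> S \<Longrightarrow> (\<And>K. K \<subseteq> T \<Longrightarrow> clique E K \<Longrightarrow> card K \<le> j) \<Longrightarrow> col E T j"
begin

lemma nonempty: "S \<noteq> {}"
  using ncol by (auto simp: col_def proper_def)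

lemma k_pos: "k > 0"
proof -
  obtain x where "x \<in> S" using nonempty by auto
  then have "card {x} \<le> k" by (intro cl) (auto simp: clique_def)
  then show ?thesis by simp
qed

lemma col_proper_subset:
  assumes "T \<subset> S" shows "col E T k"
proof (rule IH[OF assms])
  fix K assume "K \<subseteq> T" "clique E K"
  then show "card K \<le> k" using assms by (intro cl) auto
qed

lemma no_hitting_stable_set:
  assumes "T \<subseteq> S" "T \<noteq> {}" "\<And>u v. u \<in> T \<Longrightarrow> v \<in> T \<Longrightarrow> \<not> E u v"
    and hit: "\<And>K. K \<subseteq> S \<Longrightarrow> clique E K \<Longrightarrow> card K = k \<Longrightarrow> K \<inter> T \<noteq> {}"
  shows False
proof -
  have "col E (S - T) (k - 1)"
  proof (rule IH)
    show "S - T \<subset> S" using assms(1,2) by auto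
    fix K assume K: "K \<subseteq> S - T" "clique E K"
    then have "card K \<le> k" "card K \<noteq> k" using cl[of K] hit[of K] by blast+
    then show "card K \<le> k - 1" by simp
  qed
  then obtain c where c: "proper E (S - T) c {..<k - 1}" unfolding col_def by blast
  have "proper E ((S - T) \<union> T) (\<lambda>x. if x \<in> S - T then c x else k - 1) {..<k}"
  proof (rule proper_glue)
    show "proper E (S - T) c {..<k}" using c by (rule proper_mono) auto
    show "proper E T (\<lambda>x. k - 1) {..<k}" using assms(3) k_pos by (auto simp: proper_def)
    fix a assume "a \<in> S - T" then show "c a \<noteq> k - 1" using proper_range[OF c, of a] by auto
  qed
  moreover have "(S - T) \<union> T = S" using assms(1) by auto
  ultimately show False using ncol by (auto simp: col_def)
qed

lemma no_star_cutset:
  assumes x: "x \<in> S" and A: "A \<subseteq> S" "A \<noteq> {}" "x \<notin> A" and B: "B \<subseteq> S" "B \<noteq> {}" "x \<notin> B"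
    and disj: "A \<inter> B = {}" and anti: "\<And>a b. a \<in> A \<Longrightarrow> b \<in> B \<Longrightarrow> \<not> E a b"
    and star: "\<And>y. y \<in> S \<Longrightarrow> y \<notin> A \<Longrightarrow> y \<notin> B \<Longrightarrow> y = x \<or> E x y"
  shows False
proof -
  obtain c1 where c1: "proper E (S - B) c1 {..<k}"
    using col_proper_subset[of "S - B"] B unfolding col_def by blast
  obtain c2 where c2: "proper E (S - A) c2 {..<k}"
    using col_proper_subset[of "S - A"] A unfolding col_def by blast
  let ?T = "{v \<in> S - B. c1 v = c1 x} \<union> {v \<in> S - A. c2 v = c2 x}"
  show False
  proof (rule no_hitting_stable_set[of ?T])
    show "?T \<subseteq> S" by auto
    show "?T \<noteq> {}" using x B by auto
    have A1: "v = x \<or> v \<in> A" if "v \<in> S - B" "c1 v = c1 x" for v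
      using star[of v] properD[OF c1, of x v] that x B by auto
    have B1: "v = x \<or> v \<in> B" if "v \<in> S - A" "c2 v = c2 x" for v
      using star[of v] properD[OF c2, of x v] that x A by auto
    fix u v assume u: "u \<in> ?T" and v: "v \<in> ?T"
    show "\<not> E u v"
    proof
      assume e: "E u v"
      consider "u \<in> S - B" "c1 u = c1 x" "v \<in> S - B" "c1 v = c1 x"
        | "u \<in> S - A" "c2 u = c2 x" "v \<in> S - A" "c2 v = c2 x"
        | "u \<in> S - B" "c1 u = c1 x" "v \<in> S - A" "c2 v = c2 x"
        | "v \<in> S - B" "c1 v = c1 x" "u \<in> S - A" "c2 u = c2 x"
        using u v by blast
      then show False
      proof cases
        case 1 then show ?thesis using properD[OF c1, of u v] e by auto
      next
        case 2 then show ?thesis using properD[OF c2, of u v] e by auto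
      next
        case 3
        then show ?thesis using A1[of u] B1[of v] anti[of u v] e properD[OF c1, of u v] properD[OF c2, of u v] x A B
          by (metis DiffI)
      next
        case 4
        then show ?thesis using A1[of v] B1[of u] anti[of v u] sym[OF e] properD[OF c1, of v u] properD[OF c2, of v u] x A B
          by (metis DiffI)
      qed
    qed
  next
    fix K assume K: "K \<subseteq> S" "clique E K" "card K = k"
    have surj: "\<exists>v\<in>K. c v = c x" if c: "proper E U c {..<k}" "K \<subseteq> U" "x \<in> U" for c U
    proof -
      have "card (c ` K) = card {..<k}" using proper_card_clique[OF c(1,2) K(2)] K by simp
      moreover have "c ` K \<subseteq> {..<k}" using c by (auto simp: proper_def)
      ultimately have "c ` K = {..<k}" by (simp add: card_subset_eq)
      moreover have "c x \<in> {..<k}" using c by (auto simp: proper_def)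
      ultimately show ?thesis by (metis imageE)
    qed
    have "K \<subseteq> S - B \<or> K \<subseteq> S - A"
    proof (rule ccontr)
      assume "\<not> ?thesis"
      then obtain a b where "a \<in> K" "a \<in> A" "b \<in> K" "b \<in> B" using K by blast
      then show False using anti[of a b] K(2) disj by (metis cliqueD disjoint_iff)
    qed
    then show "K \<inter> ?T \<noteq> {}"
    proof
      assume s: "K \<subseteq> S - B"
      then obtain v where "v \<in> K" "c1 v = c1 x" using surj[OF c1] x B by blast
      then show ?thesis using s by blast
    next
      assume s: "K \<subseteq> S - A"
      then obtain v where "v \<in> K" "c2 v = c2 x" using surj[OF c2] x A by blast
      then show ?thesis using s by blast
    qed
  qed
qed

lemma not_disconnected:
  assumes "S = A \<union> B" "A \<noteq> {}" "B \<noteq> {}" "A \<inter> B = {}" "\<And>a b. a \<in> A \<Longrightarrow> b \<in> B \<Longrightarrow> \<not> E a b"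
  shows False
proof -
  have "A \<subset> S" "B \<subset> S" using assms by auto
  then obtain c d where cd: "proper E A c {..<k}" "proper E B d {..<k}"
    using col_proper_subset unfolding col_def by metis
  have "proper E (A \<union> B) (\<lambda>x. if x \<in> A then c x else d x) {..<k}"
    by (rule proper_glue[OF cd]) (use assms(5) sym in blast)
  then show False using ncol assms(1) by (auto simp: col_def)
qed

lemma not_join:
  assumes S: "S = A \<union> B" and ne: "A \<noteq> {}" "B \<noteq> {}" and disj: "A \<inter> B = {}"
    and compl: "\<And>a b. a \<in> A \<Longrightarrow> b \<in> B \<Longrightarrow> E a b"
  shows False
proof -
  have fAB: "finite A" "finite B" using fin S by auto
  obtain K where K: "K \<subseteq> A" "clique E K" "\<And>L. L \<subseteq> A \<Longrightarrow> clique E L \<Longrightarrow> card L \<le> card K"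
    using max_clique_exists[OF fAB(1), of E] by metis
  obtain M where M: "M \<subseteq> B" "clique E M" "\<And>L. L \<subseteq> B \<Longrightarrow> clique E L \<Longrightarrow> card L \<le> card M"
    using max_clique_exists[OF fAB(2), of E] by metis
  have "A \<subset> S" "B \<subset> S" using assms by auto
  then have "col E A (card K)" "col E B (card M)" using IH K(3) M(3) by auto
  then obtain c d where c: "proper E A c {..<card K}" and d: "proper E B d {card K..<card K + card M}"
    using col_imp_proper[of E B "card M" "{card K..<card K + card M}"] unfolding col_def by auto
  have "clique E (K \<union> M)" unfolding clique_def
  proof (intro ballI impI)
    fix x y assume "x \<in> K \<union> M" "y \<in> K \<union> M" "x \<noteq> y"
    then show "E x y" using K M compl[of x y] compl[of y x] sym cliqueD by (metis UnE subsetD)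
  qed
  then have "card (K \<union> M) \<le> k" using cl K M S by (metis Un_mono)
  moreover have "card (K \<union> M) = card K + card M"
    using K M disj fAB by (intro card_Un_disjoint) (auto intro: finite_subset)
  ultimately have le: "card K + card M \<le> k" by simp
  have "proper E (A \<union> B) (\<lambda>x. if x \<in> A then c x else d x) {..<k}"
  proof (rule proper_glue)
    show "proper E A c {..<k}" using c by (rule proper_mono) (use le in auto)
    show "proper E B d {..<k}" using d by (rule proper_mono) (use le in auto)
    fix a b assume "a \<in> A" "b \<in> B"
    then show "c a \<noteq> d b" using proper_range[OF c, of a] proper_range[OF d, of b] by auto
  qed
  then show False using ncol S by (auto simp: col_def)
qed

definition far :: "'a \<Rightarrow> 'a set" where "far v = {y \<in> S. y \<noteq> v \<and> \<not> E v y}"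

lemma far_nonempty:
  assumes "v \<in> S" shows "far v \<noteq> {}"
proof
  assume a: "far v = {}"
  show False
  proof (cases "S = {v}")
    case True
    have "proper E S (\<lambda>_. 0) {..<k}" using True irr k_pos by (auto simp: proper_def)
    then show False using ncol by (auto simp: col_def)
  next
    case False
    show False by (rule not_join[of "{v}" "S - {v}"]) (use assms False a in \<open>auto simp: far_def\<close>)
  qed
qed

lemma far_connected:
  assumes "v \<in> S" "A \<union> B = far v" "A \<noteq> {}" "B \<noteq> {}" "A \<inter> B = {}"
  shows "\<exists>a\<in>A. \<exists>b\<in>B. E a b"
proof (rule ccontr)
  assume n: "\<not> ?thesis"
  have AB: "A \<subseteq> far v" "B \<subseteq> far v" using assms by auto
  show False
    by (rule no_star_cutset[of v A B]) (use assms AB n in \<open>auto simp: far_def\<close>)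
qed

lemma neighbour_has_far_neighbour:
  assumes "v \<in> S" "x \<in> S" "E v x" shows "\<exists>y\<in>far v. E x y"
proof (rule ccontr)
  assume n: "\<not> ?thesis"
  show False
    by (rule no_star_cutset[of v "{x}" "far v"])
      (use assms n far_nonempty[of v] irr in \<open>auto simp: far_def\<close>)
qed

lemma far_neighbourhoods_comparable:
  assumes "v \<in> S" "x \<in> S" "x' \<in> S" "E v x" "E v x'" "\<not> E x x'"
    "y \<in> far v" "y' \<in> far v" "E x y" "\<not> E x' y" "E x' y'" "\<not> E x y'"
  shows False
proof (cases "E y y'")
  case True
  have f: "\<not> E v y" "\<not> E v y'" "v \<in> S" "y \<in> S" "y' \<in> S" using assms by (auto simp: far_def)
  have "cycle5 E v x y y' x'" unfolding cycle5_def
    using assms(4-6,9-12) True f by (intro conjI) (metis sym)+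
  then show False using c5f assms(2,3) f by (auto simp: c5_free_def)
next
  case False
  have "\<not> E v y" "\<not> E v y'" using assms by (auto simp: far_def)
  then show False using P5[of y x v x' y'] assms False by (metis sym)
qed

lemma neighbourhood_not_clique:
  assumes v: "v \<in> S"
  shows "\<exists>x\<in>S. \<exists>y\<in>S. E v x \<and> E v y \<and> x \<noteq> y \<and> \<not> E x y"
proof (rule ccontr)
  assume n: "\<not> ?thesis"
  have "\<exists>x\<in>S. E v x"
  proof (rule ccontr)
    assume m: "\<not> ?thesis"
    show False by (rule not_disconnected[of "{v}" "far v"]) (use v m far_nonempty[OF v] in \<open>auto simp: far_def\<close>)
  qed
  then obtain x where x: "x \<in> S" "E v x" by blast
  show False
    by (rule no_star_cutset[of x "{v}" "far v"])
      (use v x n far_nonempty[OF v] irr in \<open>auto simp: far_def\<close>)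
qed

lemma dominating_neighbour:
  assumes v: "v \<in> S"
  shows "\<exists>u\<in>S. E v u \<and> (\<forall>y\<in>far v. E u y)"
proof -
  let ?N = "\<lambda>u. {y \<in> far v. E u y}"
  let ?P = "\<lambda>u. u \<in> S \<and> E v u \<and> (\<exists>x\<in>S. E v x \<and> x \<noteq> u \<and> \<not> E u x)"
  have ff: "finite (far v)" using fin by (auto simp: far_def)
  obtain u0 where "?P u0" using neighbourhood_not_clique[OF v] by metis
  then have "\<exists>u. ?P u \<and> (\<forall>u'. ?P u' \<longrightarrow> card (?N u') \<le> card (?N u))"
    by (rule ex_has_greatest_nat[of ?P u0 _ "Suc (card (far v))"])
      (use ff in \<open>auto simp: less_Suc_eq_le intro!: card_mono\<close>)
  then obtain u where u: "?P u" and mx: "\<And>u'. ?P u' \<Longrightarrow> card (?N u') \<le> card (?N u)" by blast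
  show ?thesis
  proof (rule ccontr)
    assume n: "\<not> ?thesis"
    let ?A = "{x \<in> S. E v x \<and> x \<noteq> u \<and> \<not> E u x}" and ?B = "far v - ?N u"
    show False
    proof (rule no_star_cutset[of u ?A ?B])
      show "?B \<noteq> {}" using n u by blast
      show "?A \<noteq> {}" using u by blast
      show "?A \<inter> ?B = {}" by (auto simp: far_def)
      fix a b assume a: "a \<in> ?A" and b: "b \<in> ?B"
      show "\<not> E a b"
      proof
        assume e: "E a b"
        have "?P a" using a u com[of u a] by auto
        then have le: "card (?N a) \<le> card (?N u)" by (rule mx)
        have "\<not> ?N u \<subset> ?N a" using le psubset_card_mono[of "?N a" "?N u"] ff by fastforce
        then obtain y where "y \<in> far v" "E u y" "\<not> E a y" using e b by blast
        then show False using far_neighbourhoods_comparable[of v a u b y] v a u b e com[of u a] by auto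
      qed
    qed (use u v irr com in \<open>auto simp: far_def\<close>)
  qed
qed

definition pair :: "'a \<Rightarrow> 'a \<Rightarrow> bool" where
  "pair u v \<longleftrightarrow> u \<in> S \<and> v \<in> S \<and> E u v \<and> (\<forall>y\<in>far v. E u y) \<and> (\<forall>y\<in>far u. E v y)"

lemma pair_exists: "\<exists>u v. pair u v"
proof -
  obtain v where v: "v \<in> S" using nonempty by auto
  obtain u where u: "u \<in> S" "E v u" "\<forall>y\<in>far v. E u y" using dominating_neighbour[OF v] by blast
  have "\<forall>y\<in>far u. E v y" using u by (auto simp: far_def com)
  then show ?thesis using u v com unfolding pair_def by blast
qed

lemma pair_sym: "pair u v \<Longrightarrow> pair v u"
  by (auto simp: pair_def sym)

lemma common_neighbour_complete_far:
  assumes p: "pair u v" and w: "w \<in> S" "E u w" "E v w" and y: "y \<in> far v"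
  shows "E w y"
proof (rule ccontr)
  assume n: "\<not> E w y"
  have uv: "u \<in> S" "v \<in> S" "E u v" "\<And>y. y \<in> far v \<Longrightarrow> E u y" "\<And>y. y \<in> far u \<Longrightarrow> E v y"
    using p by (auto simp: pair_def)
  obtain r where r: "r \<in> far u" "E w r" using neighbour_has_far_neighbour[of u w] uv w by blast
  let ?A = "{y \<in> far v. E w y}" and ?B = "{y \<in> far v. \<not> E w y}"
  have A: "?A \<noteq> {}" using neighbour_has_far_neighbour[of v w] uv w by blast
  have B: "?B \<noteq> {}" using n y by blast
  obtain y1 y2 where y12: "y1 \<in> far v" "E w y1" "y2 \<in> far v" "\<not> E w y2" "E y1 y2"
    using far_connected[OF uv(2) _ A B] by blast
  have f: "\<not> E v y1" "\<not> E v y2" "\<not> E u r"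
    using y12(1,3) r(1) by (auto simp: far_def)
  have g: "E u y1" "E u y2" "E v r" using uv(4,5) y12(1,3) r(1) by blast+
  have a: "E r y1" using gem[of w r v u y1] r(2) w(2,3) y12(2) f g uv(3) by (metis sym)
  have b: "E r y2" using gem[of y1 r w u y2] a r(2) w(2,3) y12(2,4,5) f g by (metis sym)
  show False using gem[of r v w y1 y2] a b r(2) w(2,3) y12(2,4,5) f g by (metis sym)
qed

lemma no_common_neighbour:
  assumes p: "pair u v" shows "\<not> (w \<in> S \<and> E u w \<and> E v w)"
proof
  assume w: "w \<in> S \<and> E u w \<and> E v w"
  let ?W = "{w \<in> S. E u w \<and> E v w}"
  have uv: "u \<in> S" "v \<in> S" "E u v" "\<And>y. y \<in> far v \<Longrightarrow> E u y" "\<And>y. y \<in> far u \<Longrightarrow> E v y"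
    using p by (auto simp: pair_def)
  have 1: "E w y" if "w \<in> ?W" "y \<in> far v" for w y
    using common_neighbour_complete_far[OF p] that by blast
  have 2: "E w y" if "w \<in> ?W" "y \<in> far u" for w y
    using common_neighbour_complete_far[OF pair_sym[OF p]] that by blast
  show False
  proof (rule not_join[of ?W "S - ?W"])
    show "S - ?W \<noteq> {}" using uv(1) irr by blast
    fix a b assume a: "a \<in> ?W" and b: "b \<in> S - ?W"
    then consider "b = u" | "b = v" | "b \<in> far u" | "b \<in> far v" by (auto simp: far_def)
    then show "E a b" using a 1[of a b] 2[of a b] by cases (auto intro: sym)
  qed (use w in auto)
qed

lemma far_clique:
  assumes p: "pair u v" shows "clique E (far v)"
proof (rule ccontr)
  assume n: "\<not> ?thesis"
  have uv: "u \<in> S" "v \<in> S" "E u v" "\<And>y. y \<in> far v \<Longrightarrow> E u y" "\<And>y. y \<in> far u \<Longrightarrow> E v y"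
    using p by (auto simp: pair_def)
  let ?N = "\<lambda>y. {r \<in> far u. E y r}"
  let ?P = "\<lambda>y. y \<in> far v \<and> (\<exists>x\<in>far v. x \<noteq> y \<and> \<not> E y x)"
  have ff: "finite (far u)" using fin by (auto simp: far_def)
  obtain y0 y1 where "y0 \<in> far v" "y1 \<in> far v" "y0 \<noteq> y1" "\<not> E y0 y1"
    using n by (auto simp: clique_def)
  then have "?P y0" by metis
  then have "\<exists>y. ?P y \<and> (\<forall>y'. ?P y' \<longrightarrow> card (?N y') \<le> card (?N y))"
    by (rule ex_has_greatest_nat[of ?P y0 _ "Suc (card (far u))"])
      (use ff in \<open>auto simp: less_Suc_eq_le intro!: card_mono\<close>)
  then obtain y where y: "?P y" and mx: "\<And>y'. ?P y' \<Longrightarrow> card (?N y') \<le> card (?N y)" by blast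
  let ?A = "{x \<in> far v. x \<noteq> y \<and> \<not> E y x}" and ?B = "{v} \<union> (far u - ?N y)"
  have *: "\<not> E a b" if a: "a \<in> ?A" and b: "b \<in> far u" "\<not> E y b" for a b
  proof
    assume e: "E a b"
    have "\<not> E a y" "a \<in> far v" "y \<noteq> a" using a sym by blast+
    then have "?P a" using y by metis
    then have le: "card (?N a) \<le> card (?N y)" by (rule mx)
    have "\<not> ?N y \<subset> ?N a" using le psubset_card_mono[of "?N a" "?N y"] ff by fastforce
    then obtain r where "r \<in> far u" "E y r" "\<not> E a r" using e b by blast
    moreover have "E u a" "E u y" "a \<in> S" "y \<in> S" using uv(4) a y by (auto simp: far_def)
    moreover have "\<not> E a y" using a sym by blast
    ultimately show False using far_neighbourhoods_comparable[of u a y b r] uv(1) b e by blast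
  qed
  show False
  proof (rule no_star_cutset[of y ?A ?B])
    show "?A \<noteq> {}" using y by blast
    have "E u x \<and> x \<noteq> v" if "x \<in> far v" for x using uv(4) that by (auto simp: far_def)
    then show "?A \<inter> ?B = {}" by (auto simp: far_def)
    fix a b assume "a \<in> ?A" "b \<in> ?B"
    then show "\<not> E a b" using *[of a b] sym[of a b] by (auto simp: far_def)
  next
    fix z assume z: "z \<in> S" "z \<notin> ?A" "z \<notin> ?B"
    show "z = y \<or> E y z"
    proof (cases "E u z \<and> E v z")
      case True then show ?thesis using no_common_neighbour[OF p] z by blast
    next
      case False
      then consider "z = u" | "z \<in> far u" | "z \<in> far v" using z by (auto simp: far_def)
      then show ?thesis
      proof cases
        case 1 then show ?thesis using uv(4)[of y] y sym by blast
      qed (use z in auto)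
    qed
  next
    show "y \<notin> ?B" using uv(4)[of y] y by (auto simp: far_def)
  qed (use y uv(2) in \<open>auto simp: far_def\<close>)
qed

lemma impossible: False
proof -
  obtain u v where p: "pair u v" using pair_exists by blast
  have uv: "u \<in> S" "v \<in> S" "E u v" "\<And>y. y \<in> far v \<Longrightarrow> E u y" "\<And>y. y \<in> far u \<Longrightarrow> E v y"
    using p by (auto simp: pair_def)
  define A where "A = insert u (far v)"
  define B where "B = insert v (far u)"
  have S: "S = A \<union> B"
  proof
    show "S \<subseteq> A \<union> B"
      using no_common_neighbour[OF p] unfolding A_def B_def far_def by blast
    show "A \<union> B \<subseteq> S" using uv(1,2) unfolding A_def B_def far_def by auto
  qed
  have disj: "A \<inter> B = {}"
  proof -
    have "u \<noteq> v" using uv(3) irr by blast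
    moreover have "u \<notin> far u" "v \<notin> far v" by (auto simp: far_def)
    moreover have "x \<notin> far u" if "x \<in> far v" for x using uv(4)[OF that] by (auto simp: far_def)
    ultimately show ?thesis unfolding A_def B_def by blast
  qed
  have cA: "clique E A"
    using far_clique[OF p] uv(4) sym unfolding A_def clique_def by blast
  have cB: "clique E B"
    using far_clique[OF pair_sym[OF p]] uv(5) sym unfolding B_def clique_def by blast
  have fAB: "finite A" "finite B" using fin S by auto
  have kA: "card A \<le> k" "card B \<le> k" using cl cA cB S by auto
  define N where "N = (\<lambda>a. {b \<in> B. E a b})"
  have NB: "N a \<subseteq> B" for a by (auto simp: N_def)
  have Nu: "N u = {v}" using uv(3) unfolding N_def B_def by (auto simp: far_def)
  have Nf: "v \<notin> N y \<and> N y \<noteq> {}" if yf: "y \<in> far v" for y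
  proof -
    have y: "y \<in> S" "\<not> E v y" using yf by (auto simp: far_def)
    obtain r where "r \<in> far u" "E y r"
      using neighbour_has_far_neighbour[OF uv(1) y(1)] uv(4)[OF yf] by blast
    then show ?thesis using y sym unfolding N_def B_def by blast
  qed
  have far_u: "far u \<noteq> {}" "far v \<noteq> {}" using far_nonempty uv(1,2) by auto
  have sub: "N a \<subseteq> N a'" if a: "a \<in> A" "a' \<in> A" and b: "b \<in> N a" "b \<in> N a'" for a a' b
  proof
    fix t assume t: "t \<in> N a"
    show "t \<in> N a'"
    proof (rule ccontr)
      assume n: "t \<notin> N a'"
      have ne: "t \<noteq> b" "a \<noteq> a'" using n t b by auto
      have "a \<noteq> u" using Nu b t ne by auto
      moreover have "a' \<noteq> u"
      proof
        assume "a' = u"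
        then have "b = v" using Nu b by auto
        then show False using Nf[of a] \<open>a \<noteq> u\<close> a b unfolding A_def by auto
      qed
      ultimately have au: "a \<in> far v" "a' \<in> far v" using a unfolding A_def by auto
      then have "b \<noteq> v" "t \<noteq> v" using Nf b t by blast+
      then have bu: "b \<in> far u" "t \<in> far u" using b t NB unfolding B_def by auto
      have e: "E a b" "E a' b" "E a t" "\<not> E a' t" using b t n by (auto simp: N_def)
      have "\<not> E b u" "\<not> E t u" using bu sym by (auto simp: far_def)
      moreover have "E a u" "E a' u" using uv(4) au sym by blast+
      moreover have "E t b" "E a a'" using cliqueD[OF cB] cliqueD[OF cA] b t a ne NB by blast+
      ultimately show False using gem[of a t b a' u] e by (metis sym)
    qed
  qed
  have eq: "N a = N a'" if "a \<in> A" "a' \<in> A" "N a \<inter> N a' \<noteq> {}" for a a'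
    using sub that by blast
  define C where "C = (\<lambda>a. {a' \<in> A. N a' = N a})"
  have CA: "C a \<subseteq> A" for a by (auto simp: C_def)
  have fCN: "finite (C a)" "finite (N a)" for a using CA NB fAB finite_subset by metis+
  let ?f = "\<lambda>a. card (C a) + card (N a)"
  have hit: False if ab: "a \<in> A" "b \<in> B" "\<not> E a b"
    and h: "\<And>x. x \<in> A \<Longrightarrow> N x \<noteq> {} \<Longrightarrow> ?f x \<ge> k \<Longrightarrow> N x = N a \<or> b \<in> N x" for a b
  proof (rule no_hitting_stable_set[of "{a, b}"])
    show "{a, b} \<subseteq> S" using ab S by auto
    show "\<not> E x y" if "x \<in> {a, b}" "y \<in> {a, b}" for x y using ab that irr sym by auto
    fix K assume K: "K \<subseteq> S" "clique E K" "card K = k"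
    have fK: "finite K" using K fin finite_subset by blast
    show "K \<inter> {a, b} \<noteq> {}"
    proof (cases "K \<subseteq> A \<or> K \<subseteq> B")
      case True
      then have "K = A \<or> K = B" using K(3) kA fAB by (metis card_seteq)
      then show ?thesis using ab by auto
    next
      case False
      then obtain x y where xy: "x \<in> K" "x \<in> A" "y \<in> K" "y \<in> B" using K(1) S by blast
      have cK: "card K = card (K \<inter> A) + card (K \<inter> B)"
      proof -
        have "K = (K \<inter> A) \<union> (K \<inter> B)" using K(1) S by auto
        moreover have "card ((K \<inter> A) \<union> (K \<inter> B)) = card (K \<inter> A) + card (K \<inter> B)"
          using disj fK by (intro card_Un_disjoint) auto
        ultimately show ?thesis by simp
      qed
      have adj: "E a' b'" if "a' \<in> K \<inter> A" "b' \<in> K \<inter> B" for a' b'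
        using that disj by (intro cliqueD[OF K(2)]) auto
      have sN: "K \<inter> B \<subseteq> N x" using adj xy by (auto simp: N_def)
      have sC: "K \<inter> A \<subseteq> C x"
      proof
        fix a' assume a': "a' \<in> K \<inter> A"
        have "y \<in> N a'" "y \<in> N x" using adj xy a' by (auto simp: N_def)
        then have "N a' = N x" using eq[of a' x] xy a' by blast
        then show "a' \<in> C x" using a' by (auto simp: C_def)
      qed
      have "card (K \<inter> A) \<le> card (C x)" "card (K \<inter> B) \<le> card (N x)"
        using sN sC fCN by (auto intro: card_mono)
      then have tight: "?f x \<ge> k" using cK K(3) by linarith
      have clx: "clique E (C x \<union> N x)"
      proof -
        have e: "E p q" if "p \<in> C x" "q \<in> N x" for p q
        proof -
          have "q \<in> N p" using that by (auto simp: C_def)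
          then show ?thesis by (simp add: N_def)
        qed
        show ?thesis unfolding clique_def
        proof (intro ballI impI)
          fix p q assume pq: "p \<in> C x \<union> N x" "q \<in> C x \<union> N x" "p \<noteq> q"
          then consider "p \<in> C x" "q \<in> C x" | "p \<in> N x" "q \<in> N x" | "p \<in> C x" "q \<in> N x" | "p \<in> N x" "q \<in> C x"
            by blast
          then show "E p q"
            using cliqueD[OF cA, of p q] cliqueD[OF cB, of p q] CA[of x] NB[of x] e[of p q] e[of q p] sym pq(3)
            by cases blast+
        qed
      qed
      have dCN: "C x \<inter> N x = {}" using CA NB disj by blast
      have "card (C x \<union> N x) \<le> k" using clx S CA[of x] NB[of x] by (intro cl) auto
      then have "?f x \<le> k" using card_Un_disjoint[OF fCN dCN] by simp
      then have "card (K \<inter> A) = card (C x)" "card (K \<inter> B) = card (N x)"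
        using \<open>card (K \<inter> A) \<le> card (C x)\<close> \<open>card (K \<inter> B) \<le> card (N x)\<close> cK K(3) by linarith+
      then have Keq: "K \<inter> A = C x" "K \<inter> B = N x"
        using sN sC fCN by (metis card_subset_eq)+
      have "N x \<noteq> {}" using adj xy by (auto simp: N_def)
      then have "N x = N a \<or> b \<in> N x" using h tight xy(2) by blast
      then show ?thesis
      proof
        assume "N x = N a"
        then have "a \<in> C x" using ab by (auto simp: C_def)
        then show ?thesis using Keq by blast
      next
        assume "b \<in> N x" then show ?thesis using Keq by blast
      qed
    qed
  qed simp
  have nonadj: "\<exists>b\<in>B. \<not> E a b" if "a \<in> A" for a
  proof (cases "a = u")
    case True
    obtain b where "b \<in> far u" using far_u by blast
    then show ?thesis using True unfolding B_def by (auto simp: far_def)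
  next
    case False
    then have "v \<notin> N a" using that Nf[of a] unfolding A_def by auto
    then show ?thesis unfolding N_def B_def by blast
  qed
  let ?t = "\<lambda>x. x \<in> A \<and> N x \<noteq> {} \<and> ?f x \<ge> k"
  show False
  proof (cases "\<exists>x. ?t x")
    case False
    have uA: "u \<in> A" by (simp add: A_def)
    obtain b where "b \<in> B" "\<not> E u b" using nonadj[OF uA] by blast
    then show False using hit[OF uA] False by blast
  next
    case True
    then obtain x where x: "?t x" by blast
    then have xA: "x \<in> A" by blast
    show False
    proof (cases "\<exists>y. ?t y \<and> N y \<noteq> N x")
      case False
      obtain b where "b \<in> B" "\<not> E x b" using nonadj[OF xA] by blast
      then show False using hit[OF xA] False by blast
    next
      case True
      then obtain y where y: "?t y" "N y \<noteq> N x" by blast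
      then obtain b where b: "b \<in> N y" by blast
      have bx: "b \<notin> N x" using eq[of x y] x y b by blast
      show False
      proof (rule hit[of x b])
        show "b \<in> B" "\<not> E x b" using b bx by (auto simp: N_def)
        fix z assume z: "z \<in> A" "N z \<noteq> {}" "?f z \<ge> k"
        show "N z = N x \<or> b \<in> N z"
        proof (rule ccontr)
          assume n: "\<not> ?thesis"
          then have zy: "N z \<noteq> N y" using b by blast
          have dN: "N z \<inter> N y = {}" "N z \<inter> N x = {}" "N y \<inter> N x = {}"
            using eq[of z y] eq[of z x] eq[of y x] x y z n zy by blast+
          have dC: "C z \<inter> C y = {}" "C z \<inter> C x = {}" "C y \<inter> C x = {}"
            using n zy y(2) by (auto simp: C_def)
          have three: "card X + card Y + card W \<le> card U"
            if "X \<inter> Y = {}" "X \<inter> W = {}" "Y \<inter> W = {}" "X \<subseteq> U" "Y \<subseteq> U" "W \<subseteq> U" "finite U" for X Y W U :: "'a set"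
          proof -
            have f: "finite X" "finite Y" "finite W" using that finite_subset by metis+
            have "card (X \<union> Y \<union> W) = card X + card Y + card W"
              using f that by (simp add: card_Un_disjoint Int_Un_distrib2)
            moreover have "card (X \<union> Y \<union> W) \<le> card U" using that by (intro card_mono) auto
            ultimately show ?thesis by simp
          qed
          have "card (C z) + card (C y) + card (C x) \<le> card A"
            by (rule three) (use dC CA fAB in auto)
          moreover have "card (N z) + card (N y) + card (N x) \<le> card B"
            by (rule three) (use dN NB fAB in auto)
          ultimately show False using kA x y z k_pos by linarith
        qed
      qed (use xA in auto)
    qed
  qed
qed

end

lemma (in P5_gem_free_graph) perfect:
  assumes "finite S" "c5_free E S" "\<And>K. K \<subseteq> S \<Longrightarrow> clique E K \<Longrightarrow> card K \<le> k"
  shows "col E S k"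
  using assms
proof (induction "card S" arbitrary: S k rule: less_induct)
  case less
  show ?case
  proof (rule ccontr)
    assume n: "\<not> col E S k"
    have "minimal_imperfect E S k"
    proof unfold_locales
      fix T j assume T: "T \<subset> S" and j: "\<And>K. K \<subseteq> T \<Longrightarrow> clique E K \<Longrightarrow> card K \<le> j"
      show "col E T j"
      proof (rule less.hyps)
        show "card T < card S" using T less.prems(1) by (rule psubset_card_mono[rotated])
        show "finite T" using T less.prems(1) by (meson finite_subset psubset_imp_subset)
        show "c5_free E T" using T less.prems(2) unfolding c5_free_def by blast
      qed (use j in blast)
    qed (use less.prems n in auto)
    then show False by (rule minimal_imperfect.impossible)
  qed
qed

section \<open>Vertex-critical graphs and induced five-cycles\<close>

lemma inj_into_palette:
  assumes "finite Q" "finite P" "card Q \<le> card P"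
  obtains g :: "'a \<Rightarrow> nat" where "inj_on g Q" "g ` Q \<subseteq> P"
  using inj_on_iff_card_le[of Q P] assms by auto

lemma disjoint_subsets_of_cards:
  assumes f: "finite L1" "finite L2" and "n1 \<le> card L1" "n2 \<le> card L2" "n1 + n2 \<le> card (L1 \<union> L2)"
  obtains S1 S2 where "S1 \<subseteq> L1" "S2 \<subseteq> L2" "S1 \<inter> S2 = {}" "card S1 = n1" "card S2 = n2"
proof (cases "n1 \<le> card (L1 - L2)")
  case True
  then obtain S1 where "S1 \<subseteq> L1 - L2" "card S1 = n1" by (meson obtain_subset_with_card_n)
  moreover obtain S2 where "S2 \<subseteq> L2" "card S2 = n2" using assms by (meson obtain_subset_with_card_n)
  ultimately show thesis by (intro that[of S1 S2]) auto
next
  case False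
  have c1: "card L1 = card (L1 - L2) + card (L1 \<inter> L2)"
    using f by (metis card_Diff_subset_Int card_mono finite_Int inf_le1 le_add_diff_inverse2)
  have "n1 - card (L1 - L2) \<le> card (L1 \<inter> L2)" using c1 assms(3) by linarith
  then obtain R where R: "R \<subseteq> L1 \<inter> L2" "card R = n1 - card (L1 - L2)" by (meson obtain_subset_with_card_n)
  have fR: "finite R" using R f finite_subset by blast
  have "card (L1 \<union> L2) = card (L1 - L2) + card L2"
    using f by (metis Diff_disjoint Un_Diff_cancel2 card_Un_disjoint finite_Diff inf_commute)
  moreover have "card (L2 - R) = card L2 - card R" using R fR by (intro card_Diff_subset) auto
  ultimately have "n2 \<le> card (L2 - R)" using R(2) assms(5) False by linarith
  then obtain S2 where S2: "S2 \<subseteq> L2 - R" "card S2 = n2" by (meson obtain_subset_with_card_n)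
  have "card ((L1 - L2) \<union> R) = n1"
    using R fR f False by (subst card_Un_disjoint) auto
  then show thesis using R S2 by (intro that[of "(L1 - L2) \<union> R" S2]) auto
qed

lemma col_by_palettes:
  assumes "finite I" "\<And>i. i \<in> I \<Longrightarrow> finite (Q i)" "\<And>i. i \<in> I \<Longrightarrow> finite (P i)"
    and "\<And>i. i \<in> I \<Longrightarrow> card (Q i) \<le> card (P i)" "\<And>i. i \<in> I \<Longrightarrow> P i \<subseteq> {..<k}"
    and cov: "S \<subseteq> (\<Union>i\<in>I. Q i)"
    and dis: "\<And>i j x y. i \<in> I \<Longrightarrow> j \<in> I \<Longrightarrow> i \<noteq> j \<Longrightarrow> x \<in> Q i \<Longrightarrow> y \<in> Q j \<Longrightarrow> E x y \<Longrightarrow> P i \<inter> P j = {}"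
    and irr: "\<And>x. \<not> E x x"
  shows "col E S k"
proof -
  have "\<forall>i\<in>I. \<exists>g. inj_on g (Q i) \<and> g ` Q i \<subseteq> P i"
    using assms inj_into_palette by metis
  then obtain g where g: "\<And>i. i \<in> I \<Longrightarrow> inj_on (g i) (Q i)" "\<And>i. i \<in> I \<Longrightarrow> g i ` Q i \<subseteq> P i"
    by metis
  have "\<forall>x\<in>S. \<exists>i. i \<in> I \<and> x \<in> Q i" using cov by blast
  then obtain h where h: "\<And>x. x \<in> S \<Longrightarrow> h x \<in> I \<and> x \<in> Q (h x)" by metis
  have r: "g (h x) x \<in> P (h x)" if "x \<in> S" for x using h[OF that] g(2)[of "h x"] by blast
  have "proper E S (\<lambda>x. g (h x) x) {..<k}" unfolding proper_def
  proof (intro conjI ballI impI)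
    fix x assume x: "x \<in> S"
    have "P (h x) \<subseteq> {..<k}" using assms(5) h[OF x] by simp
    then show "g (h x) x \<in> {..<k}" using r[OF x] by blast
  next
    fix x y assume xy: "x \<in> S" "y \<in> S" "E x y"
    show "g (h x) x \<noteq> g (h y) y"
    proof (cases "h x = h y")
      case True
      have "x \<noteq> y" using xy irr by blast
      then show ?thesis using g(1)[of "h x"] h xy True by (metis inj_onD)
    next
      case False
      then have "P (h x) \<inter> P (h y) = {}" using dis[of "h x" "h y" x y] h[OF xy(1)] h[OF xy(2)] xy(3) by simp
      then show ?thesis using r[OF xy(1)] r[OF xy(2)] by (metis disjoint_iff)
    qed
  qed
  then show ?thesis by (auto simp: col_def)
qed

lemma cyclically_disjoint_palettes:
  fixes P :: "nat \<Rightarrow> nat set"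
  assumes P: "\<And>i. i < 5 \<Longrightarrow> P i \<subseteq> {..<k}"
    and "P 0 \<inter> P 1 = {}" "P 1 \<inter> P 2 = {}" "P 2 \<inter> P 3 = {}" "P 3 \<inter> P 4 = {}" "P 4 \<inter> P 0 = {}"
  shows "card (P 0) + card (P 1) + card (P 2) + card (P 3) + card (P 4) \<le> 2 * k"
proof -
  have c: "card (P i) = (\<Sum>x<k. if x \<in> P i then 1 else 0)" if "i < 5" for i
  proof -
    have "{x \<in> {..<k}. x \<in> P i} = P i" using P[OF that] by auto
    then show ?thesis by (simp add: sum.If_cases Int_def)
  qed
  have "card (P 0) + card (P 1) + card (P 2) + card (P 3) + card (P 4) =
    (\<Sum>x<k. (if x \<in> P 0 then 1 else 0) + (if x \<in> P 1 then 1 else 0) + (if x \<in> P 2 then 1 else 0)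
       + (if x \<in> P 3 then 1 else 0) + (if x \<in> P 4 then 1 else 0))"
    by (simp add: c sum.distrib)
  also have "\<dots> \<le> (\<Sum>x<k. 2)"
    by (rule sum_mono) (use assms in auto)
  finally show ?thesis by simp
qed

lemma five_cycle_blowup_bound:
  assumes p: "proper E S c {..<k}"
    and sub: "A0 \<union> A1 \<union> A2 \<union> A3 \<union> A4 \<subseteq> S"
    and cl: "clique E (A0 \<union> A1)" "clique E (A1 \<union> A2)" "clique E (A2 \<union> A3)" "clique E (A3 \<union> A4)" "clique E (A4 \<union> A0)"
    and disj: "A0 \<inter> A1 = {}" "A1 \<inter> A2 = {}" "A2 \<inter> A3 = {}" "A3 \<inter> A4 = {}" "A4 \<inter> A0 = {}"
  shows "card A0 + card A1 + card A2 + card A3 + card A4 \<le> 2 * k"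
proof -
  define A where "A = (\<lambda>i::nat. if i = 0 then A0 else if i = 1 then A1 else if i = 2 then A2 else if i = 3 then A3 else A4)"
  define P where "P = (\<lambda>i. c ` A i)"
  have inj: "inj_on c (B \<union> C)" if "clique E (B \<union> C)" "B \<union> C \<subseteq> S" for B C
    using that p proper_inj_on_clique proper_subset by metis
  have d: "c ` B \<inter> c ` C = {}" if "clique E (B \<union> C)" "B \<union> C \<subseteq> S" "B \<inter> C = {}" for B C
    using inj[OF that(1,2)] that(3) by (metis image_empty inj_on_image_Int sup_ge1 sup_ge2)
  have eq: "card (c ` B) = card B" if "clique E (B \<union> C)" "B \<union> C \<subseteq> S" for B C
    using inj[OF that] by (metis card_image inj_on_Un)
  have "card (P 0) + card (P 1) + card (P 2) + card (P 3) + card (P 4) \<le> 2 * k"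
  proof (rule cyclically_disjoint_palettes)
    fix i :: nat assume "i < 5"
    then have "A i \<subseteq> S" using sub by (auto simp: A_def)
    then show "P i \<subseteq> {..<k}" using p by (auto simp: P_def proper_def)
  qed (use d cl disj sub in \<open>auto simp: P_def A_def\<close>)
  moreover have "card (P 0) = card A0" "card (P 1) = card A1" "card (P 2) = card A2" "card (P 3) = card A3" "card (P 4) = card A4"
    unfolding P_def A_def
    using eq[of A0 A1] eq[of A1 A2] eq[of A2 A3] eq[of A3 A4] eq[of A4 A0] cl sub by auto
  ultimately show ?thesis by simp
qed

locale critical_graph = P5_gem_free_graph +
  fixes V :: "'a set"
  assumes finV: "finite V"
    and edgeV: "E x y \<Longrightarrow> x \<in> V"
    and ncol: "\<not> col E V 5"
    and crit: "v \<in> V \<Longrightarrow> col E (V - {v}) 5"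
    and noK6: "K \<subseteq> V \<Longrightarrow> clique E K \<Longrightarrow> card K \<le> 5"
begin

lemma proper_of_inj:
  assumes "inj_on g Q" "g ` Q \<subseteq> P" shows "proper E Q g P"
  unfolding proper_def
proof (intro conjI ballI impI)
  fix u v assume uv: "u \<in> Q" "v \<in> Q" "E u v"
  then have "u \<noteq> v" using irr by blast
  then show "g u \<noteq> g v" using assms(1) uv by (metis inj_onD)
qed (use assms in blast)

lemma edgeV2: "E x y \<Longrightarrow> y \<in> V" using edgeV sym by blast

lemma proper_exists:
  assumes "S \<subseteq> V" "S \<noteq> V" obtains c where "proper E S c {..<5}"
proof -
  obtain v where "v \<in> V" "v \<notin> S" using assms by blast
  then have "col E S 5" using crit[of v] assms col_subset[of E "V - {v}" 5 S] by blast
  then show thesis using that by (auto simp: col_def)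
qed

lemma not_proper: "\<not> proper E V c {..<5}"
  using ncol by (auto simp: col_def)

lemma connected:
  assumes "A \<subseteq> V" "A \<noteq> {}" "A \<noteq> V" obtains a b where "a \<in> A" "b \<in> V - A" "E a b"
proof (rule ccontr)
  assume n: "\<not> thesis"
  obtain c where c: "proper E A c {..<5}" using proper_exists assms by metis
  have "V - A \<subseteq> V" "V - A \<noteq> V" using assms by blast+
  then obtain d where d: "proper E (V - A) d {..<5}" using proper_exists by metis
  have "proper E (A \<union> (V - A)) (\<lambda>x. if x \<in> A then c x else d x) {..<5}"
    by (rule proper_glue[OF c d]) (use n that sym in blast)
  moreover have "A \<union> (V - A) = V" using assms by blast
  ultimately show False using not_proper by simp
qed

lemma c5_free_neighbourhood:
  assumes "\<And>x. x \<in> M \<Longrightarrow> E p x" shows "c5_free E M"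
  unfolding c5_free_def
proof (intro ballI notI)
  fix a b c d e assume m: "a \<in> M" "b \<in> M" "c \<in> M" "d \<in> M" and "cycle5 E a b c d e"
  then show False using gem[of p a b c d] assms by (auto simp: cycle5_def)
qed

lemma module_clique:
  assumes M: "M \<subseteq> V" and f: "c5_free E M"
    and mod: "\<And>v x y. v \<in> V \<Longrightarrow> v \<notin> M \<Longrightarrow> x \<in> M \<Longrightarrow> y \<in> M \<Longrightarrow> E v x \<Longrightarrow> E v y"
  shows "clique E M"
proof -
  have fM: "finite M" using M finV finite_subset by blast
  obtain K where K: "K \<subseteq> M" "clique E K" "\<And>L. L \<subseteq> M \<Longrightarrow> clique E L \<Longrightarrow> card L \<le> card K"
    using max_clique_exists[OF fM, of E] by metis
  have "K = M"
  proof (rule ccontr)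
    assume "K \<noteq> M"
    then have "V - (M - K) \<subseteq> V" "V - (M - K) \<noteq> V" using K M by blast+
    then obtain c where c: "proper E (V - (M - K)) c {..<5}" using proper_exists by metis
    have "card (c ` K) = card K" using proper_card_clique[OF c _ K(2)] K(1) M by auto
    moreover have "col E M (card K)" using perfect[OF fM f] K(3) by blast
    ultimately obtain d where d: "proper E M d (c ` K)"
      using col_imp_proper[of E M "card K" "c ` K"] finite_subset[OF K(1) fM] by auto
    have "proper E (M \<union> (V - M)) (\<lambda>x. if x \<in> M then d x else c x) {..<5}"
    proof (rule proper_glue)
      show "proper E M d {..<5}" using d
        by (rule proper_mono) (use c K(1) M in \<open>auto simp: proper_def\<close>)
      show "proper E (V - M) c {..<5}" using c by (rule proper_subset) auto
      fix a b assume ab: "a \<in> M" "b \<in> V - M" "E a b \<or> E b a"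
      obtain x where x: "x \<in> K" "d a = c x" using d ab by (auto simp: proper_def)
      have "E b x" using mod[of b a x] ab x K(1) sym by blast
      then show "d a \<noteq> c b" using properD[OF c, of b x] x ab K(1) M by auto
    qed
    moreover have "M \<union> (V - M) = V" using M by blast
    ultimately show False using not_proper by simp
  qed
  then show ?thesis using K by simp
qed

definition twins :: "'a \<Rightarrow> 'a set" where
  "twins v = {u \<in> V. u = v \<or> (E u v \<and> (\<forall>x\<in>V. x \<noteq> u \<longrightarrow> x \<noteq> v \<longrightarrow> (E x u \<longleftrightarrow> E x v)))}"

lemma twins_self: "v \<in> V \<Longrightarrow> v \<in> twins v" by (auto simp: twins_def)

lemma twins_sub: "twins v \<subseteq> V" by (auto simp: twins_def)

lemma finite_twins [simp]: "finite (twins v)" using twins_sub finV finite_subset by blast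

lemma twins_E: "u \<in> twins v \<Longrightarrow> u \<noteq> v \<Longrightarrow> E u v" by (auto simp: twins_def)

lemma twins_sym: "v \<in> V \<Longrightarrow> u \<in> twins v \<Longrightarrow> v \<in> twins u"
  unfolding twins_def using sym by blast

lemma twins_uniform1: "u \<in> twins v \<Longrightarrow> x \<noteq> u \<Longrightarrow> x \<noteq> v \<Longrightarrow> E x u \<longleftrightarrow> E x v"
  unfolding twins_def using edgeV by blast

lemma twins_trans:
  assumes "u \<in> twins v" "w \<in> twins u" shows "w \<in> twins v"
proof (cases "u = v \<or> w = u \<or> w = v")
  case True then show ?thesis using assms by (auto simp: twins_def)
next
  case False
  have "E w v" using twins_E[OF assms(2)] twins_uniform1[OF assms(1), of w] False by blast
  moreover have "E x w \<longleftrightarrow> E x v" if "x \<noteq> w" "x \<noteq> v" for x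
  proof (cases "x = u")
    case True
    then show ?thesis using twins_E[OF assms(1)] twins_E[OF assms(2)] False sym by blast
  next
    case False
    then show ?thesis using twins_uniform1[OF assms(2), of x] twins_uniform1[OF assms(1), of x] that by blast
  qed
  ultimately show ?thesis using assms by (auto simp: twins_def)
qed

lemma twins_eq:
  assumes "v \<in> V" "u \<in> twins v" shows "twins u = twins v"
  using twins_trans twins_sym[OF assms] assms(2) by blast

lemma twins_uniform:
  assumes "u \<in> twins v" "w \<in> twins v" "x \<notin> twins v" shows "E x u \<longleftrightarrow> E x w"
proof (cases "v \<in> V")
  case True
  then have "x \<noteq> u" "x \<noteq> w" "x \<noteq> v" using assms twins_self by auto
  then show ?thesis using twins_uniform1 assms by metis
next
  case False
  then show ?thesis using assms edgeV2 twins_E unfolding twins_def by blast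
qed

lemma clique_twins: "clique E (twins v)"
  unfolding clique_def
proof (intro ballI impI)
  fix x y assume a: "x \<in> twins v" "y \<in> twins v" "x \<noteq> y"
  show "E x y"
  proof (cases "x = v \<or> y = v")
    case True then show ?thesis using a twins_E sym by blast
  next
    case False
    then have "E x v" using a twins_E by blast
    then show ?thesis using twins_uniform1[OF a(2), of x] False a(3) by blast
  qed
qed

lemma component_twins:
  assumes S: "S \<subseteq> V" "S \<noteq> V" and xy: "x \<in> S" "y \<in> S" "E x y"
    and uni: "\<And>v u w. v \<in> V \<Longrightarrow> v \<notin> S \<Longrightarrow> u \<in> S \<Longrightarrow> w \<in> S \<Longrightarrow> E u w \<Longrightarrow> E v u \<Longrightarrow> E v w"
  shows "y \<in> twins x"
proof -
  define R where "R = {(u, w). u \<in> S \<and> w \<in> S \<and> E u w}"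
  define K where "K = {u. (x, u) \<in> R\<^sup>*}"
  have KS: "K \<subseteq> S"
  proof
    fix u assume "u \<in> K"
    then have "(x, u) \<in> R\<^sup>*" by (simp add: K_def)
    then show "u \<in> S" using xy(1) by (cases rule: rtranclE) (auto simp: R_def)
  qed
  have xK: "x \<in> K" by (simp add: K_def)
  have step: "w \<in> K" if "u \<in> K" "w \<in> S" "E u w" for u w
    using that KS unfolding K_def R_def by (blast intro: rtrancl_into_rtrancl)
  have fromx: "E v u" if "u \<in> K" "v \<in> V" "v \<notin> S" "E v x" for u v
  proof -
    have "(x, u) \<in> R\<^sup>*" using that by (simp add: K_def)
    then show ?thesis
    proof (induction rule: rtrancl_induct)
      case (step y z) then show ?case using uni[of v y z] that by (auto simp: R_def)
    qed (use that in simp)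
  qed
  have tox: "E v x" if "u \<in> K" "v \<in> V" "v \<notin> S" "E v u" for u v
  proof -
    have "(x, u) \<in> R\<^sup>*" using that by (simp add: K_def)
    then show ?thesis using that(4)
    proof (induction rule: rtrancl_induct)
      case (step y z) then show ?case using uni[of v z y] that sym by (auto simp: R_def)
    qed simp
  qed
  have mod: "E v w" if "v \<in> V" "v \<notin> K" "u \<in> K" "w \<in> K" "E v u" for v u w
  proof -
    have "v \<notin> S" using step[of u v] that sym by blast
    then show ?thesis using fromx[of w v] tox[of u v] that by blast
  qed
  have KV: "K \<subseteq> V" "K \<noteq> {}" "K \<noteq> V" using KS S xK by auto
  obtain p q where pq: "q \<in> K" "p \<in> V - K" "E q p" using connected[OF KV] by metis
  have "E p u" if "u \<in> K" for u using mod[of p q u] pq that sym by blast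
  then have c: "clique E K" using module_clique[OF KV(1)] c5_free_neighbourhood[of K p] mod by blast
  have yK: "y \<in> K" using step xK xy by blast
  have "E z y \<longleftrightarrow> E z x" if "z \<in> V" "z \<noteq> y" "z \<noteq> x" for z
    using mod[of z x y] mod[of z y x] cliqueD[OF c, of z x] cliqueD[OF c, of z y] xK yK that by blast
  then show ?thesis using xy S sym unfolding twins_def by blast
qed

lemma dominated:
  assumes v: "v \<in> V" and K: "K \<subseteq> V" "clique E K" "K \<inter> twins v = {}"
    and dom: "\<And>y x. y \<in> V \<Longrightarrow> y \<notin> twins v \<Longrightarrow> E y v \<Longrightarrow> x \<in> K \<Longrightarrow> E y x"
  shows "card K < card (twins v)"
proof (rule ccontr)
  assume "\<not> ?thesis"
  then have le: "card (twins v) \<le> card K" by simp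
  have fK: "finite K" using K finV finite_subset by blast
  have "V - twins v \<subseteq> V" "V - twins v \<noteq> V" using v twins_self by blast+
  then obtain c where c: "proper E (V - twins v) c {..<5}" using proper_exists by metis
  have "card (c ` K) = card K" using proper_card_clique[OF c _ K(2)] K by blast
  then obtain g where g: "inj_on g (twins v)" "g ` twins v \<subseteq> c ` K"
    using inj_into_palette[of "twins v" "c ` K"] le fK by auto
  have "K \<subseteq> V - twins v" using K by blast
  then have cK: "c ` K \<subseteq> {..<5}" using proper_range[OF c] by blast
  have "proper E (twins v \<union> (V - twins v)) (\<lambda>x. if x \<in> twins v then g x else c x) {..<5}"
  proof (rule proper_glue)
    show "proper E (twins v) g {..<5}" by (rule proper_of_inj[OF g(1)]) (use g(2) cK in blast)
    fix a b assume ab: "a \<in> twins v" "b \<in> V - twins v" "E a b \<or> E b a"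
    obtain x where x: "x \<in> K" "g a = c x" using g(2) ab by blast
    have "E b v" using twins_uniform[of a v v b] ab v twins_self sym by blast
    then have "E b x" using dom ab x by blast
    moreover have "x \<in> V - twins v" using x K by blast
    ultimately show "g a \<noteq> c b" using properD[OF c, of b x] x ab by auto
  qed (rule c)
  moreover have "twins v \<union> (V - twins v) = V" using twins_sub by blast
  ultimately show False using not_proper by simp
qed

lemma no_extension_to_two_cliques:
  assumes Q: "Q1 \<subseteq> V" "Q2 \<subseteq> V" "Q1 \<inter> Q2 = {}"
    and c: "proper E (V - (Q1 \<union> Q2)) c {..<5}"
    and L: "L1 \<subseteq> {..<5}" "L2 \<subseteq> {..<5}"
    and free1: "\<And>x y. x \<in> Q1 \<Longrightarrow> y \<in> V - (Q1 \<union> Q2) \<Longrightarrow> E y x \<Longrightarrow> c y \<notin> L1"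
    and free2: "\<And>x y. x \<in> Q2 \<Longrightarrow> y \<in> V - (Q1 \<union> Q2) \<Longrightarrow> E y x \<Longrightarrow> c y \<notin> L2"
    and n: "card Q1 \<le> card L1" "card Q2 \<le> card L2"
  shows "card (L1 \<union> L2) < card Q1 + card Q2"
proof (rule ccontr)
  assume "\<not> ?thesis"
  then have le: "card Q1 + card Q2 \<le> card (L1 \<union> L2)" by simp
  have fL: "finite L1" "finite L2" using L finite_subset by blast+
  have fQ: "finite Q1" "finite Q2" using Q finV finite_subset by blast+
  obtain S1 S2 where S: "S1 \<subseteq> L1" "S2 \<subseteq> L2" "S1 \<inter> S2 = {}" "card S1 = card Q1" "card S2 = card Q2"
    using disjoint_subsets_of_cards[OF fL n le] by metis
  obtain g1 where g1: "inj_on g1 Q1" "g1 ` Q1 \<subseteq> S1"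
    using inj_into_palette[of Q1 S1] S fL fQ finite_subset by (metis order_refl)
  obtain g2 where g2: "inj_on g2 Q2" "g2 ` Q2 \<subseteq> S2"
    using inj_into_palette[of Q2 S2] S fL fQ finite_subset by (metis order_refl)
  have p1: "proper E Q1 g1 {..<5}" by (rule proper_of_inj[OF g1(1)]) (use g1 S L in blast)
  have p2: "proper E Q2 g2 {..<5}" by (rule proper_of_inj[OF g2(1)]) (use g2 S L in blast)
  have p12: "proper E (Q1 \<union> Q2) (\<lambda>x. if x \<in> Q1 then g1 x else g2 x) {..<5}"
    by (rule proper_glue[OF p1 p2]) (use g1 g2 S in blast)
  have "proper E ((V - (Q1 \<union> Q2)) \<union> (Q1 \<union> Q2))
      (\<lambda>x. if x \<in> V - (Q1 \<union> Q2) then c x else if x \<in> Q1 then g1 x else g2 x) {..<5}"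
  proof (rule proper_glue[OF c p12])
    fix a b assume ab: "a \<in> V - (Q1 \<union> Q2)" "b \<in> Q1 \<union> Q2" "E a b \<or> E b a"
    show "c a \<noteq> (if b \<in> Q1 then g1 b else g2 b)"
    proof (cases "b \<in> Q1")
      case True
      then have "g1 b \<in> L1" using g1 S by blast
      then show ?thesis using free1[of b a] True ab sym by auto
    next
      case False
      then have "g2 b \<in> L2" using g2 S ab by blast
      then show ?thesis using free2[of b a] False ab sym by auto
    qed
  qed
  moreover have "(V - (Q1 \<union> Q2)) \<union> (Q1 \<union> Q2) = V" using Q by blast
  ultimately show False using not_proper by simp
qed

text \<open>For an induced 5-cycle \<open>a b c d e\<close>, the arguments are rotated to single out the first vertex:
  \<open>near\<close> contains \<open>a\<close> itself, and does not prescribe adjacency to \<open>a\<close>.\<close>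

definition near :: "'a \<Rightarrow> 'a \<Rightarrow> 'a \<Rightarrow> 'a \<Rightarrow> 'a \<Rightarrow> 'a set" where
  "near a b c d e = {x \<in> V. E x b \<and> E x e \<and> \<not> E x c \<and> \<not> E x d}"

definition opp :: "'a \<Rightarrow> 'a \<Rightarrow> 'a \<Rightarrow> 'a \<Rightarrow> 'a \<Rightarrow> 'a set" where
  "opp a b c d e = {x \<in> V. E x a \<and> E x c \<and> E x d \<and> \<not> E x b \<and> \<not> E x e}"

definition iso :: "'a \<Rightarrow> 'a \<Rightarrow> 'a \<Rightarrow> 'a \<Rightarrow> 'a \<Rightarrow> 'a set" where
  "iso a b c d e = {x \<in> V. \<not> E x a \<and> \<not> E x b \<and> \<not> E x c \<and> \<not> E x d \<and> \<not> E x e}"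

lemma near_near_adjacent:
  assumes "cycle5 E a b c d e" "x \<in> near a b c d e" "y \<in> near b c d e a"
  shows "E x y"
  using assms P5[of c y a e x]
    P5[of d c y a x]
    com[of a c] com[of a d] com[of a e] com[of a x] com[of c d] com[of c x] com[of c y] com[of d x] com[of d y] com[of e x] com[of x y]
  unfolding near_def opp_def iso_def cycle5_def mem_Collect_eq by sat

lemma near13_not_centre1:
  assumes "cycle5 E a b c d e" "x \<in> near a b c d e" "y \<in> near c d e a b" "E x y"
  shows "\<not> E x a"
  using assms P5[of a x y d c]
    gem[of b a x y c]
    com[of a b] com[of a x] com[of a y] com[of b x] com[of b y] com[of c d]
  unfolding near_def opp_def iso_def cycle5_def mem_Collect_eq by sat

lemma near13_not_centre3:
  assumes "cycle5 E a b c d e" "x \<in> near a b c d e" "y \<in> near c d e a b" "E x y"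
  shows "\<not> E y c"
  using assms P5[of a e x y c]
    gem[of b a x y c]
    com[of a b] com[of a e] com[of a x] com[of a y] com[of b x] com[of b y] com[of c e] com[of e x] com[of e y]
  unfolding near_def opp_def iso_def cycle5_def mem_Collect_eq by sat

lemma near13_uniform:
  assumes "cycle5 E a b c d e" "x \<in> near a b c d e" "x' \<in> near a b c d e" "y \<in> near c d e a b" "E x x'" "E y x"
  shows "E y x'"
  using assms gem[of b a x y c]
    P5[of c d y x x']
    P5[of a e x y c]
    com[of a b] com[of a e] com[of a x] com[of a y] com[of b x] com[of b y] com[of c e] com[of c x] com[of c x'] com[of c y] com[of d x] com[of d x'] com[of d y] com[of e x] com[of e y] com[of x y]
  unfolding near_def opp_def iso_def cycle5_def mem_Collect_eq by sat

lemma near14_uniform: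
  assumes "cycle5 E a b c d e" "x \<in> near a b c d e" "x' \<in> near a b c d e" "y \<in> near d e a b c" "E x x'" "E y x"
  shows "E y x'"
  using assms P5[of d c y x x']
    P5[of a b x y d]
    gem[of e a x y d]
    com[of a x] com[of a y] com[of b x] com[of b y] com[of c d] com[of c x] com[of c x'] com[of c y] com[of d e] com[of d x] com[of d x'] com[of d y] com[of e x] com[of e y] com[of x y]
  unfolding near_def opp_def iso_def cycle5_def mem_Collect_eq by sat

lemma near_iso:
  assumes "cycle5 E a b c d e" "x \<in> near a b c d e" "z \<in> iso a b c d e"
  shows "\<not> E x z"
  using assms P5[of c d e x z]
    com[of c x] com[of c z] com[of d x] com[of d z] com[of e x] com[of e z]
  unfolding near_def opp_def iso_def cycle5_def mem_Collect_eq by sat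

lemma near1_opp1:
  assumes "cycle5 E a b c d e" "x \<in> near a b c d e" "g \<in> opp a b c d e"
  shows "E g x"
  using assms P5[of b x e d g]
    com[of b g] com[of b x] com[of d e] com[of d g] com[of e g] com[of g x]
  unfolding near_def opp_def iso_def cycle5_def mem_Collect_eq by sat

lemma near2_opp1:
  assumes "cycle5 E a b c d e" "x \<in> near b c d e a" "g \<in> opp a b c d e"
  shows "\<not> E g x"
  using assms gem[of g a x c d]
    com[of a x]
  unfolding near_def opp_def iso_def cycle5_def mem_Collect_eq by sat

lemma near5_opp1:
  assumes "cycle5 E a b c d e" "x \<in> near e a b c d" "g \<in> opp a b c d e"
  shows "\<not> E g x"
  using assms gem[of g a x d c]
    com[of a x] com[of c d]
  unfolding near_def opp_def iso_def cycle5_def mem_Collect_eq by sat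

lemma near3_opp1_uniform:
  assumes "cycle5 E a b c d e" "x \<in> near c d e a b" "x' \<in> near c d e a b" "g \<in> opp a b c d e" "E x x'" "E g x"
  shows "E g x'"
  using assms gem[of c b x' d g]
    P5[of e a g x x']
    gem[of d c g x x']
    com[of a g] com[of a x] com[of a x'] com[of b c] com[of b g] com[of b x'] com[of c d] com[of c g] com[of c x] com[of c x'] com[of d g] com[of d x] com[of d x'] com[of e g] com[of e x] com[of e x'] com[of g x']
  unfolding near_def opp_def iso_def cycle5_def mem_Collect_eq by sat

lemma near4_opp1_uniform:
  assumes "cycle5 E a b c d e" "x \<in> near d e a b c" "x' \<in> near d e a b c" "g \<in> opp a b c d e" "E x x'" "E g x"
  shows "E g x'"
  using assms P5[of b a g x x']
    com[of a b] com[of a g] com[of a x] com[of a x'] com[of b g] com[of b x] com[of b x']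
  unfolding near_def opp_def iso_def cycle5_def mem_Collect_eq by sat

lemma iso_opp_uniform:
  assumes "cycle5 E a b c d e" "z \<in> iso a b c d e" "z' \<in> iso a b c d e" "g \<in> opp a b c d e" "E z z'" "E g z"
  shows "E g z'"
  using assms P5[of b a g z z']
    com[of a b] com[of a g] com[of a z] com[of a z'] com[of b g] com[of b z] com[of b z']
  unfolding near_def opp_def iso_def cycle5_def mem_Collect_eq by sat

lemma opp1_opp2:
  assumes "cycle5 E a b c d e" "g \<in> opp a b c d e" "h \<in> opp b c d e a"
  shows False
  using assms gem[of d c g h e]
    P5[of c g a e h]
    com[of a c] com[of a e] com[of a h] com[of c d] com[of c g] com[of c h] com[of d g] com[of d h] com[of e h]
  unfolding near_def opp_def iso_def cycle5_def mem_Collect_eq by sat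

lemma opp1_opp3:
  assumes "cycle5 E a b c d e" "g \<in> opp a b c d e" "h \<in> opp c d e a b"
  shows "\<not> E g h"
  using assms gem[of g a h c d]
    com[of a h]
  unfolding near_def opp_def iso_def cycle5_def mem_Collect_eq by sat

lemma near1_not_3_and_4:
  assumes "cycle5 E a b c d e" "x \<in> near a b c d e" "y \<in> near c d e a b" "w \<in> near d e a b c" "E x y" "E x w"
  shows False
  using assms P5[of b y d e w]
    P5[of a b y d w]
    P5[of a b x w d]
    gem[of x b y w e]
    com[of a w] com[of a x] com[of a y] com[of b w] com[of b x] com[of b y] com[of d w] com[of e w]
  unfolding near_def opp_def iso_def cycle5_def mem_Collect_eq by sat

lemma near13_near24:
  assumes "cycle5 E a b c d e" "x \<in> near a b c d e" "y \<in> near c d e a b" "v \<in> near b c d e a" "w \<in> near d e a b c" "E x y" "E v w"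
  shows False
  using assms P5[of a e x y c]
    P5[of b x e w v]
    gem[of c b v w d]
    P5[of c v a e x]
    gem[of x b y w e]
    gem[of b a x y c]
    P5[of b y d e w]
    P5[of b v w e d]
    P5[of a v w y d]
    P5[of a v c d y]
    P5[of a b y d w]
    gem[of y b x v w]
    com[of a b] com[of a c] com[of a e] com[of a v] com[of a w] com[of a x] com[of a y] com[of b c] com[of b v] com[of b w] com[of b x] com[of b y] com[of c e] com[of c v] com[of c w] com[of c x] com[of c y] com[of d e] com[of d w] com[of d y] com[of e v] com[of e w] com[of e x] com[of e y] com[of v w] com[of v x] com[of v y] com[of w y] com[of x y]
  unfolding near_def opp_def iso_def cycle5_def mem_Collect_eq by sat

lemma near13_near25:
  assumes "cycle5 E a b c d e" "x \<in> near a b c d e" "y \<in> near c d e a b" "v \<in> near b c d e a" "w \<in> near e a b c d" "E x y" "E v w"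
  shows False
  using assms P5[of a e x y c]
    P5[of b v w d e]
    P5[of c v a e x]
    P5[of a w d y x]
    P5[of b c v w e]
    gem[of b a x y c]
    gem[of y b x w d]
    gem[of a b v w e]
    P5[of a v c d y]
    gem[of a b x w v]
    gem[of x b y v w]
    P5[of b x e d w]
    com[of a b] com[of a c] com[of a e] com[of a v] com[of a w] com[of a x] com[of a y] com[of b v] com[of b w] com[of b x] com[of b y] com[of c e] com[of c v] com[of c w] com[of c x] com[of c y] com[of d e] com[of d w] com[of d x] com[of d y] com[of e w] com[of e x] com[of e y] com[of v w] com[of v x] com[of v y] com[of w x] com[of w y] com[of x y]
  unfolding near_def opp_def iso_def cycle5_def mem_Collect_eq by sat

lemma near13_opp1:
  assumes "cycle5 E a b c d e" "x \<in> near a b c d e" "y \<in> near c d e a b" "g \<in> opp a b c d e" "E x y"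
  shows "\<not> E g y"
  using assms P5[of b x e d g]
    gem[of y b x g d]
    com[of b g] com[of b x] com[of d e] com[of d g] com[of e g] com[of g y] com[of x y]
  unfolding near_def opp_def iso_def cycle5_def mem_Collect_eq by sat

lemma near13_opp3:
  assumes "cycle5 E a b c d e" "x \<in> near a b c d e" "y \<in> near c d e a b" "g \<in> opp c d e a b" "E x y"
  shows "\<not> E g x"
  using assms P5[of a e x y c]
    P5[of a g c d y]
    gem[of b a x y c]
    gem[of x b y g e]
    com[of a b] com[of a e] com[of a g] com[of a x] com[of a y] com[of b g] com[of b x] com[of b y] com[of c e] com[of c y] com[of d y] com[of e x] com[of e y] com[of g x] com[of g y]
  unfolding near_def opp_def iso_def cycle5_def mem_Collect_eq by sat

lemma near13_opp4:
  assumes "cycle5 E a b c d e" "x \<in> near a b c d e" "y \<in> near c d e a b" "g \<in> opp d e a b c" "E x y"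
  shows "\<not> E g x"
  using assms gem[of g a b y d]
    P5[of a x y d c]
    gem[of b a x y c]
    gem[of b a g x y]
    com[of a b] com[of a g] com[of a x] com[of a y] com[of b g] com[of b x] com[of b y] com[of c d]
  unfolding near_def opp_def iso_def cycle5_def mem_Collect_eq by sat

lemma near13_opp5:
  assumes "cycle5 E a b c d e" "x \<in> near a b c d e" "y \<in> near c d e a b" "g \<in> opp e a b c d" "E x y"
  shows "\<not> E g y"
  using assms P5[of a e x y c]
    gem[of b a x y c]
    gem[of b c g y x]
    gem[of g c b x e]
    com[of a b] com[of a e] com[of a x] com[of a y] com[of b c] com[of b g] com[of b x] com[of b y] com[of c e] com[of c g] com[of c x] com[of c y] com[of e x] com[of e y] com[of x y]
  unfolding near_def opp_def iso_def cycle5_def mem_Collect_eq by sat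

lemma opp1_near3_or_near4:
  assumes "cycle5 E a b c d e" "x \<in> near c d e a b" "y \<in> near d e a b c" "g \<in> opp a b c d e" "\<not> E g x"
  shows "E g y"
  using assms P5[of b a g d y]
    P5[of a g d x y]
    P5[of b x d e y]
    P5[of a g c y x]
    P5[of a b x d y]
    com[of a b] com[of a g] com[of a x] com[of a y] com[of b g] com[of b x] com[of b y] com[of c x] com[of c y] com[of d x] com[of d y] com[of e y] com[of x y]
  unfolding near_def opp_def iso_def cycle5_def mem_Collect_eq by sat

lemma near13_opp1_iso:
  assumes "cycle5 E a b c d e" "x \<in> near a b c d e" "y \<in> near c d e a b" "z \<in> iso a b c d e" "g \<in> opp a b c d e" "E x y"
  shows "\<not> E g z"
  using assms P5[of a e d y z]
    P5[of a g d y x]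
    gem[of y b x g d]
    P5[of b y d g z]
    P5[of b x e d g]
    com[of a e] com[of a g] com[of a x] com[of a y] com[of a z] com[of b g] com[of b x] com[of b y] com[of b z] com[of d e] com[of d g] com[of d x] com[of d y] com[of d z] com[of e g] com[of e y] com[of e z] com[of g x] com[of g y] com[of x y]
  unfolding near_def opp_def iso_def cycle5_def mem_Collect_eq by sat

lemma near13_opp3_iso:
  assumes "cycle5 E a b c d e" "x \<in> near a b c d e" "y \<in> near c d e a b" "z \<in> iso a b c d e" "g \<in> opp c d e a b" "E x y"
  shows "\<not> E g z"
  using assms P5[of a e x y c]
    P5[of b x e g z]
    gem[of x b y g e]
    gem[of b a x y c]
    P5[of c d e x z]
    P5[of a g c d y]
    com[of a b] com[of a e] com[of a g] com[of a x] com[of a y] com[of b g] com[of b x] com[of b y] com[of b z] com[of c e] com[of c x] com[of c y] com[of c z] com[of d x] com[of d y] com[of d z] com[of e g] com[of e x] com[of e y] com[of e z] com[of g y]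
  unfolding near_def opp_def iso_def cycle5_def mem_Collect_eq by sat

lemma iso_opp1_opp3:
  assumes "cycle5 E a b c d e" "z \<in> iso a b c d e" "g \<in> opp a b c d e" "h \<in> opp c d e a b" "E z h"
  shows "E z g"
  using assms P5[of d g a h z]
    gem[of g a h c d]
    com[of a d] com[of a h] com[of a z] com[of d g] com[of d h] com[of d z] com[of g z] com[of h z]
  unfolding near_def opp_def iso_def cycle5_def mem_Collect_eq by sat

lemma iso_opp3_opp1:
  assumes "cycle5 E a b c d e" "z \<in> iso a b c d e" "g \<in> opp a b c d e" "h \<in> opp c d e a b" "E z g"
  shows "E z h"
  using assms P5[of e h c g z]
    gem[of g a h c d]
    com[of a h] com[of c e] com[of c g] com[of c z] com[of e g] com[of e h] com[of e z] com[of g h] com[of g z] com[of h z]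
  unfolding near_def opp_def iso_def cycle5_def mem_Collect_eq by sat

lemma near13_complete_bipartite:
  assumes "cycle5 E a b c d e" "x \<in> near a b c d e" "x' \<in> near a b c d e" "y \<in> near c d e a b" "y' \<in> near c d e a b" "E x y" "E x y'" "E x' y"
  shows "E x' y'"
  using assms P5[of a x y d c]
    P5[of a e x' y c]
    gem[of b a x y c]
    P5[of a e x y' c]
    P5[of a x y' d c]
    gem[of b x' y x y']
    P5[of a x' y d c]
    P5[of a e x' y y']
    P5[of a e x y c]
    P5[of c d y' x x']
    com[of a b] com[of a e] com[of a x] com[of a x'] com[of a y] com[of a y'] com[of b x] com[of b x'] com[of b y] com[of b y'] com[of c d] com[of c e] com[of c x] com[of c x'] com[of c y'] com[of d x] com[of d x'] com[of d y'] com[of e x] com[of e x'] com[of e y] com[of e y'] com[of x x'] com[of x y] com[of x y'] com[of x' y']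
  unfolding near_def opp_def iso_def cycle5_def mem_Collect_eq by sat

lemma vertex_types:
  assumes "cycle5 E a b c d e" "v \<in> V"
  shows "v \<in> near a b c d e \<or> v \<in> near b c d e a \<or> v \<in> near c d e a b \<or> v \<in> near d e a b c \<or> v \<in> near e a b c d \<or> v \<in> opp a b c d e \<or> v \<in> opp b c d e a \<or> v \<in> opp c d e a b \<or> v \<in> opp d e a b c \<or> v \<in> opp e a b c d \<or> v \<in> iso a b c d e"
  using assms gem[of v c b a e]
    gem[of v a b c d]
    P5[of d e a b v]
    P5[of a e d c v]
    gem[of v b c d e]
    gem[of v b a e d]
    P5[of a b c d v]
    gem[of v a e d c]
    P5[of c d e a v]
    P5[of b a e d v]
    P5[of b c d e v]
    com[of a b] com[of b c] com[of c d] com[of d e] com[of e a] com[of a c] com[of a d] com[of b d] com[of b e] com[of c e] com[of v a] com[of v b] com[of v c] com[of v d] com[of v e]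
  unfolding near_def opp_def iso_def cycle5_def mem_Collect_eq by sat
end

section \<open>Five-cycles with maximal twin classes\<close>

context critical_graph begin

lemma cycle5_rotate: "cycle5 E a b c d e \<Longrightarrow> cycle5 E b c d e a"
  unfolding cycle5_def using sym by blast

lemma cycle5_reflect: "cycle5 E a b c d e \<Longrightarrow> cycle5 E a e d c b"
  unfolding cycle5_def using sym by blast

lemma near_reflect: "near a e d c b = near a b c d e"
  unfolding near_def by auto

lemma opp_reflect: "opp a e d c b = opp a b c d e"
  unfolding opp_def by auto

lemma iso_rotate: "iso b c d e a = iso a b c d e"
  unfolding iso_def by auto

lemma centre_near: "cycle5 E a b c d e \<Longrightarrow> a \<in> near a b c d e"
  unfolding cycle5_def near_def using sym edgeV by blast

lemma near_sub: "near a b c d e \<subseteq> V" and opp_sub: "opp a b c d e \<subseteq> V" and iso_sub: "iso a b c d e \<subseteq> V"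
  by (auto simp: near_def opp_def iso_def)

lemma near_twins:
  assumes H: "cycle5 E a b c d e" and xy: "x \<in> near a b c d e" "y \<in> near a b c d e" "E x y"
  shows "y \<in> twins x"
proof (rule component_twins[of "near a b c d e"])
  note H2 = cycle5_rotate[OF H]
  note H3 = cycle5_rotate[OF H2]
  note H4 = cycle5_rotate[OF H3]
  note H5 = cycle5_rotate[OF H4]
  have "b \<notin> near a b c d e" using irr by (auto simp: near_def)
  moreover have "b \<in> V" using centre_near[OF H2] near_sub by blast
  ultimately show "near a b c d e \<noteq> V" by blast
  fix v u w assume v: "v \<in> V" "v \<notin> near a b c d e" and u: "u \<in> near a b c d e" and w: "w \<in> near a b c d e"
    and uw: "E u w" and vu: "E v u"
  have 2: "v \<in> near b c d e a \<Longrightarrow> E v w" using near_near_adjacent[OF H w] sym by blast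
  have 5: "v \<in> near e a b c d \<Longrightarrow> E v w" using near_near_adjacent[OF H5 _ w] by blast
  have 3: "v \<in> near c d e a b \<Longrightarrow> E v w" using near13_uniform[OF H u w _ uw vu] by blast
  have 4: "v \<in> near d e a b c \<Longrightarrow> E v w" using near14_uniform[OF H u w _ uw vu] by blast
  have d1: "v \<in> opp a b c d e \<Longrightarrow> E v w" using near1_opp1[OF H w] by blast
  have d2: "v \<notin> opp b c d e a" using near5_opp1[OF H2 u] vu by blast
  have d5: "v \<notin> opp e a b c d" using near2_opp1[OF H5 u] vu by blast
  have d3: "v \<in> opp c d e a b \<Longrightarrow> E v w" using near4_opp1_uniform[OF H3 u w _ uw vu] by blast
  have d4: "v \<in> opp d e a b c \<Longrightarrow> E v w" using near3_opp1_uniform[OF H4 u w _ uw vu] by blast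
  have z: "v \<notin> iso a b c d e" using near_iso[OF H u] vu sym by blast
  show "E v w" using vertex_types[OF H v(1)] v(2) 2 3 4 5 d1 d2 d3 d4 d5 z by blast
qed (use xy near_sub in auto)

lemma near_twins_sub:
  assumes H: "cycle5 E a b c d e" and x: "x \<in> near a b c d e"
  shows "twins x \<subseteq> near a b c d e"
proof -
  have far: "v \<notin> twins x" if v: "v = c \<or> v = d" for v
  proof
    assume "v \<in> twins x"
    then have "v = x \<or> E v x" using twins_E by blast
    then show False using v x H sym irr unfolding near_def cycle5_def by blast
  qed
  have b: "b \<notin> twins x"
  proof
    assume t: "b \<in> twins x"
    have "c \<noteq> b" "c \<noteq> x" using H x irr unfolding near_def cycle5_def by blast+
    then show False using twins_uniform1[OF t, of c] H x sym unfolding near_def cycle5_def by blast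
  qed
  have e: "e \<notin> twins x"
  proof
    assume t: "e \<in> twins x"
    have "d \<noteq> e" "d \<noteq> x" using H x irr sym[of c d] unfolding near_def cycle5_def by blast+
    then show False using twins_uniform1[OF t, of d] H x sym unfolding near_def cycle5_def by blast
  qed
  have xx: "x \<in> twins x" using x near_sub twins_self by blast
  show ?thesis
  proof
    fix u assume u: "u \<in> twins x"
    have "E v u \<longleftrightarrow> E v x" if "v \<in> {b, c, d, e}" for v
      using twins_uniform[OF u xx, of v] far b e that by blast
    then show "u \<in> near a b c d e" using x u twins_sub com unfolding near_def by blast
  qed
qed

lemma near_twins_eq:
  assumes H: "cycle5 E a b c d e" "x \<in> near a b c d e" "y \<in> near a b c d e" "y \<notin> twins x"
  shows "\<not> E x y" "twins x \<inter> twins y = {}"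
proof -
  show "\<not> E x y" using near_twins[OF H(1-3)] H(4) by blast
  show "twins x \<inter> twins y = {}"
  proof (rule ccontr)
    assume "twins x \<inter> twins y \<noteq> {}"
    then obtain u where "u \<in> twins x" "u \<in> twins y" by blast
    then have "twins x = twins y" using twins_eq H(2,3) near_sub by (metis subsetD)
    then show False using H(3,4) near_sub twins_self by blast
  qed
qed

definition max_cycle :: "'a \<Rightarrow> 'a \<Rightarrow> 'a \<Rightarrow> 'a \<Rightarrow> 'a \<Rightarrow> bool" where
  "max_cycle a b c d e \<longleftrightarrow> cycle5 E a b c d e \<and>
     (\<forall>x\<in>near a b c d e. card (twins x) \<le> card (twins a)) \<and>
     (\<forall>x\<in>near b c d e a. card (twins x) \<le> card (twins b)) \<and>
     (\<forall>x\<in>near c d e a b. card (twins x) \<le> card (twins c)) \<and>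
     (\<forall>x\<in>near d e a b c. card (twins x) \<le> card (twins d)) \<and>
     (\<forall>x\<in>near e a b c d. card (twins x) \<le> card (twins e))"

lemma max_cycle_cycle: "max_cycle a b c d e \<Longrightarrow> cycle5 E a b c d e"
  by (simp add: max_cycle_def)

lemma max_cycle_max: "max_cycle a b c d e \<Longrightarrow> x \<in> near a b c d e \<Longrightarrow> card (twins x) \<le> card (twins a)"
  by (simp add: max_cycle_def)

lemma max_cycle_rotate: "max_cycle a b c d e \<Longrightarrow> max_cycle b c d e a"
  by (simp add: max_cycle_def cycle5_rotate)

lemma max_cycle_reflect: "max_cycle a b c d e \<Longrightarrow> max_cycle a e d c b"
  by (simp add: max_cycle_def cycle5_reflect near_reflect[of a b c d e] near_reflect[of b c d e a]
      near_reflect[of c d e a b] near_reflect[of d e a b c] near_reflect[of e a b c d])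

lemma near_isolated_twin:
  assumes C: "max_cycle a b c d e" and x: "x \<in> near a b c d e"
    and n: "\<And>y. y \<in> near c d e a b \<Longrightarrow> \<not> E x y" "\<And>y. y \<in> near d e a b c \<Longrightarrow> \<not> E x y"
  shows "x \<in> twins a"
proof (rule ccontr)
  assume nt: "x \<notin> twins a"
  note H = max_cycle_cycle[OF C]
  note H2 = cycle5_rotate[OF H]
  note H3 = cycle5_rotate[OF H2]
  note H4 = cycle5_rotate[OF H3]
  note H5 = cycle5_rotate[OF H4]
  have aX: "a \<in> near a b c d e" by (rule centre_near[OF H])
  have dj: "twins a \<inter> twins x = {}" by (rule near_twins_eq[OF H aX x nt])
  have aV: "a \<in> V" and xV: "x \<in> V" using aX x near_sub by blast+
  have "card (twins a) < card (twins x)"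
  proof (rule dominated[OF xV twins_sub clique_twins dj])
    fix y t assume y: "y \<in> V" "y \<notin> twins x" "E y x" and t: "t \<in> twins a"
    have tX: "t \<in> near a b c d e" using near_twins_sub[OF H aX] t by blast
    have 1: "y \<notin> near a b c d e" using near_twins[OF H x] y sym by blast
    have 2: "y \<in> near b c d e a \<Longrightarrow> E y t" using near_near_adjacent[OF H tX] sym by blast
    have 5: "y \<in> near e a b c d \<Longrightarrow> E y t" using near_near_adjacent[OF H5 _ tX] by blast
    have 3: "y \<notin> near c d e a b" "y \<notin> near d e a b c" using n y sym by blast+
    have d1: "y \<in> opp a b c d e \<Longrightarrow> E y t" using near1_opp1[OF H tX] by blast
    have d2: "y \<notin> opp b c d e a" using near5_opp1[OF H2 x] y by blast
    have d5: "y \<notin> opp e a b c d" using near2_opp1[OF H5 x] y by blast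
    have u: "E y a \<Longrightarrow> y \<notin> twins a \<Longrightarrow> E y t"
      using twins_uniform[of a a t y] t twins_self[OF aV] by blast
    have ny: "y \<notin> twins a" using near_twins_sub[OF H aX] 1 by blast
    have d3: "y \<in> opp c d e a b \<Longrightarrow> E y t" using u ny by (auto simp: opp_def)
    have d4: "y \<in> opp d e a b c \<Longrightarrow> E y t" using u ny by (auto simp: opp_def)
    have z: "y \<notin> iso a b c d e" using near_iso[OF H x] y sym by blast
    show "E y t" using vertex_types[OF H y(1)] 1 2 3 5 d1 d2 d3 d4 d5 z by blast
  qed
  then show False using max_cycle_max[OF C x] by simp
qed

lemma near13_partner_unique:
  assumes H: "cycle5 E a b c d e" and x: "x \<in> near a b c d e"
    and y: "y \<in> near c d e a b" "E x y" and y': "y' \<in> near c d e a b" "E x y'"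
  shows "y' \<in> twins y"
proof (rule ccontr)
  assume nt: "y' \<notin> twins y"
  note H2 = cycle5_rotate[OF H]
  note H3 = cycle5_rotate[OF H2]
  note H4 = cycle5_rotate[OF H3]
  note H5 = cycle5_rotate[OF H4]
  have less: "card (twins y') < card (twins y)"
    if y: "y \<in> near c d e a b" "E x y" and y': "y' \<in> near c d e a b" "E x y'" and nt: "y' \<notin> twins y" for y y'
  proof (rule dominated[OF _ twins_sub clique_twins])
    show "y \<in> V" using y near_sub by blast
    show "twins y' \<inter> twins y = {}" using near_twins_eq(2)[OF H3 y(1) y'(1) nt] by blast
    fix z t assume z: "z \<in> V" "z \<notin> twins y" "E z y" and t: "t \<in> twins y'"
    have 3: "z \<notin> near c d e a b" using near_twins[OF H3 y(1)] z sym by blast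
    have 2: "z \<in> near b c d e a \<Longrightarrow> E z y'" using near_near_adjacent[OF H2 _ y'(1)] by blast
    have 4: "z \<in> near d e a b c \<Longrightarrow> E z y'" using near_near_adjacent[OF H3 y'(1)] sym by blast
    have 1: "z \<in> near a b c d e \<Longrightarrow> E z y'"
      using near13_complete_bipartite[OF H x _ y(1) y'(1) y(2) y'(2) z(3)] by blast
    have 5: "z \<notin> near e a b c d" using near1_not_3_and_4[OF H3 y(1) _ x] y(2) z sym by blast
    have d3: "z \<in> opp c d e a b \<Longrightarrow> E z y'" using near1_opp1[OF H3 y'(1)] by blast
    have d2: "z \<notin> opp b c d e a" using near2_opp1[OF H2 y(1)] z by blast
    have d4: "z \<notin> opp d e a b c" using near5_opp1[OF H4 y(1)] z by blast
    have d1: "z \<notin> opp a b c d e" using near13_opp1[OF H x y(1) _ y(2)] z by blast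
    have d5: "z \<notin> opp e a b c d" using near13_opp5[OF H x y(1) _ y(2)] z by blast
    have iz: "z \<notin> iso a b c d e" using near_iso[OF H3 y(1), of z] z sym by (auto simp: iso_def)
    have "E z y'" using vertex_types[OF H z(1)] 1 2 3 4 5 d1 d2 d3 d4 d5 iz by blast
    moreover have "z \<notin> twins y'" using near_twins_sub[OF H3 y'(1)] 3 by blast
    ultimately show "E z t" using twins_uniform[of y' y' t z] t twins_self y'(1) near_sub by blast
  qed
  have "y \<notin> twins y'" using nt twins_sym y'(1) near_sub by blast
  then show False using less[OF y y' nt] less[OF y' y] by simp
qed

lemma near31_partner_unique:
  assumes H: "cycle5 E a b c d e" and x: "x \<in> near a b c d e" "E x y" and y: "y \<in> near c d e a b"
    and x': "x' \<in> near a b c d e" "E x' y"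
  shows "x' \<in> twins x"
proof -
  have "cycle5 E c b a e d" using cycle5_reflect[OF cycle5_rotate[OF cycle5_rotate[OF H]]] .
  from near13_partner_unique[OF this, of y x x'] show ?thesis
    using assms sym near_reflect[of c d e a b] near_reflect[of a b c d e] by simp
qed

lemma near13_neighbours:
  assumes H: "cycle5 E a b c d e" and x: "x \<in> near a b c d e" and y: "y \<in> near c d e a b" and xy: "E x y"
    and z: "E z x"
  shows "z \<in> twins x \<union> twins y \<union> near b c d e a \<union> near e a b c d \<union> opp a b c d e"
proof -
  note H2 = cycle5_rotate[OF H]
  note H3 = cycle5_rotate[OF H2]
  note H4 = cycle5_rotate[OF H3]
  note H5 = cycle5_rotate[OF H4]
  have zV: "z \<in> V" using edgeV[OF z] .
  have 1: "z \<in> near a b c d e \<Longrightarrow> z \<in> twins x" using near_twins[OF H x] z sym by blast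
  have 3: "z \<in> near c d e a b \<Longrightarrow> z \<in> twins y" using near13_partner_unique[OF H x y xy] z sym by blast
  have 4: "z \<notin> near d e a b c" using near1_not_3_and_4[OF H x y _ xy] z sym by blast
  have d2: "z \<notin> opp b c d e a" using near5_opp1[OF H2 x] z by blast
  have d5: "z \<notin> opp e a b c d" using near2_opp1[OF H5 x] z by blast
  have d3: "z \<notin> opp c d e a b" using near13_opp3[OF H x y _ xy] z by blast
  have d4: "z \<notin> opp d e a b c" using near13_opp4[OF H x y _ xy] z by blast
  have iz: "z \<notin> iso a b c d e" using near_iso[OF H x] z sym by blast
  show ?thesis using vertex_types[OF H zV] 1 3 4 d2 d3 d4 d5 iz by blast
qed

lemma near31_neighbours:
  assumes H: "cycle5 E a b c d e" and x: "x \<in> near a b c d e" and y: "y \<in> near c d e a b" and xy: "E x y"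
    and z: "E z y"
  shows "z \<in> twins x \<union> twins y \<union> near b c d e a \<union> near d e a b c \<union> opp c d e a b"
proof -
  have R: "cycle5 E c b a e d" using cycle5_reflect[OF cycle5_rotate[OF cycle5_rotate[OF H]]] .
  have "z \<in> twins y \<union> twins x \<union> near b a e d c \<union> near d c b a e \<union> opp c b a e d"
    by (rule near13_neighbours[OF R _ _ sym[OF xy] z])
      (use x y near_reflect[of c d e a b] near_reflect[of a b c d e] in simp_all)
  then show ?thesis
    using near_reflect[of b c d e a] near_reflect[of d e a b c] opp_reflect[of c d e a b] by auto
qed

lemma near13_centre_not_twin:
  assumes H: "cycle5 E a b c d e" and x: "x \<in> near a b c d e" and y: "y \<in> near c d e a b" and xy: "E x y"
  shows "x \<notin> twins a" "y \<notin> twins c"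
proof -
  note H3 = cycle5_rotate[OF cycle5_rotate[OF H]]
  have "x \<noteq> a" using xy y sym by (auto simp: near_def)
  then show "x \<notin> twins a" using near13_not_centre1[OF H x y xy] twins_E by blast
  have "y \<noteq> c" using xy x by (auto simp: near_def)
  then show "y \<notin> twins c" using near13_not_centre3[OF H x y xy] twins_E by blast
qed

lemma near13_palette_bound:
  assumes C: "max_cycle a b c d e" and x: "x \<in> near a b c d e" and y: "y \<in> near c d e a b" and xy: "E x y"
    and k: "proper E (V - (twins x \<union> twins y)) k {..<5}"
  shows "card (({..<5} - k ` (near b c d e a \<union> near e a b c d \<union> opp a b c d e)) \<union>
               ({..<5} - k ` (near b c d e a \<union> near d e a b c \<union> opp c d e a b)))
         < card (twins x) + card (twins y)"
proof -
  note H = max_cycle_cycle[OF C]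
  note H2 = cycle5_rotate[OF H]
  note H3 = cycle5_rotate[OF H2]
  note H4 = cycle5_rotate[OF H3]
  note H5 = cycle5_rotate[OF H4]
  have aX: "a \<in> near a b c d e" and cX: "c \<in> near c d e a b" by (rule centre_near[OF H] centre_near[OF H3])+
  have dj: "near a b c d e \<inter> near c d e a b = {}" using H unfolding near_def cycle5_def by blast
  have tX: "twins a \<subseteq> near a b c d e" "twins x \<subseteq> near a b c d e" "twins c \<subseteq> near c d e a b" "twins y \<subseteq> near c d e a b"
    using near_twins_sub[OF H] near_twins_sub[OF H3] x y aX cX by blast+
  have ta: "twins a \<subseteq> V - (twins x \<union> twins y)" "twins c \<subseteq> V - (twins x \<union> twins y)"
    using near_twins_eq(2)[OF H aX x] near_twins_eq(2)[OF H3 cX y] near13_centre_not_twin[OF H x y xy] tX dj twins_sub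
    by blast+
  let ?L1 = "{..<5} - k ` (near b c d e a \<union> near e a b c d \<union> opp a b c d e)"
  let ?L2 = "{..<5} - k ` (near b c d e a \<union> near d e a b c \<union> opp c d e a b)"
  have dX: "near a b c d e \<inter> (near b c d e a \<union> near e a b c d \<union> opp a b c d e \<union> near d e a b c \<union> opp c d e a b) = {}"
    "near c d e a b \<inter> (near b c d e a \<union> near e a b c d \<union> opp a b c d e \<union> near d e a b c \<union> opp c d e a b) = {}"
    using irr unfolding near_def opp_def by blast+
  let ?W = "near b c d e a \<union> near e a b c d \<union> opp a b c d e \<union> near d e a b c \<union> opp c d e a b"
  have WV: "?W \<subseteq> V - (twins x \<union> twins y)" using dX tX near_sub opp_sub by blast
  have "k ` twins a \<subseteq> ?L1"
  proof
    fix q assume "q \<in> k ` twins a"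
    then obtain t where t: "t \<in> twins a" "q = k t" by blast
    have nk: "k t \<noteq> k w" if "w \<in> near b c d e a \<union> near e a b c d \<union> opp a b c d e" for w
    proof -
      have "E t w" using near_near_adjacent[OF H, of t w] near_near_adjacent[OF H5, of w t] near1_opp1[OF H, of t w]
        t tX that sym by blast
      then show ?thesis using properD[OF k, of t w] t ta that WV by blast
    qed
    have "q \<in> {..<5}" using proper_range[OF k] t ta by blast
    then show "q \<in> ?L1" unfolding t(2) using nk by (metis DiffI imageE)
  qed
  moreover have "card (k ` twins a) = card (twins a)" by (rule proper_card_clique[OF k ta(1) clique_twins])
  ultimately have n1: "card (twins x) \<le> card ?L1"
    using max_cycle_max[OF C x] card_mono[of ?L1 "k ` twins a"] by simp
  have "k ` twins c \<subseteq> ?L2"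
  proof
    fix q assume "q \<in> k ` twins c"
    then obtain t where t: "t \<in> twins c" "q = k t" by blast
    have nk: "k t \<noteq> k w" if "w \<in> near b c d e a \<union> near d e a b c \<union> opp c d e a b" for w
    proof -
      have "E t w" using near_near_adjacent[OF H3, of t w] near_near_adjacent[OF H2, of w t] near1_opp1[OF H3, of t w]
        t tX that sym by blast
      then show ?thesis using properD[OF k, of t w] t ta that WV by blast
    qed
    have "q \<in> {..<5}" using proper_range[OF k] t ta by blast
    then show "q \<in> ?L2" unfolding t(2) using nk by (metis DiffI imageE)
  qed
  moreover have "card (k ` twins c) = card (twins c)" by (rule proper_card_clique[OF k ta(2) clique_twins])
  ultimately have n2: "card (twins y) \<le> card ?L2"
    using max_cycle_max[OF max_cycle_rotate[OF max_cycle_rotate[OF C]] y] card_mono[of ?L2 "k ` twins c"] by simp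
  have xV: "x \<in> V" "y \<in> V" using x y near_sub by blast+
  show ?thesis
  proof (rule no_extension_to_two_cliques[OF twins_sub twins_sub _ k _ _ _ _ n1 n2])
    show "twins x \<inter> twins y = {}" using tX dj by blast
    fix u v assume u: "u \<in> twins x" and v: "v \<in> V - (twins x \<union> twins y)" "E v u"
    have "E v x" using twins_uniform[of u x x v] u v twins_self[OF xV(1)] by blast
    then have "v \<in> near b c d e a \<union> near e a b c d \<union> opp a b c d e"
      using near13_neighbours[OF H x y xy] v by blast
    then show "k v \<notin> ?L1" by blast
  next
    fix u v assume u: "u \<in> twins y" and v: "v \<in> V - (twins x \<union> twins y)" "E v u"
    have "E v y" using twins_uniform[of u y y v] u v twins_self[OF xV(2)] by blast
    then have "v \<in> near b c d e a \<union> near d e a b c \<union> opp c d e a b"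
      using near31_neighbours[OF H x y xy] v by blast
    then show "k v \<notin> ?L2" by blast
  qed auto
qed

end

section \<open>Adjacent vertices near two opposite cycle vertices\<close>

lemma (in P5_gem_free_graph) col_by_palette_list:
  assumes "\<And>Q P. (Q, P) \<in> set qs \<Longrightarrow> finite Q \<and> finite P \<and> card Q \<le> card P \<and> P \<subseteq> {..<k}"
    and "S \<subseteq> (\<Union>(Q, P)\<in>set qs. Q)"
    and "sorted_wrt (\<lambda>(Q, P) (Q', P'). P \<inter> P' = {} \<or> (\<forall>x\<in>Q. \<forall>y\<in>Q'. \<not> E x y)) qs"
  shows "col E S k"
proof (rule col_by_palettes[of "{..<length qs}" "\<lambda>i. fst (qs ! i)" "\<lambda>i. snd (qs ! i)"])
  show "finite {..<length qs}" by simp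
  have m: "(fst (qs ! i), snd (qs ! i)) \<in> set qs" if "i \<in> {..<length qs}" for i using that by simp
  show "finite (fst (qs ! i))" "finite (snd (qs ! i))" "card (fst (qs ! i)) \<le> card (snd (qs ! i))"
    "snd (qs ! i) \<subseteq> {..<k}" if "i \<in> {..<length qs}" for i
    using assms(1)[OF m[OF that]] by auto
  show "S \<subseteq> (\<Union>i\<in>{..<length qs}. fst (qs ! i))"
  proof
    fix x assume "x \<in> S"
    then obtain q where "q \<in> set qs" "x \<in> fst q" using assms(2) by fastforce
    then show "x \<in> (\<Union>i\<in>{..<length qs}. fst (qs ! i))" by (auto simp: in_set_conv_nth)
  qed
  fix i j x y assume ij: "i \<in> {..<length qs}" "j \<in> {..<length qs}" "i \<noteq> j"
    and xy: "x \<in> fst (qs ! i)" "y \<in> fst (qs ! j)" "E x y"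
  have "i < j \<or> j < i" using ij by auto
  then show "snd (qs ! i) \<inter> snd (qs ! j) = {}"
  proof
    assume "i < j"
    then show ?thesis using sorted_wrt_nth_less[OF assms(3), of i j] ij xy by (auto simp: case_prod_beta)
  next
    assume "j < i"
    then show ?thesis using sorted_wrt_nth_less[OF assms(3), of j i] ij xy sym by (auto simp: case_prod_beta)
  qed
qed (use irr in auto)

context critical_graph begin

lemma near2_isolated:
  assumes C: "max_cycle a b c d e" and x: "x \<in> near a b c d e" and y: "y \<in> near c d e a b" and xy: "E x y"
  shows "near b c d e a = twins b"
proof
  note H = max_cycle_cycle[OF C]
  show "near b c d e a \<subseteq> twins b"
  proof
    fix v assume v: "v \<in> near b c d e a"
    show "v \<in> twins b"
      by (rule near_isolated_twin[OF max_cycle_rotate[OF C] v])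
        (use near13_near24[OF H x y v _ xy] near13_near25[OF H x y v _ xy] in blast)+
  qed
  show "twins b \<subseteq> near b c d e a"
    using near_twins_sub[OF cycle5_rotate[OF H] centre_near[OF cycle5_rotate[OF H]]] .
qed

lemma twins_complete:
  assumes "u \<in> twins x" "w \<in> twins y" "x \<in> V" "y \<in> V" "E x y" "twins x \<inter> twins y = {}" shows "E u w"
proof -
  have "y \<notin> twins x" "u \<notin> twins y" using assms twins_self by blast+
  then have "E y u" using twins_uniform[of u x x y] assms twins_self sym by blast
  then show ?thesis using twins_uniform[of w y y u] assms twins_self sym \<open>u \<notin> twins y\<close> by blast
qed

lemma twins_anticomplete:
  assumes "u \<in> twins x" "w \<in> twins y" "x \<in> V" "y \<in> V" "\<not> E x y" "twins x \<inter> twins y = {}" shows "\<not> E u w"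
proof
  assume e: "E u w"
  have "y \<notin> twins x" "u \<notin> twins y" using assms twins_self by blast+
  have "E u y" using twins_uniform[of w y y u] assms twins_self e \<open>u \<notin> twins y\<close> by blast
  then have "E y x" using twins_uniform[of u x x y] assms twins_self sym \<open>y \<notin> twins x\<close> by blast
  then show False using assms sym by blast
qed

lemma clique_Un:
  assumes "clique E A" "clique E B" "\<And>u w. u \<in> A \<Longrightarrow> w \<in> B \<Longrightarrow> E u w"
  shows "clique E (A \<union> B)"
  unfolding clique_def
proof (intro ballI impI)
  fix x y assume "x \<in> A \<union> B" "y \<in> A \<union> B" "x \<noteq> y"
  then show "E x y" using assms(1,2) assms(3)[of x y] assms(3)[of y x] sym cliqueD by (metis UnE)
qed

lemma complete_disjoint: "(\<And>u w. u \<in> A \<Longrightarrow> w \<in> B \<Longrightarrow> E u w) \<Longrightarrow> A \<inter> B = {}"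
  using irr by blast

lemma clique2_bound:
  assumes "A \<subseteq> V" "B \<subseteq> V" "clique E A" "clique E B" "\<And>u w. u \<in> A \<Longrightarrow> w \<in> B \<Longrightarrow> E u w"
  shows "card A + card B \<le> 5"
proof -
  have "card (A \<union> B) \<le> 5" using assms by (intro noK6 clique_Un) auto
  then show ?thesis using complete_disjoint[of A B] assms finV finite_subset card_Un_disjoint by metis
qed

lemma clique3_bound:
  assumes "A \<subseteq> V" "B \<subseteq> V" "D \<subseteq> V" "clique E A" "clique E B" "clique E D"
    and "\<And>u w. u \<in> A \<Longrightarrow> w \<in> B \<Longrightarrow> E u w" "\<And>u w. u \<in> A \<Longrightarrow> w \<in> D \<Longrightarrow> E u w" "\<And>u w. u \<in> B \<Longrightarrow> w \<in> D \<Longrightarrow> E u w"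
  shows "card A + card B + card D \<le> 5"
proof -
  have "card (A \<union> B) + card D \<le> 5"
    by (rule clique2_bound) (use assms in \<open>auto intro: clique_Un\<close>)
  then show ?thesis using complete_disjoint[of A B] assms finV finite_subset card_Un_disjoint by metis
qed

lemma near13_triangle:
  assumes H: "cycle5 E a b c d e" and x: "x \<in> near a b c d e" and y: "y \<in> near c d e a b" and xy: "E x y"
  shows "card (twins b) + card (twins x) + card (twins y) \<le> 5"
proof (rule clique3_bound[OF twins_sub twins_sub twins_sub clique_twins clique_twins clique_twins])
  note H2 = cycle5_rotate[OF H]
  note H3 = cycle5_rotate[OF H2]
  have s: "twins b \<subseteq> near b c d e a" "twins x \<subseteq> near a b c d e" "twins y \<subseteq> near c d e a b"
    using near_twins_sub[OF H2 centre_near[OF H2]] near_twins_sub[OF H x] near_twins_sub[OF H3 y] by auto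
  show "E u w" if "u \<in> twins b" "w \<in> twins x" for u w using near_near_adjacent[OF H, of w u] s that sym by blast
  show "E u w" if "u \<in> twins b" "w \<in> twins y" for u w using near_near_adjacent[OF H2, of u w] s that by blast
  have dj: "near a b c d e \<inter> near c d e a b = {}" using H unfolding near_def cycle5_def by blast
  show "E u w" if "u \<in> twins x" "w \<in> twins y" for u w
    by (rule twins_complete[OF that _ _ xy]) (use x y near_sub s dj in blast)+
qed

lemma near13_cross_colours:
  assumes C: "max_cycle a b c d e" and x: "x \<in> near a b c d e" and y: "y \<in> near c d e a b" and xy: "E x y"
    and u: "u \<in> near e a b c d \<union> opp a b c d e" and w: "w \<in> near d e a b c \<union> opp c d e a b"
    and n: "\<not> E u w"
  shows "u \<in> opp a b c d e \<and> w \<in> opp c d e a b"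
proof -
  note H = max_cycle_cycle[OF C]
  note H3 = cycle5_rotate[OF cycle5_rotate[OF H]]
  note H4 = cycle5_rotate[OF H3]
  have 1: "\<not> (u \<in> near e a b c d \<and> w \<in> near d e a b c)"
    using near_near_adjacent[OF H4, of w u] n sym by blast
  have 2: "\<not> (u \<in> near e a b c d \<and> w \<in> opp c d e a b)"
    using opp1_near3_or_near4[OF H3, of u x w] near13_opp3[OF H x y _ xy, of w] n sym x by blast
  have 3: "\<not> (u \<in> opp a b c d e \<and> w \<in> near d e a b c)"
    using opp1_near3_or_near4[OF H y, of w u] near13_opp1[OF H x y _ xy, of u] n by blast
  show ?thesis using u w 1 2 3 by blast
qed

lemma near13_rest_sub:
  assumes H: "cycle5 E a b c d e" and x: "x \<in> near a b c d e" and y: "y \<in> near c d e a b"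
  shows "near b c d e a \<union> near e a b c d \<union> opp a b c d e \<union> near d e a b c \<union> opp c d e a b \<subseteq> V - (twins x \<union> twins y)"
proof -
  have "near a b c d e \<inter> (near b c d e a \<union> near e a b c d \<union> opp a b c d e \<union> near d e a b c \<union> opp c d e a b) = {}"
    "near c d e a b \<inter> (near b c d e a \<union> near e a b c d \<union> opp a b c d e \<union> near d e a b c \<union> opp c d e a b) = {}"
    using H irr unfolding near_def opp_def cycle5_def by blast+
  then show ?thesis
    using near_twins_sub[OF H x] near_twins_sub[OF cycle5_rotate[OF cycle5_rotate[OF H]] y] near_sub opp_sub by blast
qed

lemma near13_forces_opp:
  assumes C: "max_cycle a b c d e" and x: "x \<in> near a b c d e" and y: "y \<in> near c d e a b" and xy: "E x y"
  shows "opp a b c d e \<noteq> {}" "opp c d e a b \<noteq> {}"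
proof -
  note H = max_cycle_cycle[OF C]
  have "opp a b c d e \<noteq> {} \<and> opp c d e a b \<noteq> {}"
  proof (rule ccontr)
    assume n: "\<not> ?thesis"
    have "x \<in> V" using x near_sub by blast
    then have "V - (twins x \<union> twins y) \<subseteq> V" "V - (twins x \<union> twins y) \<noteq> V" using twins_self by blast+
    then obtain k where k: "proper E (V - (twins x \<union> twins y)) k {..<5}" using proper_exists by metis
    let ?L1 = "{..<5} - k ` (near b c d e a \<union> near e a b c d \<union> opp a b c d e)"
    let ?L2 = "{..<5} - k ` (near b c d e a \<union> near d e a b c \<union> opp c d e a b)"
    have "{..<5} - k ` near b c d e a \<subseteq> ?L1 \<union> ?L2"
    proof
      fix q assume q: "q \<in> {..<5} - k ` near b c d e a"
      show "q \<in> ?L1 \<union> ?L2"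
      proof (rule ccontr)
        assume "q \<notin> ?L1 \<union> ?L2"
        then obtain u w where uw: "u \<in> near e a b c d \<union> opp a b c d e" "w \<in> near d e a b c \<union> opp c d e a b"
          "k u = k w" using q by auto
        then have "\<not> E u w" using properD[OF k, of u w] near13_rest_sub[OF H x y] by blast
        then show False using near13_cross_colours[OF C x y xy uw(1,2)] n by blast
      qed
    qed
    then have "card ({..<5} - k ` near b c d e a) \<le> card (?L1 \<union> ?L2)" by (intro card_mono) auto
    moreover have "card ({..<5::nat} - k ` near b c d e a) \<ge> 5 - card (k ` near b c d e a)"
      using diff_card_le_card_Diff[of "k ` near b c d e a" "{..<5::nat}"] near2_isolated[OF C x y xy] by simp
    moreover have "card (k ` near b c d e a) \<le> card (twins b)"
      using near2_isolated[OF C x y xy] card_image_le[of "twins b" k] by simp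
    ultimately show False
      using near13_palette_bound[OF C x y xy k] near13_triangle[OF H x y xy] by linarith
  qed
  then show "opp a b c d e \<noteq> {}" "opp c d e a b \<noteq> {}" by auto
qed

lemma near13_unique_pair_aux:
  assumes C: "max_cycle a b c d e" and x: "x \<in> near a b c d e" and y: "y \<in> near c d e a b" and xy: "E x y"
    and x': "x' \<in> near a b c d e" and y': "y' \<in> near c d e a b" and xy': "E x' y'"
    and nt: "x' \<notin> twins x" "y' \<notin> twins y" and le: "card (twins x) + card (twins y) \<le> card (twins x') + card (twins y')"
  shows False
proof -
  note H = max_cycle_cycle[OF C]
  note H2 = cycle5_rotate[OF H]
  note H3 = cycle5_rotate[OF H2]
  note H5 = cycle5_rotate[OF cycle5_rotate[OF H3]]
  have xV: "x \<in> V" using x near_sub by blast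
  then have "V - (twins x \<union> twins y) \<subseteq> V" "V - (twins x \<union> twins y) \<noteq> V" using twins_self by blast+
  then obtain k where k: "proper E (V - (twins x \<union> twins y)) k {..<5}" using proper_exists by metis
  let ?U = "V - (twins x \<union> twins y)"
  let ?L1 = "{..<5} - k ` (near b c d e a \<union> near e a b c d \<union> opp a b c d e)"
  let ?L2 = "{..<5} - k ` (near b c d e a \<union> near d e a b c \<union> opp c d e a b)"
  have dj: "near a b c d e \<inter> near c d e a b = {}" using H unfolding near_def cycle5_def by blast
  have s: "twins x \<subseteq> near a b c d e" "twins y \<subseteq> near c d e a b" "twins x' \<subseteq> near a b c d e" "twins y' \<subseteq> near c d e a b"
    using near_twins_sub[OF H] near_twins_sub[OF H3] x y x' y' by blast+
  have U: "twins x' \<subseteq> ?U" "twins y' \<subseteq> ?U"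
    using near_twins_eq(2)[OF H x x' nt(1)] near_twins_eq(2)[OF H3 y y' nt(2)] s dj twins_sub by blast+
  note R = near13_rest_sub[OF H x y]
  have 1: "k ` twins x' \<subseteq> ?L1"
  proof
    fix q assume "q \<in> k ` twins x'"
    then obtain t where t: "t \<in> twins x'" "q = k t" by blast
    have nk: "k t \<noteq> k w" if "w \<in> near b c d e a \<union> near e a b c d \<union> opp a b c d e" for w
    proof -
      have "E t w" using near_near_adjacent[OF H, of t w] near_near_adjacent[OF H5, of w t] near1_opp1[OF H, of t w]
        t s that sym by blast
      then show ?thesis using properD[OF k, of t w] t U that R by blast
    qed
    have "q \<in> {..<5}" using proper_range[OF k] t U by blast
    then show "q \<in> ?L1" unfolding t(2) using nk by (metis DiffI imageE)
  qed
  have 2: "k ` twins y' \<subseteq> ?L2"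
  proof
    fix q assume "q \<in> k ` twins y'"
    then obtain t where t: "t \<in> twins y'" "q = k t" by blast
    have nk: "k t \<noteq> k w" if "w \<in> near b c d e a \<union> near d e a b c \<union> opp c d e a b" for w
    proof -
      have "E t w" using near_near_adjacent[OF H3, of t w] near_near_adjacent[OF H2, of w t] near1_opp1[OF H3, of t w]
        t s that sym by blast
      then show ?thesis using properD[OF k, of t w] t U that R by blast
    qed
    have "q \<in> {..<5}" using proper_range[OF k] t U by blast
    then show "q \<in> ?L2" unfolding t(2) using nk by (metis DiffI imageE)
  qed
  have comp: "E u w" if "u \<in> twins x'" "w \<in> twins y'" for u w
    by (rule twins_complete[OF that _ _ xy']) (use x' y' near_sub s dj in blast)+
  have "k ` twins x' \<inter> k ` twins y' = {}"
  proof (rule ccontr)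
    assume "k ` twins x' \<inter> k ` twins y' \<noteq> {}"
    then obtain u w where "u \<in> twins x'" "w \<in> twins y'" "k u = k w" by (auto simp: image_iff)
    then show False using comp properD[OF k, of u w] U by blast
  qed
  then have "card (k ` twins x' \<union> k ` twins y') = card (twins x') + card (twins y')"
    using proper_card_clique[OF k U(1) clique_twins] proper_card_clique[OF k U(2) clique_twins]
    by (simp add: card_Un_disjoint)
  moreover have "card (k ` twins x' \<union> k ` twins y') \<le> card (?L1 \<union> ?L2)"
    using 1 2 by (intro card_mono) auto
  ultimately show False using near13_palette_bound[OF C x y xy k] le by linarith
qed

lemma near13_unique_pair:
  assumes C: "max_cycle a b c d e" and x: "x \<in> near a b c d e" and y: "y \<in> near c d e a b" and xy: "E x y"
    and x': "x' \<in> near a b c d e" and y': "y' \<in> near c d e a b" and xy': "E x' y'"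
  shows "x' \<in> twins x"
proof (rule ccontr)
  assume nt: "x' \<notin> twins x"
  note H = max_cycle_cycle[OF C]
  note H3 = cycle5_rotate[OF cycle5_rotate[OF H]]
  have V: "x \<in> V" "y \<in> V" "x' \<in> V" "y' \<in> V" using x y x' y' near_sub by blast+
  have nt2: "y' \<notin> twins y"
  proof
    assume t: "y' \<in> twins y"
    have "x' \<notin> near c d e a b" using x' H unfolding near_def cycle5_def by blast
    then have "x' \<notin> twins y" using near_twins_sub[OF H3 y] by blast
    then have "E x' y" using twins_uniform[of y' y y x'] t twins_self V xy' by blast
    then show False using near31_partner_unique[OF H x xy y x'] nt by blast
  qed
  have nt': "x \<notin> twins x'" "y \<notin> twins y'" using nt nt2 twins_sym V by blast+
  show False
  proof (cases "card (twins x) + card (twins y) \<le> card (twins x') + card (twins y')")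
    case True
    then show ?thesis using near13_unique_pair_aux[OF C x y xy x' y' xy' nt nt2] by blast
  next
    case False
    then show ?thesis using near13_unique_pair_aux[OF C x' y' xy' x y xy nt'] by linarith
  qed
qed

end

lemma subset_card_between:
  assumes "I \<subseteq> A" "finite A" "card I \<le> n" "n \<le> card A"
  obtains P where "I \<subseteq> P" "P \<subseteq> A" "card P = n"
proof -
  have fI: "finite I" using assms finite_subset by blast
  have "n - card I \<le> card (A - I)" using assms fI by (simp add: card_Diff_subset)
  then obtain P' where P': "P' \<subseteq> A - I" "card P' = n - card I" by (meson obtain_subset_with_card_n)
  have "finite P'" using P' assms finite_subset by blast
  then have "card (I \<union> P') = n" using P' fI assms(3) by (subst card_Un_disjoint) auto
  then show thesis using that[of "I \<union> P'"] P' assms(1) by blast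
qed

context critical_graph begin

lemma near13_opp_others:
  assumes C: "max_cycle a b c d e" and x: "x \<in> near a b c d e" and y: "y \<in> near c d e a b" and xy: "E x y"
  shows "opp b c d e a = {}" "opp d e a b c = {}" "opp e a b c d = {}"
proof -
  note H = max_cycle_cycle[OF C]
  note H3 = cycle5_rotate[OF cycle5_rotate[OF H]]
  note H5 = cycle5_rotate[OF cycle5_rotate[OF H3]]
  obtain g h where g: "g \<in> opp a b c d e" "h \<in> opp c d e a b" using near13_forces_opp[OF C x y xy] by blast
  show "opp b c d e a = {}" using opp1_opp2[OF H g(1)] by blast
  show "opp d e a b c = {}" using opp1_opp2[OF H3 g(2)] by blast
  show "opp e a b c d = {}" using opp1_opp2[OF H5 _ g(1)] by blast
qed

lemma near13_iso:
  assumes C: "max_cycle a b c d e" and x: "x \<in> near a b c d e" and y: "y \<in> near c d e a b" and xy: "E x y"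
  shows "iso a b c d e = {}"
proof (rule ccontr)
  assume ne: "iso a b c d e \<noteq> {}"
  note H = max_cycle_cycle[OF C]
  note H2 = cycle5_rotate[OF H]
  note H3 = cycle5_rotate[OF H2]
  note H4 = cycle5_rotate[OF H3]
  note H5 = cycle5_rotate[OF H4]
  have "iso a b c d e \<noteq> V" using x near_sub near_def irr H
    unfolding cycle5_def iso_def by (metis (no_types, lifting) edgeV mem_Collect_eq)
  then obtain z v where z: "z \<in> iso a b c d e" and v: "v \<in> V - iso a b c d e" "E z v"
    using connected[OF iso_sub ne] by metis
  have 1: "v \<notin> near a b c d e" using near_iso[OF H _ z] v sym by blast
  have 2: "v \<notin> near b c d e a" using near_iso[OF H2, of v z] z v sym iso_rotate[of b c d e a] by (auto simp: iso_def)
  have 3: "v \<notin> near c d e a b" using near_iso[OF H3, of v z] z v sym by (auto simp: iso_def)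
  have 4: "v \<notin> near d e a b c" using near_iso[OF H4, of v z] z v sym by (auto simp: iso_def)
  have 5: "v \<notin> near e a b c d" using near_iso[OF H5, of v z] z v sym by (auto simp: iso_def)
  have d1: "v \<notin> opp a b c d e" using near13_opp1_iso[OF H x y z _ xy] v sym by blast
  have d3: "v \<notin> opp c d e a b" using near13_opp3_iso[OF H x y z _ xy] v sym by blast
  have vV: "v \<in> V" using v by blast
  show False using vertex_types[OF H vV] 1 2 3 4 5 d1 d3 near13_opp_others[OF C x y xy] v by blast
qed

lemma near13_near4:
  assumes C: "max_cycle a b c d e" and x: "x \<in> near a b c d e" and y: "y \<in> near c d e a b" and xy: "E x y"
  shows "near d e a b c = twins d"
proof
  note C2 = max_cycle_rotate[OF C]
  note C4 = max_cycle_rotate[OF max_cycle_rotate[OF C2]]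
  note H4 = max_cycle_cycle[OF C4]
  note o = near13_opp_others[OF C x y xy]
  show "near d e a b c \<subseteq> twins d"
  proof
    fix v assume v: "v \<in> near d e a b c"
    show "v \<in> twins d"
    proof (rule near_isolated_twin[OF C4 v])
      show "\<not> E v u" if "u \<in> near a b c d e" for u using near13_forces_opp(1)[OF C4 v that] o by blast
      show "\<not> E v u" if "u \<in> near b c d e a" for u using near13_forces_opp(1)[OF C2 that v] o sym by blast
    qed
  qed
  show "twins d \<subseteq> near d e a b c" using near_twins_sub[OF H4 centre_near[OF H4]] .
qed

lemma near13_near1:
  assumes C: "max_cycle a b c d e" and x: "x \<in> near a b c d e" and y: "y \<in> near c d e a b" and xy: "E x y"
  shows "near a b c d e = twins a \<union> twins x"
proof
  note H = max_cycle_cycle[OF C]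
  note C4 = max_cycle_rotate[OF max_cycle_rotate[OF max_cycle_rotate[OF C]]]
  note o = near13_opp_others[OF C x y xy]
  show "near a b c d e \<subseteq> twins a \<union> twins x"
  proof
    fix v assume v: "v \<in> near a b c d e"
    show "v \<in> twins a \<union> twins x"
    proof (cases "\<exists>w\<in>near c d e a b. E v w")
      case True
      then show ?thesis using near13_unique_pair[OF C x y xy v] by blast
    next
      case False
      have "\<not> E v u" if "u \<in> near d e a b c" for u using near13_forces_opp(1)[OF C4 that v] o sym by blast
      then show ?thesis using near_isolated_twin[OF C v] False by blast
    qed
  qed
  show "twins a \<union> twins x \<subseteq> near a b c d e"
    using near_twins_sub[OF H centre_near[OF H]] near_twins_sub[OF H x] by blast
qed

lemma max_cycle_flip: "max_cycle a b c d e \<Longrightarrow> max_cycle c b a e d"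
  by (rule max_cycle_reflect[OF max_cycle_rotate[OF max_cycle_rotate]])

lemma near13_opp1_clique:
  assumes C: "max_cycle a b c d e" and x: "x \<in> near a b c d e" and y: "y \<in> near c d e a b" and xy: "E x y"
  shows "clique E (opp a b c d e)"
proof (rule module_clique[OF opp_sub])
  note H = max_cycle_cycle[OF C]
  note H2 = cycle5_rotate[OF H]
  note H3 = cycle5_rotate[OF H2]
  note H4 = cycle5_rotate[OF H3]
  note H5 = cycle5_rotate[OF H4]
  show "c5_free E (opp a b c d e)"
    by (rule c5_free_neighbourhood[of _ a]) (auto simp: opp_def sym)
  fix v u w assume v: "v \<in> V" "v \<notin> opp a b c d e" and u: "u \<in> opp a b c d e" and w: "w \<in> opp a b c d e"
    and vu: "E v u"
  have yV: "y \<in> V" and cV: "c \<in> V" and dV: "d \<in> V"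
    using y centre_near[OF H3] centre_near[OF H4] near_sub by blast+
  have X3: "near c d e a b = twins c \<union> twins y"
    using near13_near1[OF max_cycle_flip[OF C], of y x] x y sym[OF xy] near_reflect[of c d e a b] near_reflect[of a b c d e]
    by simp
  have 1: "v \<in> near a b c d e \<Longrightarrow> E v w" using near1_opp1[OF H _ w] sym by blast
  have 2: "v \<notin> near b c d e a" using near2_opp1[OF H _ u] vu sym by blast
  have 5: "v \<notin> near e a b c d" using near5_opp1[OF H _ u] vu sym by blast
  have w': "w \<notin> near c d e a b" "w \<notin> near d e a b c" "E w c" "E w d" using w by (auto simp: near_def opp_def)
  have 3: "v \<in> near c d e a b \<Longrightarrow> E v w"
  proof -
    assume v3: "v \<in> near c d e a b"
    have "v \<notin> twins y"
    proof
      assume t: "v \<in> twins y"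
      have "x \<notin> twins y" using X3 x H unfolding near_def cycle5_def by blast
      then have "E x v" using twins_uniform[of y y v x] t twins_self[OF yV] xy by blast
      then show False using near13_opp1[OF H x v3 u] vu sym by blast
    qed
    then have "v \<in> twins c" using X3 v3 by blast
    then have "E w v" using twins_uniform[of c c v w] w' X3 twins_self[OF cV] by blast
    then show ?thesis using sym by blast
  qed
  have 4: "v \<in> near d e a b c \<Longrightarrow> E v w"
    using twins_uniform[of d d v w] w' near13_near4[OF C x y xy] twins_self[OF dV] sym by blast
  have d3: "v \<notin> opp c d e a b" using opp1_opp3[OF H u] vu sym by blast
  show "E v w" using vertex_types[OF H v(1)] v(2) 1 2 3 4 5 d3 near13_opp_others[OF C x y xy]
      near13_iso[OF C x y xy] by blast
qed

lemma near13_recolour: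
  assumes C: "max_cycle a b c d e" and x: "x \<in> near a b c d e" and y: "y \<in> near c d e a b" and xy: "E x y"
  obtains I where "I \<subseteq> {..<5::nat}" "card I \<le> card (opp a b c d e)" "card I \<le> card (opp c d e a b)"
    "6 \<le> card I + card (twins x) + card (twins y)"
proof -
  note H = max_cycle_cycle[OF C]
  note H2 = cycle5_rotate[OF H]
  note H3 = cycle5_rotate[OF H2]
  let ?R = "V - (twins x \<union> twins y)"
  have xV: "x \<in> V" using x near_sub by blast
  then have "?R \<subseteq> V" "?R \<noteq> V" using twins_self by blast+
  then obtain k0 where k0: "proper E ?R k0 {..<5}" using proper_exists by metis
  note R = near13_rest_sub[OF H x y]
  have X2: "near b c d e a = twins b" by (rule near2_isolated[OF C x y xy])
  have X1: "near a b c d e = twins a \<union> twins x" by (rule near13_near1[OF C x y xy])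
  have X3: "near c d e a b = twins c \<union> twins y"
    using near13_near1[OF max_cycle_flip[OF C], of y x] x y sym[OF xy] near_reflect[of c d e a b] near_reflect[of a b c d e]
    by simp
  define I where "I = k0 ` opp a b c d e \<inter> k0 ` opp c d e a b"
  define W where "W = (twins a \<union> twins c) \<inter> ?R"
  define A where "A = {..<5} - k0 ` W"
  have WX: "W \<subseteq> near a b c d e \<union> near c d e a b" using X1 X3 by (auto simp: W_def)
  have IA: "I \<subseteq> A"
  proof
    fix q assume q: "q \<in> I"
    then obtain g h where g: "g \<in> opp a b c d e" "q = k0 g" and h: "h \<in> opp c d e a b" "q = k0 h"
      by (auto simp: I_def)
    have "k0 w \<noteq> q" if w: "w \<in> W" for w
    proof (cases "w \<in> near a b c d e")
      case True
      then have "E g w" using near1_opp1[OF H True g(1)] by blast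
      moreover have "g \<in> ?R" "w \<in> ?R" using g(1) R w by (auto simp: W_def)
      ultimately show ?thesis using properD[OF k0, of g w] g(2) by metis
    next
      case False
      then have w3: "w \<in> near c d e a b" using w WX by blast
      have "E h w" using near1_opp1[OF H3 w3 h(1)] by blast
      moreover have "h \<in> ?R" "w \<in> ?R" using h(1) R w by (auto simp: W_def)
      ultimately show ?thesis using properD[OF k0, of h w] h(2) by metis
    qed
    moreover have "q \<in> {..<5}" using proper_range[OF k0] g R by blast
    ultimately show "q \<in> A" unfolding A_def by blast
  qed
  have bA: "k0 ` twins b \<subseteq> A"
  proof
    fix q assume "q \<in> k0 ` twins b"
    then obtain t where t: "t \<in> near b c d e a" "q = k0 t" using X2 by blast
    have "k0 w \<noteq> q" if w: "w \<in> W" for w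
    proof -
      have "E t w" using near_near_adjacent[OF H, of w t] near_near_adjacent[OF H2, of t w] t w WX sym by blast
      moreover have "t \<in> ?R" "w \<in> ?R" using t(1) R w by (auto simp: W_def)
      ultimately show ?thesis using properD[OF k0, of t w] t(2) by metis
    qed
    moreover have "q \<in> {..<5}" using proper_range[OF k0] t R by blast
    ultimately show "q \<in> A" unfolding A_def by blast
  qed
  have tbR: "twins b \<subseteq> ?R" using R X2 by blast
  have cb: "card (k0 ` twins b) = card (twins b)" by (rule proper_card_clique[OF k0 tbR clique_twins])
  have fA: "finite A" by (simp add: A_def)
  then have fI: "finite I" using IA finite_subset by blast
  have bA': "card (twins b) \<le> card A" using card_mono[OF fA bA] cb by simp
  obtain P where P: "P \<subseteq> A" "card P = card (twins b)" "P \<subseteq> I \<or> I \<subseteq> P"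
  proof (cases "card (twins b) \<le> card I")
    case True
    then obtain P where "P \<subseteq> I" "card P = card (twins b)" by (meson obtain_subset_with_card_n)
    then show ?thesis using that IA by blast
  next
    case False
    then obtain P where "I \<subseteq> P" "P \<subseteq> A" "card P = card (twins b)"
      using subset_card_between[OF IA fA, of "card (twins b)"] bA' by auto
    then show ?thesis using that by blast
  qed
  have fP: "finite P" using P fA finite_subset by blast
  obtain g where g: "inj_on g (twins b)" "g ` twins b \<subseteq> P"
    using inj_into_palette[of "twins b" P] P(2) fP by auto
  define k where "k = (\<lambda>z. if z \<in> twins b then g z else k0 z)"
  have "proper E (twins b \<union> (?R - twins b)) k {..<5}" unfolding k_def
  proof (rule proper_glue)
    have P5: "P \<subseteq> {..<5}" using P(1) A_def by blast
    show "proper E (twins b) g {..<5}" by (rule proper_of_inj[OF g(1)]) (use g P5 in blast)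
    show "proper E (?R - twins b) k0 {..<5}" by (rule proper_subset[OF k0]) blast
    fix t z assume t: "t \<in> twins b" and z: "z \<in> ?R - twins b" "E t z \<or> E z t"
    have tX: "t \<in> near b c d e a" using t X2 by blast
    have zt: "E z t" using z sym by blast
    have zV: "z \<in> V" using z by blast
    have "E z b"
      using twins_uniform[of b b t z] t z zt twins_self centre_near[OF H2] near_sub by blast
    then have "z \<in> near a b c d e \<or> z \<in> near b c d e a \<or> z \<in> near c d e a b"
      using vertex_types[OF H zV] near13_opp_others[OF C x y xy] near13_iso[OF C x y xy]
      by (auto simp: near_def opp_def)
    then have "z \<in> W" using X1 X2 X3 z by (auto simp: W_def)
    moreover have "g t \<in> A" using g t P by blast
    ultimately show "g t \<noteq> k0 z" unfolding A_def by blast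
  qed
  moreover have "twins b \<union> (?R - twins b) = ?R" using tbR by blast
  ultimately have k: "proper E ?R k {..<5}" by simp
  let ?L1 = "{..<5} - k ` (near b c d e a \<union> near e a b c d \<union> opp a b c d e)"
  let ?L2 = "{..<5} - k ` (near b c d e a \<union> near d e a b c \<union> opp c d e a b)"
  have "{..<5} - (P \<union> I) \<subseteq> ?L1 \<union> ?L2"
  proof
    fix q assume q: "q \<in> {..<5} - (P \<union> I)"
    show "q \<in> ?L1 \<union> ?L2"
    proof (rule ccontr)
      assume n: "q \<notin> ?L1 \<union> ?L2"
      have kb: "q \<notin> k ` near b c d e a" using q g X2 by (auto simp: k_def)
      have "q \<in> k ` (near e a b c d \<union> opp a b c d e)" "q \<in> k ` (near d e a b c \<union> opp c d e a b)"
        using q n kb by (simp_all add: image_Un)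
      then obtain u w where uw: "u \<in> near e a b c d \<union> opp a b c d e" "w \<in> near d e a b c \<union> opp c d e a b"
        "k u = q" "k w = q" by (elim imageE) simp
      have "u \<in> ?R" "w \<in> ?R" using uw(1,2) R by blast+
      then have nuw: "\<not> E u w" using properD[OF k, of u w] uw(3,4) by auto
      have o: "u \<in> opp a b c d e" "w \<in> opp c d e a b"
        using near13_cross_colours[OF C x y xy uw(1,2) nuw] by simp_all
      then have "u \<notin> twins b" "w \<notin> twins b" using X2 by (auto simp: near_def opp_def)
      then have "q = k0 u" "q = k0 w" using uw by (auto simp: k_def)
      then have "q \<in> I" unfolding I_def using o by (metis IntI imageI)
      then show False using q by blast
    qed
  qed
  then have "card ({..<5::nat} - (P \<union> I)) \<le> card (?L1 \<union> ?L2)" by (intro card_mono) auto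
  moreover have "card ({..<5::nat} - (P \<union> I)) \<ge> 5 - card (P \<union> I)"
    using diff_card_le_card_Diff[of "P \<union> I" "{..<5::nat}"] fP fI by simp
  ultimately have lt: "5 - card (P \<union> I) < card (twins x) + card (twins y)"
    using near13_palette_bound[OF C x y xy k] by linarith
  have "P \<subseteq> I"
  proof (rule ccontr)
    assume "\<not> P \<subseteq> I"
    then have "P \<union> I = P" using P by blast
    then show False using lt P near13_triangle[OF H x y xy] by simp
  qed
  then have "6 \<le> card I + card (twins x) + card (twins y)" using lt by (simp add: Un_absorb1)
  moreover have "card I \<le> card U" if "I \<subseteq> k0 ` U" "U \<subseteq> V" for U
  proof -
    have "finite U" using that(2) finV finite_subset by blast
    then show ?thesis using card_mono[OF _ that(1)] card_image_le[of U k0] by simp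
  qed
  then have "card I \<le> card (opp a b c d e)" "card I \<le> card (opp c d e a b)"
    using opp_sub unfolding I_def by simp_all
  moreover have "I \<subseteq> {..<5}" using IA A_def by blast
  ultimately show thesis using that by blast
qed

lemma no_near13:
  assumes C: "max_cycle a b c d e" and x: "x \<in> near a b c d e" and y: "y \<in> near c d e a b"
  shows "\<not> E x y"
proof
  assume xy: "E x y"
  note H = max_cycle_cycle[OF C]
  note H2 = cycle5_rotate[OF H]
  note H3 = cycle5_rotate[OF H2]
  note H4 = cycle5_rotate[OF H3]
  note H5 = cycle5_rotate[OF H4]
  have CR: "max_cycle c b a e d" by (rule max_cycle_flip[OF C])
  have yR: "y \<in> near c b a e d" and xR: "x \<in> near a e d c b"
    using x y near_reflect[of c d e a b] near_reflect[of a b c d e] by simp_all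
  note yx = sym[OF xy]
  have X1: "near a b c d e = twins a \<union> twins x" by (rule near13_near1[OF C x y xy])
  have X2: "near b c d e a = twins b" by (rule near2_isolated[OF C x y xy])
  have X3: "near c d e a b = twins c \<union> twins y"
    using near13_near1[OF CR yR xR yx] near_reflect[of c d e a b] by simp
  have X4: "near d e a b c = twins d" by (rule near13_near4[OF C x y xy])
  have X5: "near e a b c d = twins e"
    using near13_near4[OF CR yR xR yx] near_reflect[of e a b c d] by simp
  have D1: "clique E (opp a b c d e)" by (rule near13_opp1_clique[OF C x y xy])
  have D3: "clique E (opp c d e a b)"
    using near13_opp1_clique[OF CR yR xR yx] opp_reflect[of c d e a b] by simp
  have cV: "a \<in> V" "b \<in> V" "c \<in> V" "d \<in> V" "e \<in> V" "x \<in> V" "y \<in> V"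
    using centre_near[OF H] centre_near[OF H2] centre_near[OF H3] centre_near[OF H4] centre_near[OF H5] x y near_sub by blast+
  have pos: "card (twins v) \<ge> 1" if "v \<in> V" for v
    using twins_self[OF that] by (metis One_nat_def Suc_leI card_gt_0_iff empty_iff finite_twins)
  have comp1: "E u w" if "u \<in> opp a b c d e" "w \<in> twins c \<or> w \<in> twins d" for u w
  proof -
    have "E u c" "E u d" "u \<notin> near c d e a b" "u \<notin> near d e a b c" using that by (auto simp: opp_def near_def)
    then show ?thesis using twins_uniform[of c c w u] twins_uniform[of d d w u] that twins_self cV X3 X4 by blast
  qed
  have comp3: "E u w" if "u \<in> opp c d e a b" "w \<in> twins a \<or> w \<in> twins e" for u w
  proof -
    have "E u a" "E u e" "u \<notin> near a b c d e" "u \<notin> near e a b c d" using that by (auto simp: opp_def near_def)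
    then show ?thesis using twins_uniform[of a a w u] twins_uniform[of e e w u] that twins_self cV X1 X5 by blast
  qed
  have b1: "card (opp a b c d e) + card (twins c) + card (twins d) \<le> 5"
    by (rule clique3_bound[OF opp_sub twins_sub twins_sub D1 clique_twins clique_twins])
      (use comp1 near_near_adjacent[OF H3] X3 X4 in blast)+
  have b3: "card (opp c d e a b) + card (twins a) + card (twins e) \<le> 5"
    by (rule clique3_bound[OF opp_sub twins_sub twins_sub D3 clique_twins clique_twins])
      (use comp3 near_near_adjacent[OF H5] X1 X5 sym in blast)+
  have b2: "card (twins b) + card (twins x) + card (twins y) \<le> 5" by (rule near13_triangle[OF H x y xy])
  have m: "card (twins x) \<le> card (twins a)" "card (twins y) \<le> card (twins c)"
    using max_cycle_max[OF C x] max_cycle_max[OF max_cycle_rotate[OF max_cycle_rotate[OF C]] y] by auto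
  obtain I :: "nat set" where I: "card I \<le> card (opp a b c d e)" "card I \<le> card (opp c d e a b)"
    "6 \<le> card I + card (twins x) + card (twins y)"
    using near13_recolour[OF C x y xy] by metis
  note ps = pos[OF cV(2)] pos[OF cV(4)] pos[OF cV(5)]
  have n: "card (opp a b c d e) \<le> 2" "card (opp c d e a b) \<le> 2" "card (twins a) \<le> 2" "card (twins c) \<le> 2"
    "card (twins x) \<le> 2" "card (twins y) \<le> 2" "card (twins b) \<le> 1" "card (twins d) \<le> 1" "card (twins e) \<le> 1"
    using b1 b2 b3 m I ps by linarith+
  let ?qs = "[(twins a, {0,1::nat}), (opp c d e a b, {2,3}), (twins e, {4}), (opp a b c d e, {3,4}),
    (twins c, {0,1}), (twins d, {2}), (twins b, {3}), (twins x, {0,2}), (twins y, {1,4})]"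
  have f: "finite (opp a b c d e)" "finite (opp c d e a b)" by (rule finite_subset[OF opp_sub finV])+
  have "col E V 5"
  proof (rule col_by_palette_list[of ?qs])
    show "finite Q \<and> finite P \<and> card Q \<le> card P \<and> P \<subseteq> {..<5}" if "(Q, P) \<in> set ?qs" for Q P
      using that n f by auto
    show "V \<subseteq> (\<Union>(Q, P)\<in>set ?qs. Q)"
    proof
      fix v assume "v \<in> V"
      from vertex_types[OF H this] show "v \<in> (\<Union>(Q, P)\<in>set ?qs. Q)"
        using X1 X2 X3 X4 X5 near13_opp_others[OF C x y xy] near13_iso[OF C x y xy] by auto
    qed
    have nX: "\<not> E u w" if "u \<in> twins p" "w \<in> twins q" "p \<in> V" "q \<in> V" "\<not> E p q" "p \<notin> twins q" for u w p q
    proof (rule twins_anticomplete[OF that(1-5)])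
      show "twins p \<inter> twins q = {}"
      proof (rule ccontr)
        assume "twins p \<inter> twins q \<noteq> {}"
        then obtain r where "r \<in> twins p" "r \<in> twins q" by blast
        then have "twins p = twins q" using twins_eq that(3,4) by metis
        then show False using that(3,6) twins_self by blast
      qed
    qed
    have dist: "a \<notin> twins c" "a \<notin> twins x" "a \<notin> twins y" "c \<notin> twins x" "c \<notin> twins y"
      "d \<notin> twins x" "e \<notin> twins y"
    proof -
      have "a \<notin> near c d e a b" "c \<notin> near a b c d e" "d \<notin> near a b c d e" "e \<notin> near c d e a b"
        using H irr sym unfolding near_def cycle5_def by blast+
      then show "a \<notin> twins c" "a \<notin> twins y" "c \<notin> twins x" "d \<notin> twins x" "e \<notin> twins y" using X1 X3 by blast+
      show "a \<notin> twins x" "c \<notin> twins y" using near13_centre_not_twin[OF H x y xy] twins_sym cV by blast+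
    qed
    have ad: "\<not> E a c" "\<not> E a x" "\<not> E a y" "\<not> E c x" "\<not> E c y" "\<not> E d x" "\<not> E e y"
      using H x y near13_not_centre1[OF H x y xy] near13_not_centre3[OF H x y xy] sym
      unfolding near_def cycle5_def by blast+
    have ta: "\<not> E u w" if "u \<in> twins a" "w \<in> twins c \<union> twins x \<union> twins y" for u w
      using nX[OF that(1), of w] that(2) cV dist ad by blast
    have tc: "\<not> E u w" if "u \<in> twins c" "w \<in> twins x \<union> twins y" for u w
      using nX[OF that(1), of w] that(2) cV dist ad by blast
    have td: "\<not> E u w" if "u \<in> twins d" "w \<in> twins x" for u w
      using nX[OF that(1), of w] that(2) cV dist ad by blast
    have te: "\<not> E u w" if "u \<in> twins e" "w \<in> twins y" for u w
      using nX[OF that(1), of w] that(2) cV dist ad by blast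
    have d31: "\<not> E u w" if "u \<in> opp c d e a b" "w \<in> opp a b c d e" for u w using opp1_opp3[OF H that(2,1)] sym by blast
    have d3d: "\<not> E u w" if "u \<in> opp c d e a b" "w \<in> twins d" for u w using near2_opp1[OF H3, of w u] that X4 by blast
    have d3b: "\<not> E u w" if "u \<in> opp c d e a b" "w \<in> twins b" for u w using near5_opp1[OF H3, of w u] that X2 by blast
    have d1e: "\<not> E u w" if "u \<in> twins e" "w \<in> opp a b c d e" for u w using near5_opp1[OF H, of u w] that X5 sym by blast
    have d1b: "\<not> E u w" if "u \<in> opp a b c d e" "w \<in> twins b" for u w using near2_opp1[OF H, of w u] that X2 by blast
    have d1y: "\<not> E u w" if "u \<in> opp a b c d e" "w \<in> twins y" for u w
    proof -
      have "x \<notin> twins y" using X3 x H unfolding near_def cycle5_def by blast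
      then have "E x w" using twins_uniform[of y y w x] that(2) twins_self cV xy by blast
      then show ?thesis using near13_opp1[OF H x _ that(1), of w] X3 that(2) by blast
    qed
    have d3x: "\<not> E u w" if "u \<in> opp c d e a b" "w \<in> twins x" for u w
    proof -
      have "y \<notin> twins x" using X1 y H unfolding near_def cycle5_def by blast
      then have "E w y" using twins_uniform[of x x w y] that(2) twins_self cV xy sym by blast
      then show ?thesis using near13_opp3[OF H _ y that(1), of w] X1 that(2) by blast
    qed
    show "sorted_wrt (\<lambda>(Q, P) (Q', P'). P \<inter> P' = {} \<or> (\<forall>x\<in>Q. \<forall>y\<in>Q'. \<not> E x y)) ?qs"
      using ta tc td te d31 d3d d3b d1e d1b d1y d3x by simp
  qed
  then show False using ncol by simp
qed

lemma near_eq_twins: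
  assumes C: "max_cycle a b c d e" shows "near a b c d e = twins a"
proof
  note H = max_cycle_cycle[OF C]
  note C4 = max_cycle_rotate[OF max_cycle_rotate[OF max_cycle_rotate[OF C]]]
  show "near a b c d e \<subseteq> twins a"
  proof
    fix v assume v: "v \<in> near a b c d e"
    show "v \<in> twins a"
      by (rule near_isolated_twin[OF C v])
        (use no_near13[OF C v] no_near13[OF C4 _ v] sym in blast)+
  qed
  show "twins a \<subseteq> near a b c d e" using near_twins_sub[OF H centre_near[OF H]] .
qed

end

section \<open>Neighbours opposite to a cycle vertex and vertices missing the cycle\<close>

context critical_graph begin

definition frame :: "'a \<Rightarrow> 'a \<Rightarrow> 'a \<Rightarrow> 'a \<Rightarrow> 'a \<Rightarrow> bool" where
  "frame a b c d e \<longleftrightarrow> max_cycle a b c d e \<and> opp b c d e a = {} \<and> opp d e a b c = {} \<and> opp e a b c d = {}"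

lemma frame_max_cycle: "frame a b c d e \<Longrightarrow> max_cycle a b c d e"
  by (simp add: frame_def)

lemma frame_flip: "frame a b c d e \<Longrightarrow> frame c b a e d"
  using max_cycle_flip opp_reflect[of b c d e a] opp_reflect[of d e a b c] opp_reflect[of e a b c d]
  by (simp add: frame_def)

lemma frame_exists_opp1:
  assumes C: "max_cycle a b c d e" and g: "g \<in> opp a b c d e"
  shows "\<exists>a b c d e. frame a b c d e"
proof -
  note H = max_cycle_cycle[OF C]
  note C4 = max_cycle_rotate[OF max_cycle_rotate[OF max_cycle_rotate[OF C]]]
  note H3 = cycle5_rotate[OF cycle5_rotate[OF H]]
  note H5 = cycle5_rotate[OF cycle5_rotate[OF H3]]
  have 2: "opp b c d e a = {}" using opp1_opp2[OF H g] by blast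
  have 5: "opp e a b c d = {}" using opp1_opp2[OF H5 _ g] by blast
  show ?thesis
  proof (cases "opp d e a b c = {}")
    case True then show ?thesis using C 2 5 frame_def by blast
  next
    case False
    then have "opp c d e a b = {}" using opp1_opp2[OF H3] by blast
    then have "frame d e a b c" using C4 2 5 frame_def by blast
    then show ?thesis by blast
  qed
qed

lemma frame_exists:
  assumes C: "max_cycle a b c d e" shows "\<exists>a b c d e. frame a b c d e"
proof (cases "frame a b c d e")
  case False
  note C2 = max_cycle_rotate[OF C]
  note C4 = max_cycle_rotate[OF max_cycle_rotate[OF C2]]
  have "opp b c d e a \<noteq> {} \<or> opp d e a b c \<noteq> {} \<or> opp e a b c d \<noteq> {}"
    using False C frame_def by blast
  then show ?thesis
    using frame_exists_opp1[OF C2] frame_exists_opp1[OF C4] frame_exists_opp1[OF max_cycle_rotate[OF C4]] by blast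
qed blast

lemma frame_types:
  assumes F: "frame a b c d e" and v: "v \<in> V"
  shows "v \<in> near a b c d e \<or> v \<in> near b c d e a \<or> v \<in> near c d e a b \<or> v \<in> near d e a b c
    \<or> v \<in> near e a b c d \<or> v \<in> opp a b c d e \<or> v \<in> opp c d e a b \<or> v \<in> iso a b c d e"
  using vertex_types[OF max_cycle_cycle[OF frame_max_cycle[OF F]] v] F unfolding frame_def by blast

lemma opp1_complete:
  assumes C: "max_cycle a b c d e" and g: "g \<in> opp a b c d e"
    and w: "w \<in> near a b c d e \<or> w \<in> near c d e a b \<or> w \<in> near d e a b c"
  shows "E g w"
proof -
  note H = max_cycle_cycle[OF C]
  note C3 = max_cycle_rotate[OF max_cycle_rotate[OF C]]
  note C4 = max_cycle_rotate[OF C3]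
  have "E g c" "E g d" "g \<notin> near c d e a b" "g \<notin> near d e a b c" using g by (auto simp: opp_def near_def)
  moreover have "c \<in> V" "d \<in> V"
    using centre_near[OF max_cycle_cycle[OF C3]] centre_near[OF max_cycle_cycle[OF C4]] near_sub by blast+
  ultimately show ?thesis
    using twins_uniform[of c c w g] twins_uniform[of d d w g] twins_self w near_eq_twins[OF C3] near_eq_twins[OF C4]
      near1_opp1[OF H _ g] by blast
qed

lemma opp3_complete:
  assumes C: "max_cycle a b c d e" and g: "g \<in> opp c d e a b"
    and w: "w \<in> near c d e a b \<or> w \<in> near a b c d e \<or> w \<in> near e a b c d"
  shows "E g w"
  using opp1_complete[OF max_cycle_rotate[OF max_cycle_rotate[OF C]] g] w by blast

lemma near_clique: "max_cycle a b c d e \<Longrightarrow> clique E (near a b c d e)"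
  using near_eq_twins clique_twins by simp

lemma iso_no_near:
  assumes H: "cycle5 E a b c d e" and z: "z \<in> iso a b c d e"
  shows "v \<in> near a b c d e \<or> v \<in> near b c d e a \<or> v \<in> near c d e a b \<or> v \<in> near d e a b c
    \<or> v \<in> near e a b c d \<Longrightarrow> \<not> E v z"
proof -
  note H2 = cycle5_rotate[OF H]
  note H3 = cycle5_rotate[OF H2]
  note H4 = cycle5_rotate[OF H3]
  note H5 = cycle5_rotate[OF H4]
  have "z \<in> iso b c d e a" "z \<in> iso c d e a b" "z \<in> iso d e a b c" "z \<in> iso e a b c d"
    using z by (auto simp: iso_def)
  then show "v \<in> near a b c d e \<or> v \<in> near b c d e a \<or> v \<in> near c d e a b \<or> v \<in> near d e a b c
    \<or> v \<in> near e a b c d \<Longrightarrow> \<not> E v z"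
    using near_iso[OF H _ z] near_iso[OF H2] near_iso[OF H3] near_iso[OF H4] near_iso[OF H5] by blast
qed

lemma iso_twins:
  assumes F: "frame a b c d e" and z: "z \<in> iso a b c d e" "z' \<in> iso a b c d e" "E z z'"
  shows "z' \<in> twins z"
proof (rule component_twins[of "iso a b c d e"])
  note C = frame_max_cycle[OF F]
  note H = max_cycle_cycle[OF C]
  note H3 = cycle5_rotate[OF cycle5_rotate[OF H]]
  have "a \<notin> iso a b c d e" using H by (auto simp: iso_def cycle5_def)
  then show "iso a b c d e \<noteq> V" using centre_near[OF H] near_sub by blast
  fix v u w assume v: "v \<in> V" "v \<notin> iso a b c d e" and u: "u \<in> iso a b c d e" and w: "w \<in> iso a b c d e"
    and uw: "E u w" and vu: "E v u"
  have 1: "v \<in> opp a b c d e \<Longrightarrow> E v w" using iso_opp_uniform[OF H u w _ uw vu] by blast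
  have "u \<in> iso c d e a b" "w \<in> iso c d e a b" using u w by (auto simp: iso_def)
  then have 3: "v \<in> opp c d e a b \<Longrightarrow> E v w" using iso_opp_uniform[OF H3 _ _ _ uw vu] by blast
  show "E v w" using frame_types[OF F v(1)] iso_no_near[OF H u, of v] vu v(2) 1 3 by blast
qed (use z iso_sub in auto)

lemma iso_neighbours:
  assumes F: "frame a b c d e" and z: "z \<in> iso a b c d e" and v: "E v z"
  shows "v \<in> twins z \<or> v \<in> opp a b c d e \<or> v \<in> opp c d e a b"
  using frame_types[OF F edgeV[OF v]] iso_no_near[OF max_cycle_cycle[OF frame_max_cycle[OF F]] z, of v] v
    iso_twins[OF F z, of v] sym by blast

lemma iso_twins_sub:
  assumes H: "cycle5 E a b c d e" and z: "z \<in> iso a b c d e" shows "twins z \<subseteq> iso a b c d e"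
proof
  fix u assume u: "u \<in> twins z"
  have zV: "z \<in> V" using z iso_sub by blast
  have "v \<notin> twins z" if "v \<in> {a, b, c, d, e}" for v
  proof
    assume "v \<in> twins z"
    then have "v = z \<or> E v z" using twins_E by blast
    moreover have "v \<noteq> z" using that z H sym unfolding iso_def cycle5_def by blast
    ultimately show False using that z sym by (auto simp: iso_def)
  qed
  then have "E v u \<longleftrightarrow> E v z" if "v \<in> {a, b, c, d, e}" for v
    using twins_uniform[OF u twins_self[OF zV], of v] that by blast
  then show "u \<in> iso a b c d e" using z u twins_sub com unfolding iso_def by blast
qed

text \<open>In a colouring only the palette of \<^term>\<open>opp a b c d e\<close> matters to the rest of the graph, so
  this set may be recoloured inside its palette to make room for the vertices of
  \<^term>\<open>iso a b c d e\<close> that see nothing else.\<close>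

lemma opp1_recolouring:
  assumes F: "frame a b c d e"
    and Z1: "Z1 = {z \<in> iso a b c d e. \<forall>h\<in>opp c d e a b. \<not> E z h}"
    and k: "proper E (V - Z1) k {..<5}" and f: "proper E (opp a b c d e) f (k ` opp a b c d e)"
    and room: "\<And>z. z \<in> Z1 \<Longrightarrow> card (f ` {g \<in> opp a b c d e. E z g}) + card (twins z) \<le> 5"
  shows False
proof -
  note C = frame_max_cycle[OF F]
  note H = max_cycle_cycle[OF C]
  note H5 = cycle5_rotate[OF cycle5_rotate[OF cycle5_rotate[OF cycle5_rotate[OF H]]]]
  let ?D = "opp a b c d e"
  have DZ: "?D \<subseteq> V - Z1" using opp_sub unfolding Z1 by (auto simp: opp_def iso_def)
  have Z1V: "Z1 \<subseteq> V" using iso_sub Z1 by blast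
  have kD: "k ` ?D \<subseteq> {..<5}" using proper_range[OF k] DZ by blast
  have p1: "proper E (?D \<union> (V - Z1 - ?D)) (\<lambda>x. if x \<in> ?D then f x else k x) {..<5}"
  proof (rule proper_glue)
    show "proper E ?D f {..<5}" by (rule proper_mono[OF f kD])
    show "proper E (V - Z1 - ?D) k {..<5}" by (rule proper_subset[OF k]) blast
    fix g y assume g: "g \<in> ?D" and y: "y \<in> V - Z1 - ?D" and e: "E g y \<or> E y g"
    have gy: "E g y" using e sym by blast
    have "E g' y" if g': "g' \<in> ?D" for g'
    proof -
      have yV: "y \<in> V" using y by blast
      have "y \<notin> near b c d e a" using near2_opp1[OF H _ g] gy by blast
      moreover have "y \<notin> near e a b c d" using near5_opp1[OF H _ g] gy by blast
      moreover have "y \<notin> opp c d e a b" using opp1_opp3[OF H g] gy by blast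
      moreover have "E g' y" if yz: "y \<in> iso a b c d e"
      proof -
        obtain h where "h \<in> opp c d e a b" "E y h" using y yz Z1 by blast
        then show ?thesis using iso_opp1_opp3[OF H yz g'] sym by blast
      qed
      ultimately show ?thesis using frame_types[OF F yV] y opp1_complete[OF C g'] by blast
    qed
    moreover obtain g' where "g' \<in> ?D" "f g = k g'" using proper_range[OF f g] by blast
    ultimately show "f g \<noteq> k y" using properD[OF k, of g' y] y DZ by auto
  qed
  have "?D \<union> (V - Z1 - ?D) = V - Z1" using DZ by blast
  then have p2: "proper E (V - Z1) (\<lambda>x. if x \<in> ?D then f x else k x) {..<5}" using p1 by simp
  define N where "N = (\<lambda>z. {g \<in> ?D. E z g})"
  define ok where "ok = (\<lambda>z h. inj_on h (twins z) \<and> h ` twins z \<subseteq> {..<5::nat} - f ` N z)"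
  define pick where "pick = (\<lambda>z. SOME h. ok z h)"
  define m where "m = (\<lambda>z. pick z z)"
  have ok: "ok z (pick z)" if z: "z \<in> Z1" for z
  proof -
    have "f ` N z \<subseteq> {..<5}" using proper_range[OF f] kD unfolding N_def by blast
    moreover have "card (f ` N z) + card (twins z) \<le> 5" using room[OF z] unfolding N_def .
    ultimately have "card (twins z) \<le> card ({..<5} - f ` N z)"
      by (subst card_Diff_subset) (auto intro: finite_subset)
    then obtain h where "inj_on h (twins z)" "h ` twins z \<subseteq> {..<5} - f ` N z"
      using inj_into_palette[of "twins z" "{..<5} - f ` N z"] by auto
    then have "\<exists>h. ok z h" unfolding ok_def by blast
    then show ?thesis unfolding pick_def by (rule someI_ex)
  qed
  have same: "pick z' = pick z" if z: "z \<in> Z1" and z': "z' \<in> twins z" for z z'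
  proof -
    have zV: "z \<in> V" using z Z1V by blast
    have "twins z \<subseteq> iso a b c d e" using iso_twins_sub[OF H] z Z1 by blast
    then have "g \<notin> twins z" if "g \<in> ?D" for g using that by (auto simp: opp_def iso_def)
    then have "E g z' \<longleftrightarrow> E g z" if "g \<in> ?D" for g
      using twins_uniform[OF z' twins_self[OF zV], of g] that by blast
    then have "N z' = N z" unfolding N_def using com by blast
    moreover have "twins z' = twins z" by (rule twins_eq[OF zV z'])
    ultimately show ?thesis by (simp add: pick_def ok_def)
  qed
  have self: "z \<in> twins z" if "z \<in> Z1" for z using that Z1V twins_self by blast
  have mr: "m z \<in> {..<5} - f ` N z" if z: "z \<in> Z1" for z
    using ok[OF z] self[OF z] unfolding ok_def m_def by blast
  have p3: "proper E Z1 m {..<5}" unfolding proper_def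
  proof (intro conjI ballI impI)
    fix z assume "z \<in> Z1" then show "m z \<in> {..<5}" using mr by blast
  next
    fix z z' assume z: "z \<in> Z1" "z' \<in> Z1" "E z z'"
    then have t: "z' \<in> twins z" using iso_twins[OF F] Z1 by blast
    have "z \<noteq> z'" using z irr by blast
    then show "m z \<noteq> m z'"
      using ok[OF z(1)] same[OF z(1) t] self[OF z(1)] t unfolding m_def ok_def by (metis inj_onD)
  qed
  have "proper E ((V - Z1) \<union> Z1) (\<lambda>x. if x \<in> V - Z1 then (if x \<in> ?D then f x else k x) else m x) {..<5}"
  proof (rule proper_glue[OF p2 p3])
    fix y z assume y: "y \<in> V - Z1" and z: "z \<in> Z1" and e: "E y z \<or> E z y"
    have yz: "E y z" using e sym by blast
    have zi: "z \<in> iso a b c d e" using z Z1 by blast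
    have tZ: "y \<notin> twins z"
    proof
      assume t: "y \<in> twins z"
      have yi: "y \<in> iso a b c d e" using iso_twins_sub[OF H zi] t by blast
      then obtain h where h: "h \<in> opp c d e a b" "E y h" using y Z1 by blast
      have "h \<notin> twins z" using iso_twins_sub[OF H zi] h by (auto simp: opp_def iso_def)
      then have "E h z" using twins_uniform[OF t self[OF z]] h sym by blast
      then show False using z Z1 h sym by blast
    qed
    have "y \<notin> opp c d e a b" using z Z1 yz sym by blast
    then have yD: "y \<in> ?D" using iso_neighbours[OF F zi yz] tZ by blast
    then have "f y \<in> f ` N z" using yz sym by (auto simp: N_def)
    then show "(if y \<in> ?D then f y else k y) \<noteq> m z" using mr[OF z] yD by auto
  qed
  moreover have "(V - Z1) \<union> Z1 = V" using Z1V by blast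
  ultimately show False using not_proper by simp
qed

lemma twins_pos: "v \<in> V \<Longrightarrow> card (twins v) \<ge> 1"
  using twins_self by (metis One_nat_def Suc_leI card_gt_0_iff empty_iff finite_twins)

lemma iso_meets_opp3:
  assumes F: "frame a b c d e" and z0: "z0 \<in> iso a b c d e"
  shows "\<exists>h\<in>opp c d e a b. E z0 h"
proof (rule ccontr)
  assume n: "\<not> ?thesis"
  define Z1 where "Z1 = {z \<in> iso a b c d e. \<forall>h\<in>opp c d e a b. \<not> E z h}"
  note C = frame_max_cycle[OF F]
  note H = max_cycle_cycle[OF C]
  note C2 = max_cycle_rotate[OF C]
  note C3 = max_cycle_rotate[OF C2]
  note C4 = max_cycle_rotate[OF C3]
  note C5 = max_cycle_rotate[OF C4]
  note H2 = max_cycle_cycle[OF C2]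
  note H3 = max_cycle_cycle[OF C3]
  note H4 = max_cycle_cycle[OF C4]
  note H5 = max_cycle_cycle[OF C5]
  have z0Z: "z0 \<in> Z1" using z0 n by (auto simp: Z1_def)
  have Z1V: "Z1 \<subseteq> V" by (auto simp: Z1_def iso_def)
  have "V - Z1 \<subseteq> V" "V - Z1 \<noteq> V" using z0Z Z1V by blast+
  then obtain k where k: "proper E (V - Z1) k {..<5}" using proper_exists by metis
  let ?D = "opp a b c d e"
  have fD: "finite ?D" by (rule finite_subset[OF opp_sub finV])
  have DZ: "?D \<subseteq> V - Z1" using opp_sub unfolding Z1_def by (auto simp: opp_def iso_def)
  define N where "N = (\<lambda>z. {g \<in> ?D. E z g})"
  have ND: "N z \<subseteq> ?D" for z by (auto simp: N_def)
  have N: "N z = {g \<in> ?D. E z g}" for z by (simp add: N_def)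
  note recol = opp1_recolouring[OF F Z1_def k, folded N]
  have tw: "E u g" if "z \<in> Z1" "u \<in> twins z" "g \<in> N z" for z u g
  proof -
    have "z \<in> V" "z \<in> iso a b c d e" using that Z1V by (auto simp: Z1_def)
    moreover have "g \<notin> twins z" using iso_twins_sub[OF H] calculation that ND by (auto simp: opp_def iso_def)
    ultimately show ?thesis using twins_uniform[of z z u g] that twins_self sym by (auto simp: N_def)
  qed
  have cb: "card (twins z) + card L \<le> 5" if "z \<in> Z1" "L \<subseteq> N z" "clique E L" for z L
    by (rule clique2_bound[OF twins_sub _ clique_twins that(3)]) (use that tw ND opp_sub in blast)+
  have pal: "card (h ` ?D) \<le> 3" if h: "proper E U h {..<5}" and U: "?D \<subseteq> U" "c \<in> U" "d \<in> U" for h U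
  proof -
    have "h g \<noteq> h c" "h g \<noteq> h d" if "g \<in> ?D" for g
      using properD[OF h, of g c] properD[OF h, of g d] that U by (auto simp: opp_def)
    then have "h ` ?D \<subseteq> {..<5} - {h c, h d}" using proper_range[OF h] U by auto
    moreover have "h c \<noteq> h d" using properD[OF h, of c d] H U by (auto simp: cycle5_def)
    moreover have "h c \<in> {..<5}" "h d \<in> {..<5}" using proper_range[OF h] U by blast+
    then have "card ({..<5} - {h c, h d}) = 3" using \<open>h c \<noteq> h d\<close> by (subst card_Diff_subset) auto
    ultimately show ?thesis by (metis card_mono finite_Diff finite_lessThan)
  qed
  have cV: "a \<in> V" "b \<in> V" "c \<in> V" "d \<in> V" "e \<in> V"
    using centre_near[OF H] centre_near[OF H2] centre_near[OF H3] centre_near[OF H4] centre_near[OF H5] near_sub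
    by blast+
  have ciso: "c \<notin> iso a b c d e" "d \<notin> iso a b c d e" "a \<notin> iso a b c d e"
    using H sym unfolding iso_def cycle5_def by blast+
  have kc: "card (k ` ?D) \<le> 3"
    by (rule pal[OF k DZ]) (use ciso cV in \<open>auto simp: Z1_def\<close>)
  obtain K where K: "K \<subseteq> ?D" "clique E K" "\<And>L. L \<subseteq> ?D \<Longrightarrow> clique E L \<Longrightarrow> card L \<le> card K"
    using max_clique_exists[OF fD, of E] by metis
  have Kk: "card K \<le> card (h ` ?D)" if "proper E U h P" "?D \<subseteq> U" for h U P
    using proper_card_clique[OF that(1) _ K(2)] K(1) that(2) card_mono[of "h ` ?D" "h ` K"] fD by auto
  have qk: "card K \<le> card (k ` ?D)" by (rule Kk[OF k DZ])
  have N5: "card (twins z) \<le> 5" if "z \<in> Z1" for z using cb[OF that, of "{}"] by (simp add: clique_def)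
  have N4: "card (twins z) \<le> 4" if z: "z \<in> Z1" and ne: "N z \<noteq> {}" for z
  proof -
    obtain g where "g \<in> N z" using ne by blast
    then show ?thesis using cb[OF z, of "{g}"] by (simp add: clique_def)
  qed
  consider "card K \<le> 1" | "card K = 2" | "card K = 3" using qk kc by linarith
  then show False
  proof cases
    case 1
    have st: "\<not> E u w" if "u \<in> ?D" "w \<in> ?D" for u w
    proof
      assume e: "E u w"
      then have "card {u, w} = 2" using irr by (metis card_2_iff)
      moreover have "clique E {u, w}" using e sym by (auto simp: clique_def)
      ultimately show False using K(3)[of "{u, w}"] that 1 by auto
    qed
    show False
    proof (cases "?D = {}")
      case True
      show ?thesis by (rule recol[of k]) (use True N5 in \<open>auto simp: proper_def N_def\<close>)
    next
      case False
      then obtain g0 where g0: "g0 \<in> ?D" by blast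
      show ?thesis
      proof (rule recol[of "\<lambda>_. k g0"])
        show "proper E ?D (\<lambda>_. k g0) (k ` ?D)" using st g0 by (auto simp: proper_def)
        fix z assume z: "z \<in> Z1"
        show "card ((\<lambda>_. k g0) ` N z) + card (twins z) \<le> 5"
        proof (cases "N z = {}")
          case True then show ?thesis using N5[OF z] by simp
        next
          case False
          then have "(\<lambda>_. k g0) ` N z = {k g0}" by auto
          then show ?thesis using N4[OF z False] by simp
        qed
      qed
    qed
  next
    case 2
    define r where "r = (\<lambda>z. SOME w. w \<in> twins z)"
    have rt: "r z \<in> twins z" if "z \<in> Z1" for z
      unfolding r_def using twins_self that Z1V by (meson someI subsetD)
    define Zr where "Zr = r ` {z \<in> Z1. card (twins z) = 4}"
    have Zi: "Z1 \<subseteq> iso a b c d e" by (auto simp: Z1_def)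
    have Zr: "v \<in> iso a b c d e" "card (twins v) = 4" "r v = v" "\<And>g. g \<in> ?D \<Longrightarrow> E v g \<Longrightarrow> \<exists>z\<in>Z1. v \<in> twins z \<and> g \<in> N z" if "v \<in> Zr" for v
    proof -
      obtain z where z: "z \<in> Z1" "card (twins z) = 4" "v = r z" using \<open>v \<in> Zr\<close> by (auto simp: Zr_def)
      have zV: "z \<in> V" using z Z1V by blast
      have vt: "v \<in> twins z" using rt[OF z(1)] z by simp
      have eq: "twins v = twins z" by (rule twins_eq[OF zV vt])
      show "v \<in> iso a b c d e" using iso_twins_sub[OF H] z Zi vt by blast
      show "card (twins v) = 4" using eq z by simp
      show "r v = v" using eq z(3) by (simp add: r_def)
      fix g assume g: "g \<in> ?D" "E v g"
      have "g \<notin> twins z" using iso_twins_sub[OF H] z(1) Zi g by (auto simp: opp_def iso_def)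
      then have "E g z" using twins_uniform[OF vt twins_self[OF zV], of g] g sym by blast
      then show "\<exists>z\<in>Z1. v \<in> twins z \<and> g \<in> N z" using z vt g sym unfolding N_def by blast
    qed
    have rst: "\<not> E u v" if "u \<in> Zr" "v \<in> Zr" for u v
    proof
      assume e: "E u v"
      then have t: "v \<in> twins u" using iso_twins[OF F] Zr(1) that by blast
      have "u \<in> V" using Zr(1) that iso_sub by blast
      then have "twins v = twins u" by (rule twins_eq[OF _ t])
      then have "r v = r u" by (simp add: r_def)
      then show False using Zr(3) that e irr by metis
    qed
    have ZrD: "Zr \<inter> ?D = {}" using Zr(1) by (auto simp: opp_def iso_def)
    have ZrV: "Zr \<subseteq> V" using Zr(1) iso_sub by blast
    have Zrb: "card L \<le> 1" if v: "v \<in> Zr" and L: "L \<subseteq> ?D" "clique E L" "\<And>g. g \<in> L \<Longrightarrow> E v g" for v L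
    proof -
      have "E u g" if "u \<in> twins v" "g \<in> L" for u g
      proof -
        have "g \<notin> twins v" using iso_twins_sub[OF H Zr(1)[OF v]] that L by (auto simp: opp_def iso_def)
        moreover have "v \<in> V" using v ZrV by blast
        ultimately show ?thesis using twins_uniform[of v v u g] twins_self L(3) that sym by blast
      qed
      then have "card (twins v) + card L \<le> 5"
        by (intro clique2_bound[OF twins_sub _ clique_twins L(2)]) (use L(1) opp_sub in blast)+
      then show ?thesis using Zr(2)[OF v] by simp
    qed
    let ?W = "?D \<union> Zr"
    have "col E ?W 2"
    proof (rule perfect)
      show "finite ?W" using opp_sub ZrV finV finite_subset by (metis Un_least)
      show "card L \<le> 2" if L: "L \<subseteq> ?W" "clique E L" for L
      proof (cases "L \<subseteq> ?D")
        case True then show ?thesis using K(3)[OF True L(2)] 2 by simp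
      next
        case False
        then obtain v where v: "v \<in> L" "v \<in> Zr" using L by blast
        have fL: "finite L" using L(1) opp_sub ZrV finV finite_subset by (metis Un_least subset_trans)
        have "L - {v} \<subseteq> ?D" using L v rst cliqueD[OF L(2) v(1)] by blast
        then have "card (L - {v}) \<le> 1"
          using v cliqueD[OF L(2) v(1)] by (intro Zrb[OF v(2)] clique_subset[OF L(2)]) auto
        then show ?thesis using v fL by (simp add: card_Diff_singleton)
      qed
      have A: False if "cycle5 E p q s t u" "p \<in> ?D" "q \<in> ?D" "s \<in> ?D" "t \<in> ?D" for p q s t u
        using gem[of a p q s t] that sym by (auto simp: cycle5_def opp_def)
      have B: False if cy: "cycle5 E p q s t u" and m: "p \<in> Zr" "q \<in> ?D" "s \<in> Zr" "t \<in> ?D" "u \<in> ?D" for p q s t u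
      proof -
        have c: "E w g" if "v \<in> Zr" "w \<in> twins v" "g \<in> ?D" "E v g" for v w g
        proof -
          have "g \<notin> twins v" using iso_twins_sub[OF H Zr(1)[OF that(1)]] that by (auto simp: opp_def iso_def)
          moreover have "v \<in> V" using that ZrV by blast
          ultimately show ?thesis using twins_uniform[of v v w g] twins_self that sym by blast
        qed
        let ?S = "twins p \<union> {q} \<union> twins s \<union> {t} \<union> {u}"
        have SV: "?S \<subseteq> V" using twins_sub m opp_sub by blast
        have "a \<notin> ?S"
        proof -
          have "a \<notin> ?D" using irr by (auto simp: opp_def)
          then show ?thesis using iso_twins_sub[OF H Zr(1)] m ciso by blast
        qed
        then have "?S \<noteq> V" using cV by blast
        then obtain h where h: "proper E ?S h {..<5}" using proper_exists[OF SV] by metis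
        have e: "E p q" "E s q" "E s t" "E t u" "E p u" using cy sym by (auto simp: cycle5_def)
        have s1: "clique E {x}" for x by (simp add: clique_def)
        have "card (twins p) + card {q} + card (twins s) + card {t} + card {u} \<le> 2 * 5"
        proof (rule five_cycle_blowup_bound[OF h])
          show "clique E (twins p \<union> {q})" "clique E ({q} \<union> twins s)" "clique E (twins s \<union> {t})" "clique E ({u} \<union> twins p)"
            by (intro clique_Un clique_twins s1; use c[of p _ q] c[of s _ q] c[of s _ t] c[of p _ u] m e sym in blast)+
          show "clique E ({t} \<union> {u})" using e sym by (auto simp: clique_def)
          have "twins p \<inter> ?D = {}" "twins s \<inter> ?D = {}"
            using iso_twins_sub[OF H Zr(1)] m by (auto simp: opp_def iso_def)
          then show "twins p \<inter> {q} = {}" "{q} \<inter> twins s = {}" "twins s \<inter> {t} = {}" "{u} \<inter> twins p = {}"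
            using m by auto
          show "{t} \<inter> {u} = {}" using e irr by auto
        qed simp
        then show False using Zr(2) m by simp
      qed
      show "c5_free E ?W" unfolding c5_free_def
      proof (intro ballI notI)
        fix p q s t u assume w: "p \<in> ?W" "q \<in> ?W" "s \<in> ?W" "t \<in> ?W" "u \<in> ?W" and cy: "cycle5 E p q s t u"
        note cy2 = cycle5_rotate[OF cy]
        note cy3 = cycle5_rotate[OF cy2]
        note cy4 = cycle5_rotate[OF cy3]
        note cy5 = cycle5_rotate[OF cy4]
        have nn: "\<not> (p \<in> Zr \<and> q \<in> Zr)" "\<not> (q \<in> Zr \<and> s \<in> Zr)" "\<not> (s \<in> Zr \<and> t \<in> Zr)"
          "\<not> (t \<in> Zr \<and> u \<in> Zr)" "\<not> (u \<in> Zr \<and> p \<in> Zr)"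
          using rst cy unfolding cycle5_def by blast+
        show False
          using w nn A[OF cy] A[OF cy2] A[OF cy3] A[OF cy4] A[OF cy5]
            B[OF cy] B[OF cy2] B[OF cy3] B[OF cy4] B[OF cy5] unfolding Un_iff by argo
      qed
    qed
    moreover obtain P where P: "P \<subseteq> k ` ?D" "card P = 2"
      using obtain_subset_with_card_n[of 2 "k ` ?D"] qk 2 by metis
    moreover have fP: "finite P" using P fD finite_subset by blast
    ultimately obtain f where f: "proper E ?W f P" using col_imp_proper[of E ?W 2 P] by auto
    show False
    proof (rule recol[of f])
      show "proper E ?D f (k ` ?D)" using proper_mono[OF proper_subset[OF f] P(1)] by blast
      fix z assume z: "z \<in> Z1"
      have fN: "f ` N z \<subseteq> P" using proper_range[OF f] ND by blast
      consider "N z = {}" | "card (twins z) \<le> 3" | "card (twins z) = 4" using N4[OF z] by linarith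
      then show "card (f ` N z) + card (twins z) \<le> 5"
      proof cases
        case 1 then show ?thesis using N5[OF z] by simp
      next
        case 2 then show ?thesis using card_mono[OF fP fN] P by simp
      next
        case 3
        then have rz: "r z \<in> Zr" using z by (auto simp: Zr_def)
        have "f g \<noteq> f (r z)" if "g \<in> N z" for g
          using properD[OF f, of "r z" g] tw[OF z rt[OF z] that] rz that ND by fastforce
        then have "f ` N z \<subseteq> P - {f (r z)}" using fN by auto
        moreover have "f (r z) \<in> P" using proper_range[OF f] rz by blast
        ultimately have "card (f ` N z) \<le> 1"
          using card_mono[of "P - {f (r z)}" "f ` N z"] fP P by simp
        then show ?thesis using 3 by simp
      qed
    qed
  next
    case 3
    have Kne: "K \<noteq> {}" using 3 by auto
    have KV: "K \<subseteq> V" using K(1) opp_sub by blast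
    show False
    proof (cases "opp c d e a b = {}")
      case True
      have X: "near a b c d e = twins a" "near b c d e a = twins b" "near c d e a b = twins c"
        "near d e a b c = twins d" "near e a b c d = twins e"
        using near_eq_twins[OF C] near_eq_twins[OF C2] near_eq_twins[OF C3] near_eq_twins[OF C4] near_eq_twins[OF C5] by auto
      have b4: "3 < card (twins b)" unfolding 3[symmetric]
      proof (rule dominated[OF cV(2) KV K(2)])
        show "K \<inter> twins b = {}" using K(1) X by (auto simp: opp_def near_def)
        fix y x assume y: "y \<in> V" "y \<notin> twins b" "E y b" and x: "x \<in> K"
        have "y \<in> near a b c d e \<or> y \<in> near c d e a b"
          using frame_types[OF F y(1)] y(2,3) X(2) by (auto simp: near_def opp_def iso_def)
        then show "E y x" using opp1_complete[OF C, of x y] x K(1) sym by blast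
      qed
      have e4: "3 < card (twins e)" unfolding 3[symmetric]
      proof (rule dominated[OF cV(5) KV K(2)])
        show "K \<inter> twins e = {}" using K(1) X by (auto simp: opp_def near_def)
        fix y x assume y: "y \<in> V" "y \<notin> twins e" "E y e" and x: "x \<in> K"
        have "y \<in> near a b c d e \<or> y \<in> near d e a b c"
          using frame_types[OF F y(1)] y(2,3) X(5) True by (auto simp: near_def opp_def iso_def)
        then show "E y x" using opp1_complete[OF C, of x y] x K(1) sym by blast
      qed
      let ?S = "twins a \<union> twins b \<union> twins c \<union> twins d \<union> twins e"
      have "?S \<subseteq> V" using twins_sub by blast
      moreover have "?S \<noteq> V"
      proof -
        obtain g where g: "g \<in> K" using Kne by blast
        have "g \<notin> ?S" using g K(1) unfolding X[symmetric] by (auto simp: opp_def near_def)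
        then show ?thesis using g KV by blast
      qed
      ultimately obtain h where h: "proper E ?S h {..<5}" using proper_exists by metis
      have "card (twins a) + card (twins b) + card (twins c) + card (twins d) + card (twins e) \<le> 2 * 5"
      proof (rule five_cycle_blowup_bound[OF h])
        have c1: "clique E (twins a \<union> twins b)" "clique E (twins b \<union> twins c)" "clique E (twins c \<union> twins d)"
          "clique E (twins d \<union> twins e)" "clique E (twins e \<union> twins a)"
          by (intro clique_Un clique_twins; use near_near_adjacent[OF H] near_near_adjacent[OF H2]
              near_near_adjacent[OF H3] near_near_adjacent[OF H4] near_near_adjacent[OF H5] X in blast)+
        then show "clique E (twins a \<union> twins b)" "clique E (twins b \<union> twins c)" "clique E (twins c \<union> twins d)"
          "clique E (twins d \<union> twins e)" "clique E (twins e \<union> twins a)" .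
        show "twins a \<inter> twins b = {}" "twins b \<inter> twins c = {}" "twins c \<inter> twins d = {}"
          "twins d \<inter> twins e = {}" "twins e \<inter> twins a = {}"
          by (rule complete_disjoint; use near_near_adjacent[OF H] near_near_adjacent[OF H2]
              near_near_adjacent[OF H3] near_near_adjacent[OF H4] near_near_adjacent[OF H5] X in blast)+
      qed simp
      then show False using b4 e4 twins_pos[OF cV(1)] twins_pos[OF cV(3)] twins_pos[OF cV(4)] by linarith
    next
      case False
      have "V - opp c d e a b \<subseteq> V" "V - opp c d e a b \<noteq> V" using False opp_sub by blast+
      then obtain h where h: "proper E (V - opp c d e a b) h {..<5}" using proper_exists by metis
      have Dsub: "?D \<subseteq> V - opp c d e a b" using opp_sub by (auto simp: opp_def)
      have "c \<notin> opp c d e a b" "d \<notin> opp c d e a b"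
        using H irr sym unfolding opp_def cycle5_def by blast+
      then have "card (h ` ?D) \<le> 3" using pal[OF h Dsub] cV by blast
      then have le: "card (h ` ?D) \<le> card (k ` ?D)" using qk 3 by linarith
      obtain m where m: "inj_on m (h ` ?D)" "m ` h ` ?D \<subseteq> k ` ?D"
        using inj_into_palette[OF _ _ le] fD by auto
      have hD: "proper E ?D h (h ` ?D)" by (rule proper_image[OF proper_subset[OF h Dsub]])
      show False
      proof (rule recol[of "m \<circ> h"])
        show "proper E ?D (m \<circ> h) (k ` ?D)" by (rule proper_mono[OF proper_compose[OF hD m(1)] m(2)])
        fix z assume z: "z \<in> Z1"
        have tz: "twins z \<subseteq> V - opp c d e a b"
          using iso_twins_sub[OF H, of z] z twins_sub by (auto simp: Z1_def opp_def iso_def)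
        have dj: "h ` N z \<inter> h ` twins z = {}"
        proof (rule ccontr)
          assume "h ` N z \<inter> h ` twins z \<noteq> {}"
          then obtain g u where "g \<in> N z" "u \<in> twins z" "h g = h u" by (auto simp: image_iff)
          then show False using tw[OF z, of u g] properD[OF h, of u g] tz Dsub ND by fastforce
        qed
        have fN: "finite (N z)" using ND fD finite_subset by blast
        have "card (h ` N z) + card (h ` twins z) = card (h ` N z \<union> h ` twins z)"
          using dj fN by (simp add: card_Un_disjoint)
        also have "\<dots> \<le> card {..<5::nat}"
          using proper_range[OF h] tz Dsub ND by (intro card_mono) blast+
        finally have "card (h ` N z) + card (twins z) \<le> 5"
          using proper_card_clique[OF h tz clique_twins] by simp
        moreover have "card ((m \<circ> h) ` N z) \<le> card (h ` N z)"
          unfolding image_comp[symmetric] using fN by (intro card_image_le) simp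
        ultimately show "card ((m \<circ> h) ` N z) + card (twins z) \<le> 5" by linarith
      qed
    qed
  qed
qed

end

section \<open>Blow-ups of the base graphs\<close>

definition blowup :: "('a \<Rightarrow> 'a \<Rightarrow> bool) \<Rightarrow> 'b ugraph \<Rightarrow> ('b \<Rightarrow> 'a set) \<Rightarrow> 'a set \<Rightarrow> bool" where
  "blowup E H Q S \<longleftrightarrow> S = (\<Union>i\<in>uverts H. Q i) \<and>
     (\<forall>i\<in>uverts H. \<forall>j\<in>uverts H. i \<noteq> j \<longrightarrow> Q i \<inter> Q j = {}) \<and>
     (\<forall>i\<in>uverts H. \<forall>j\<in>uverts H. \<forall>x\<in>Q i. \<forall>y\<in>Q j. x \<noteq> y \<longrightarrow> (E x y \<longleftrightarrow> i = j \<or> {i, j} \<in> uedges H))"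

lemma verts_G7: "uverts base_G7 = {1, 2, 3, 4, 5, 6, 7, 8}"
  by (auto simp: base_G7_def)

lemma verts_G1: "uverts base_G1 = {1, 2, 3, 4, 5}"
  by (auto simp: base_G1_def)

lemma increasing_pair_eq: "i < j \<Longrightarrow> p < q \<Longrightarrow> {i, j} = {p, q} \<longleftrightarrow> i = p \<and> j = q" for i j p q :: nat
  by (auto simp: doubleton_eq_iff)

lemma edges_G7: "i < j \<Longrightarrow> {i, j} \<in> uedges base_G7 \<longleftrightarrow> (i, j) \<in>
  {(1, 2), (1, 3), (1, 4), (1, 7), (2, 3), (2, 5), (2, 8), (3, 6), (4, 5), (4, 6), (4, 8), (5, 6), (5, 7)}"
  by (simp add: base_G7_def increasing_pair_eq)

lemma nonedges_G7:
  assumes "i \<in> uverts base_G7" "j \<in> uverts base_G7" "i < j" "{i, j} \<notin> uedges base_G7"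
  shows "(i, j) \<in> {(1, 5), (1, 6), (1, 8), (2, 4), (2, 6), (2, 7), (3, 4), (3, 5), (3, 7), (3, 8), (4, 7), (5, 8), (6, 7), (6, 8), (7, 8)}"
  using assms(1-3) assms(4)[unfolded edges_G7[OF assms(3)]] unfolding verts_G7
  by (elim insertE emptyE) simp_all

lemma blowup_adjacent:
  "blowup E H Q S \<Longrightarrow> {i, j} \<in> uedges H \<Longrightarrow> i \<noteq> j \<Longrightarrow> i \<in> uverts H \<Longrightarrow> j \<in> uverts H \<Longrightarrow> x \<in> Q i \<Longrightarrow> y \<in> Q j \<Longrightarrow> E x y"
  unfolding blowup_def by (metis disjoint_iff)

lemma blowup_nonadjacent:
  "blowup E H Q S \<Longrightarrow> {i, j} \<notin> uedges H \<Longrightarrow> i \<noteq> j \<Longrightarrow> i \<in> uverts H \<Longrightarrow> j \<in> uverts H \<Longrightarrow> x \<in> Q i \<Longrightarrow> y \<in> Q j \<Longrightarrow> \<not> E x y"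
  unfolding blowup_def by (metis disjoint_iff)

lemma blowup_clique: "blowup E H Q S \<Longrightarrow> i \<in> uverts H \<Longrightarrow> clique E (Q i)"
  unfolding blowup_def clique_def by blast

lemma blowup_disjoint: "blowup E H Q S \<Longrightarrow> i \<in> uverts H \<Longrightarrow> j \<in> uverts H \<Longrightarrow> i \<noteq> j \<Longrightarrow> Q i \<inter> Q j = {}"
  unfolding blowup_def by blast

lemma blowup_restrict:
  assumes "blowup E H Q S" shows "blowup E H (\<lambda>i. Q i \<inter> T) (S \<inter> T)"
proof -
  have "S \<inter> T = (\<Union>i\<in>uverts H. Q i \<inter> T)" using assms by (auto simp: blowup_def)
  then show ?thesis using assms unfolding blowup_def by auto
qed

lemma blowup_reindex:
  assumes B: "blowup E H Q S" and inj: "inj_on \<sigma> (uverts H')" and m: "\<And>i. i \<in> uverts H' \<Longrightarrow> \<sigma> i \<in> uverts H"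
    and e: "\<And>i j. i \<in> uverts H' \<Longrightarrow> j \<in> uverts H' \<Longrightarrow> {i, j} \<in> uedges H' \<longleftrightarrow> {\<sigma> i, \<sigma> j} \<in> uedges H"
  shows "blowup E H' (\<lambda>i. Q (\<sigma> i)) (\<Union>i\<in>uverts H'. Q (\<sigma> i))"
  unfolding blowup_def
proof (intro conjI ballI impI refl)
  fix i j assume ij: "i \<in> uverts H'" "j \<in> uverts H'" "i \<noteq> j"
  then have "\<sigma> i \<noteq> \<sigma> j" using inj by (simp add: inj_on_eq_iff)
  then show "Q (\<sigma> i) \<inter> Q (\<sigma> j) = {}" using blowup_disjoint[OF B m[OF ij(1)] m[OF ij(2)]] by simp
next
  fix i j x y assume ij: "i \<in> uverts H'" "j \<in> uverts H'" and xy: "x \<in> Q (\<sigma> i)" "y \<in> Q (\<sigma> j)" "x \<noteq> y"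
  have "E x y \<longleftrightarrow> \<sigma> i = \<sigma> j \<or> {\<sigma> i, \<sigma> j} \<in> uedges H"
    using B m[OF ij(1)] m[OF ij(2)] xy unfolding blowup_def by blast
  then show "E x y \<longleftrightarrow> i = j \<or> {i, j} \<in> uedges H'" using inj e[OF ij] ij by (simp add: inj_on_eq_iff)
qed

definition anticomplete_to :: "('a \<Rightarrow> 'a \<Rightarrow> bool) \<Rightarrow> 'a set \<Rightarrow> 'a set \<Rightarrow> bool" where
  "anticomplete_to E A B \<longleftrightarrow> A \<inter> B = {} \<and> (\<forall>x\<in>A. \<forall>y\<in>B. \<not> E x y)"

definition complete_to :: "('a \<Rightarrow> 'a \<Rightarrow> bool) \<Rightarrow> 'a set \<Rightarrow> 'a set \<Rightarrow> bool" where
  "complete_to E A B \<longleftrightarrow> A \<inter> B = {} \<and> (\<forall>x\<in>A. \<forall>y\<in>B. E x y)"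

lemma (in P5_gem_free_graph) blowupI:
  assumes S: "S = (\<Union>i\<in>uverts H. Q i)" and cl: "\<And>i. i \<in> uverts H \<Longrightarrow> clique E (Q i)"
    and c: "\<And>i j. i \<in> uverts H \<Longrightarrow> j \<in> uverts H \<Longrightarrow> i < j \<Longrightarrow> {i, j} \<in> uedges H \<Longrightarrow> complete_to E (Q i) (Q j)"
    and a: "\<And>i j. i \<in> uverts H \<Longrightarrow> j \<in> uverts H \<Longrightarrow> i < j \<Longrightarrow> {i, j} \<notin> uedges H \<Longrightarrow> anticomplete_to E (Q i) (Q j)"
  shows "blowup E H (Q :: nat \<Rightarrow> 'a set) S"
  unfolding blowup_def
proof (intro conjI ballI impI S)
  fix i j assume ij: "i \<in> uverts H" "j \<in> uverts H" "i \<noteq> j"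
  then show "Q i \<inter> Q j = {}" using c[of i j] a[of i j] c[of j i] a[of j i]
    unfolding anticomplete_to_def complete_to_def by (metis inf_commute linorder_neqE_nat)
next
  fix i j x y assume ij: "i \<in> uverts H" "j \<in> uverts H" and xy: "x \<in> Q i" "y \<in> Q j" "x \<noteq> y"
  consider "i = j" | "i < j" | "j < i" by linarith
  then show "E x y \<longleftrightarrow> i = j \<or> {i, j} \<in> uedges H"
  proof cases
    case 1 then show ?thesis using cliqueD[OF cl] ij xy by metis
  next
    case 2 then show ?thesis using c[OF ij 2] a[OF ij 2] xy unfolding anticomplete_to_def complete_to_def by blast
  next
    case 3
    then show ?thesis using c[OF ij(2,1) 3] a[OF ij(2,1) 3] xy com[of x y]
      unfolding anticomplete_to_def complete_to_def by (metis insert_commute less_irrefl)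
  qed
qed

context critical_graph begin

lemma max_cycle_exists: "\<exists>a b c d e. max_cycle a b c d e"
proof -
  have "\<not> c5_free E V" using perfect[OF finV, of 5] noK6 ncol by blast
  then obtain a0 b0 c0 d0 e0 where c0: "cycle5 E a0 b0 c0 d0 e0" by (auto simp: c5_free_def)
  let ?P = "\<lambda>(a, b, c, d, e). cycle5 E a b c d e"
  let ?f = "\<lambda>(a, b, c, d, e). card (twins a) + card (twins b) + card (twins c) + card (twins d) + card (twins e)"
  have tb: "card (twins v) \<le> card V" for v by (rule card_mono[OF finV twins_sub])
  have "\<exists>t. ?P t \<and> (\<forall>t'. ?P t' \<longrightarrow> ?f t' \<le> ?f t)"
  proof (rule ex_has_greatest_nat[of ?P "(a0, b0, c0, d0, e0)" ?f "Suc (5 * card V)"])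
    show "?P (a0, b0, c0, d0, e0)" using c0 by simp
    show "\<forall>t. ?P t \<longrightarrow> ?f t < Suc (5 * card V)"
    proof (intro allI impI)
      fix t :: "'a \<times> 'a \<times> 'a \<times> 'a \<times> 'a"
      obtain a b c d e where t: "t = (a, b, c, d, e)" by (metis prod.exhaust)
      show "?f t < Suc (5 * card V)" unfolding t using tb[of a] tb[of b] tb[of c] tb[of d] tb[of e] by simp
    qed
  qed
  then obtain a b c d e where cy: "cycle5 E a b c d e"
    and mx: "\<And>a' b' c' d' e'. cycle5 E a' b' c' d' e' \<Longrightarrow> ?f (a', b', c', d', e') \<le> ?f (a, b, c, d, e)"
    by fast
  have "card (twins x) \<le> card (twins a)" if "x \<in> near a b c d e" for x
  proof -
    have "cycle5 E x b c d e" using that cy sym unfolding near_def cycle5_def by blast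
    then show ?thesis using mx by fastforce
  qed
  moreover have "card (twins x) \<le> card (twins b)" if "x \<in> near b c d e a" for x
  proof -
    have "cycle5 E a x c d e" using that cy sym unfolding near_def cycle5_def by blast
    then show ?thesis using mx by fastforce
  qed
  moreover have "card (twins x) \<le> card (twins c)" if "x \<in> near c d e a b" for x
  proof -
    have "cycle5 E a b x d e" using that cy sym unfolding near_def cycle5_def by blast
    then show ?thesis using mx by fastforce
  qed
  moreover have "card (twins x) \<le> card (twins d)" if "x \<in> near d e a b c" for x
  proof -
    have "cycle5 E a b c x e" using that cy sym unfolding near_def cycle5_def by blast
    then show ?thesis using mx by fastforce
  qed
  moreover have "card (twins x) \<le> card (twins e)" if "x \<in> near e a b c d" for x
  proof -
    have "cycle5 E a b c d x" using that cy sym unfolding near_def cycle5_def by blast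
    then show ?thesis using mx by fastforce
  qed
  ultimately show ?thesis using cy unfolding max_cycle_def by blast
qed

lemma iso_complete_opp:
  assumes F: "frame a b c d e" and z: "z \<in> iso a b c d e"
  shows "g \<in> opp a b c d e \<Longrightarrow> E z g" "h \<in> opp c d e a b \<Longrightarrow> E z h"
proof -
  note H = max_cycle_cycle[OF frame_max_cycle[OF F]]
  have zR: "z \<in> iso c b a e d" using z by (auto simp: iso_def)
  obtain h0 where h0: "h0 \<in> opp c d e a b" "E z h0" using iso_meets_opp3[OF F z] by blast
  obtain g0 where g0: "g0 \<in> opp a b c d e" "E z g0"
    using iso_meets_opp3[OF frame_flip[OF F] zR] opp_reflect[of a b c d e] by auto
  show "g \<in> opp a b c d e \<Longrightarrow> E z g" using iso_opp1_opp3[OF H z _ h0] by blast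
  show "h \<in> opp c d e a b \<Longrightarrow> E z h" using iso_opp3_opp1[OF H z g0(1) _ g0(2)] by blast
qed

lemma opp1_clique:
  assumes F: "frame a b c d e" shows "clique E (opp a b c d e)"
proof (rule module_clique[OF opp_sub])
  note C = frame_max_cycle[OF F]
  note H = max_cycle_cycle[OF C]
  show "c5_free E (opp a b c d e)"
    by (rule c5_free_neighbourhood[of _ a]) (auto simp: opp_def sym)
  fix v u w assume v: "v \<in> V" "v \<notin> opp a b c d e" and u: "u \<in> opp a b c d e" and w: "w \<in> opp a b c d e"
    and vu: "E v u"
  have "v \<notin> near b c d e a" using near2_opp1[OF H _ u] vu sym by blast
  moreover have "v \<notin> near e a b c d" using near5_opp1[OF H _ u] vu sym by blast
  moreover have "v \<notin> opp c d e a b" using opp1_opp3[OF H u] vu sym by blast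
  ultimately show "E v w"
    using frame_types[OF F v(1)] v(2) opp1_complete[OF C w, of v] iso_complete_opp(1)[OF F _ w, of v] sym by blast
qed

lemma iso_clique:
  assumes F: "frame a b c d e" shows "clique E (iso a b c d e)"
proof (cases "iso a b c d e = {}")
  case True then show ?thesis by (simp add: clique_def)
next
  case False
  note C = frame_max_cycle[OF F]
  note H = max_cycle_cycle[OF C]
  obtain z0 where "z0 \<in> iso a b c d e" using False by blast
  then obtain h where h: "h \<in> opp c d e a b" using iso_meets_opp3[OF F] by blast
  show ?thesis
  proof (rule module_clique[OF iso_sub])
    show "c5_free E (iso a b c d e)"
      by (rule c5_free_neighbourhood[of _ h]) (use iso_complete_opp(2)[OF F _ h] sym in blast)
    fix v u w assume v: "v \<in> V" "v \<notin> iso a b c d e" and u: "u \<in> iso a b c d e" and w: "w \<in> iso a b c d e"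
      and vu: "E v u"
    show "E v w"
      using frame_types[OF F v(1)] v(2) iso_no_near[OF H u, of v] vu iso_complete_opp[OF F w] sym by blast
  qed
qed

theorem blowup_of_G7: "\<exists>Q. blowup E base_G7 Q V"
proof -
  obtain a b c d e where F: "frame a b c d e" using max_cycle_exists frame_exists by blast
  note C = frame_max_cycle[OF F]
  note C2 = max_cycle_rotate[OF C]
  note C3 = max_cycle_rotate[OF C2]
  note C4 = max_cycle_rotate[OF C3]
  note C5 = max_cycle_rotate[OF C4]
  note H = max_cycle_cycle[OF C]
  note H2 = max_cycle_cycle[OF C2]
  note H3 = max_cycle_cycle[OF C3]
  note H4 = max_cycle_cycle[OF C4]
  note H5 = max_cycle_cycle[OF C5]
  define Q where "Q = (\<lambda>i::nat. if i = 1 then near a b c d e else if i = 2 then opp c d e a b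
    else if i = 3 then near e a b c d else if i = 4 then opp a b c d e else if i = 5 then near c d e a b
    else if i = 6 then near d e a b c else if i = 7 then near b c d e a else iso a b c d e)"
  have cI: "complete_to E A B" if "\<And>x y. x \<in> A \<Longrightarrow> y \<in> B \<Longrightarrow> E x y" for A B
    using that irr unfolding complete_to_def by blast
  have aI: "anticomplete_to E A B" if "\<And>x y. x \<in> A \<Longrightarrow> y \<in> B \<Longrightarrow> \<not> E x y" "A \<inter> B = {}" for A B
    using that unfolding anticomplete_to_def by blast
  have cQ: "complete_to E (Q 1) (Q 2)" "complete_to E (Q 1) (Q 3)" "complete_to E (Q 1) (Q 4)" "complete_to E (Q 1) (Q 7)"
    "complete_to E (Q 2) (Q 3)" "complete_to E (Q 2) (Q 5)" "complete_to E (Q 2) (Q 8)" "complete_to E (Q 3) (Q 6)" "complete_to E (Q 4) (Q 5)"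
    "complete_to E (Q 4) (Q 6)" "complete_to E (Q 4) (Q 8)" "complete_to E (Q 5) (Q 6)" "complete_to E (Q 5) (Q 7)"
    unfolding Q_def
    by (simp; intro cI; use near_near_adjacent[OF H] near_near_adjacent[OF H2] near_near_adjacent[OF H3]
        near_near_adjacent[OF H4] near_near_adjacent[OF H5] opp1_complete[OF C] opp3_complete[OF C]
        iso_complete_opp[OF F] sym in blast)+
  have dj: "near a b c d e \<inter> near c d e a b = {}"
    "near a b c d e \<inter> near d e a b c = {}"
    "near a b c d e \<inter> iso a b c d e = {}"
    "opp c d e a b \<inter> opp a b c d e = {}"
    "opp c d e a b \<inter> near d e a b c = {}"
    "opp c d e a b \<inter> near b c d e a = {}"
    "near e a b c d \<inter> opp a b c d e = {}"
    "near e a b c d \<inter> near c d e a b = {}"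
    "near e a b c d \<inter> near b c d e a = {}"
    "near e a b c d \<inter> iso a b c d e = {}"
    "opp a b c d e \<inter> near b c d e a = {}"
    "near c d e a b \<inter> iso a b c d e = {}"
    "near d e a b c \<inter> near b c d e a = {}"
    "near d e a b c \<inter> iso a b c d e = {}"
    "near b c d e a \<inter> iso a b c d e = {}"
    unfolding near_def opp_def iso_def by blast+
  have a15: "anticomplete_to E (near a b c d e) (near c d e a b)" by (rule aI[OF _ dj(1)]) (use no_near13[OF C] in blast)
  have a16: "anticomplete_to E (near a b c d e) (near d e a b c)" by (rule aI[OF _ dj(2)]) (use no_near13[OF C4] sym in blast)
  have a18: "anticomplete_to E (near a b c d e) (iso a b c d e)" by (rule aI[OF _ dj(3)], rule iso_no_near[OF H], assumption, simp)
  have a24: "anticomplete_to E (opp c d e a b) (opp a b c d e)" by (rule aI[OF _ dj(4)]) (use opp1_opp3[OF H] sym in blast)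
  have a26: "anticomplete_to E (opp c d e a b) (near d e a b c)" by (rule aI[OF _ dj(5)]) (use near2_opp1[OF H3] in blast)
  have a27: "anticomplete_to E (opp c d e a b) (near b c d e a)" by (rule aI[OF _ dj(6)]) (use near5_opp1[OF H3] in blast)
  have a34: "anticomplete_to E (near e a b c d) (opp a b c d e)" by (rule aI[OF _ dj(7)]) (use near5_opp1[OF H] sym in blast)
  have a35: "anticomplete_to E (near e a b c d) (near c d e a b)" by (rule aI[OF _ dj(8)]) (use no_near13[OF C3] sym in blast)
  have a37: "anticomplete_to E (near e a b c d) (near b c d e a)" by (rule aI[OF _ dj(9)]) (use no_near13[OF C5] in blast)
  have a38: "anticomplete_to E (near e a b c d) (iso a b c d e)" by (rule aI[OF _ dj(10)], rule iso_no_near[OF H], assumption, simp)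
  have a47: "anticomplete_to E (opp a b c d e) (near b c d e a)" by (rule aI[OF _ dj(11)]) (use near2_opp1[OF H] in blast)
  have a58: "anticomplete_to E (near c d e a b) (iso a b c d e)" by (rule aI[OF _ dj(12)], rule iso_no_near[OF H], assumption, simp)
  have a67: "anticomplete_to E (near d e a b c) (near b c d e a)" by (rule aI[OF _ dj(13)]) (use no_near13[OF C2] sym in blast)
  have a68: "anticomplete_to E (near d e a b c) (iso a b c d e)" by (rule aI[OF _ dj(14)], rule iso_no_near[OF H], assumption, simp)
  have a78: "anticomplete_to E (near b c d e a) (iso a b c d e)" by (rule aI[OF _ dj(15)], rule iso_no_near[OF H], assumption, simp)
  note aQ = a15 a16 a18 a24 a26 a27 a34 a35 a37 a38 a47 a58 a67 a68 a78
  have "blowup E base_G7 Q V"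
  proof (rule blowupI)
    show "V = (\<Union>i\<in>uverts base_G7. Q i)"
    proof
      show "V \<subseteq> (\<Union>i\<in>uverts base_G7. Q i)" using frame_types[OF F] by (auto simp: verts_G7 Q_def)
      show "(\<Union>i\<in>uverts base_G7. Q i) \<subseteq> V" using near_sub opp_sub iso_sub by (auto simp: verts_G7 Q_def)
    qed
    have "clique E (opp c d e a b)" using opp1_clique[OF frame_flip[OF F]] opp_reflect[of c d e a b] by simp
    then show "clique E (Q i)" for i
      using near_clique[OF C] near_clique[OF C2] near_clique[OF C3] near_clique[OF C4] near_clique[OF C5]
        opp1_clique[OF F] iso_clique[OF F] by (simp add: Q_def)
    fix i j assume ij: "i \<in> uverts base_G7" "j \<in> uverts base_G7" "i < j"
    show "complete_to E (Q i) (Q j)" if "{i, j} \<in> uedges base_G7"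
      using that[unfolded edges_G7[OF ij(3)]] cQ by (elim insertE emptyE) simp_all
    show "anticomplete_to E (Q i) (Q j)" if "{i, j} \<notin> uedges base_G7"
      using nonedges_G7[OF ij that] aQ by (elim insertE emptyE) (simp_all add: Q_def)
  qed
  then show ?thesis by blast
qed

end

section \<open>Colouring blow-ups\<close>

lemma card_le_of_fibres:
  assumes c: "proper E S c {..<k}" and f: "finite S"
    and m: "\<And>T. T \<subseteq> S \<Longrightarrow> (\<And>u v. u \<in> T \<Longrightarrow> v \<in> T \<Longrightarrow> \<not> E u v) \<Longrightarrow> card T \<le> m"
  shows "card S \<le> k * m"
proof -
  have "S = (\<Union>x<k. {v \<in> S. c v = x})" using c by (auto simp: proper_def)
  then have "card S \<le> (\<Sum>x<k. card {v \<in> S. c v = x})" using card_UN_le[of "{..<k}" "\<lambda>x. {v \<in> S. c v = x}"] by simp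
  also have "\<dots> \<le> (\<Sum>x<k. m)"
  proof (rule sum_mono)
    fix x assume "x \<in> {..<k}"
    show "card {v \<in> S. c v = x} \<le> m"
    proof (rule m)
      fix u v assume "u \<in> {v \<in> S. c v = x}" "v \<in> {v \<in> S. c v = x}"
      then show "\<not> E u v" using properD[OF c, of u v] by auto
    qed auto
  qed
  finally show ?thesis by simp
qed

lemma blowup_clique_Union:
  fixes I :: "nat set"
  assumes B: "blowup E H Q S" and I: "I \<subseteq> uverts H"
    and e: "\<And>i j. i \<in> I \<Longrightarrow> j \<in> I \<Longrightarrow> i < j \<Longrightarrow> {i, j} \<in> uedges H"
  shows "clique E (\<Union>i\<in>I. Q i)"
  unfolding clique_def
proof (intro ballI impI)
  fix x y assume "x \<in> (\<Union>i\<in>I. Q i)" "y \<in> (\<Union>i\<in>I. Q i)" and ne: "x \<noteq> y"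
  then obtain i j where ij: "i \<in> I" "j \<in> I" "x \<in> Q i" "y \<in> Q j" by blast
  have "i = j \<or> {i, j} \<in> uedges H"
    using e[of i j] e[of j i] ij(1,2) by (metis insert_commute linorder_neqE_nat)
  then show "E x y" using B I ij ne unfolding blowup_def by blast
qed

lemma blowup_G7_adjacent:
  assumes B: "blowup E base_G7 Q S"
    and ij: "(i, j) \<in> {(1, 2), (1, 3), (1, 4), (1, 7), (2, 3), (2, 5), (2, 8), (3, 6), (4, 5), (4, 6), (4, 8), (5, 6), (5, 7)}"
    and xy: "x \<in> Q i" "y \<in> Q j"
  shows "E x y"
proof -
  have v: "i < j" "i \<in> uverts base_G7" "j \<in> uverts base_G7"
    using ij unfolding verts_G7 by (elim insertE emptyE; simp)+
  then show ?thesis using blowup_adjacent[OF B, of i j x y] edges_G7[of i j] ij xy by simp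
qed

lemma blowup_G7_nonadjacent:
  assumes B: "blowup E base_G7 Q S"
    and ij: "(i, j) \<in> {(1, 5), (1, 6), (1, 8), (2, 4), (2, 6), (2, 7), (3, 4), (3, 5), (3, 7), (3, 8), (4, 7), (5, 8), (6, 7), (6, 8), (7, 8)}"
    and xy: "x \<in> Q i" "y \<in> Q j"
  shows "\<not> E x y"
proof -
  have v: "i < j" "i \<in> uverts base_G7" "j \<in> uverts base_G7"
    using ij unfolding verts_G7 by (elim insertE emptyE; simp)+
  have "{i, j} \<notin> uedges base_G7"
    unfolding edges_G7[OF v(1)] using ij by (elim insertE emptyE; simp)
  then show ?thesis using blowup_nonadjacent[OF B, of i j x y] v xy by simp
qed

lemma card_stable_clique_le_1:
  assumes "clique E A" "\<And>u v. u \<in> T \<Longrightarrow> v \<in> T \<Longrightarrow> \<not> E u v"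
  shows "card (T \<inter> A) \<le> 1"
proof -
  have "x = y" if "x \<in> T \<inter> A" "y \<in> T \<inter> A" for x y using that assms cliqueD[OF assms(1)] by blast
  then have "T \<inter> A = {} \<or> (\<exists>x. T \<inter> A = {x})" by blast
  then show ?thesis by auto
qed

context P5_gem_free_graph begin

lemma blowup_G7_cliques:
  assumes B: "blowup E base_G7 Q S"
  shows "clique E (Q 1 \<union> Q 2 \<union> Q 3)" "clique E (Q 4 \<union> Q 5 \<union> Q 6)"
proof -
  have v: "{1, 2, 3} \<subseteq> uverts base_G7" "{4, 5, 6} \<subseteq> uverts base_G7" by (simp_all add: verts_G7)
  have "clique E (\<Union>i\<in>{1, 2, 3}. Q i)"
    by (rule blowup_clique_Union[OF B v(1)]) (elim insertE emptyE; simp add: edges_G7)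
  moreover have "clique E (\<Union>i\<in>{4, 5, 6}. Q i)"
    by (rule blowup_clique_Union[OF B v(2)]) (elim insertE emptyE; simp add: edges_G7)
  ultimately show "clique E (Q 1 \<union> Q 2 \<union> Q 3)" "clique E (Q 4 \<union> Q 5 \<union> Q 6)" by (simp_all add: Un_assoc)
qed

lemma blowup_G7_stable:
  assumes B: "blowup E base_G7 Q S" and f: "finite S" and T: "T \<subseteq> S" "\<And>u v. u \<in> T \<Longrightarrow> v \<in> T \<Longrightarrow> \<not> E u v"
  shows "card T \<le> 3"
proof (rule ccontr)
  assume n: "\<not> card T \<le> 3"
  have fT: "finite T" using T f finite_subset by blast
  have S: "S = Q 1 \<union> Q 2 \<union> Q 3 \<union> (Q 4 \<union> Q 5 \<union> Q 6) \<union> Q 7 \<union> Q 8"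
    using B unfolding blowup_def verts_G7 by auto
  have "T = T \<inter> (Q 1 \<union> Q 2 \<union> Q 3) \<union> T \<inter> (Q 4 \<union> Q 5 \<union> Q 6) \<union> T \<inter> Q 7 \<union> T \<inter> Q 8"
    using T(1) unfolding S by blast
  then have "card T = card (T \<inter> (Q 1 \<union> Q 2 \<union> Q 3) \<union> T \<inter> (Q 4 \<union> Q 5 \<union> Q 6) \<union> T \<inter> Q 7 \<union> T \<inter> Q 8)"
    by (rule arg_cong)
  then have le: "card T \<le> card (T \<inter> (Q 1 \<union> Q 2 \<union> Q 3)) + card (T \<inter> (Q 4 \<union> Q 5 \<union> Q 6)) + card (T \<inter> Q 7) + card (T \<inter> Q 8)"
    using card_Un_le[of "T \<inter> (Q 1 \<union> Q 2 \<union> Q 3) \<union> T \<inter> (Q 4 \<union> Q 5 \<union> Q 6) \<union> T \<inter> Q 7" "T \<inter> Q 8"]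
      card_Un_le[of "T \<inter> (Q 1 \<union> Q 2 \<union> Q 3) \<union> T \<inter> (Q 4 \<union> Q 5 \<union> Q 6)" "T \<inter> Q 7"]
      card_Un_le[of "T \<inter> (Q 1 \<union> Q 2 \<union> Q 3)" "T \<inter> (Q 4 \<union> Q 5 \<union> Q 6)"] by linarith
  have q: "clique E (Q 7)" "clique E (Q 8)" using blowup_clique[OF B] by (simp_all add: verts_G7)
  have "card (T \<inter> (Q 1 \<union> Q 2 \<union> Q 3)) \<le> 1" "card (T \<inter> (Q 4 \<union> Q 5 \<union> Q 6)) \<le> 1" "card (T \<inter> Q 7) \<le> 1" "card (T \<inter> Q 8) \<le> 1"
    by (rule card_stable_clique_le_1[where E = E], use q blowup_G7_cliques[OF B] in blast, use T(2) in blast)+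
  then have one: "card (T \<inter> (Q 1 \<union> Q 2 \<union> Q 3)) = 1" "card (T \<inter> (Q 4 \<union> Q 5 \<union> Q 6)) = 1" "card (T \<inter> Q 7) = 1" "card (T \<inter> Q 8) = 1"
    using le n by linarith+
  have ne: "X \<noteq> {}" if "card X = 1" for X :: "'a set" using that by auto
  obtain x y u v where m: "x \<in> T" "x \<in> Q 1 \<union> Q 2 \<union> Q 3" "y \<in> T" "y \<in> Q 4 \<union> Q 5 \<union> Q 6" "u \<in> T" "u \<in> Q 7" "v \<in> T" "v \<in> Q 8"
    using ne[OF one(1)] ne[OF one(2)] ne[OF one(3)] ne[OF one(4)] by blast
  have e: "\<not> (p \<in> Q i \<and> q \<in> Q j)" if "p \<in> T" "q \<in> T" "(i, j) \<in> {(1::nat, 7::nat), (2, 8), (5, 7), (4, 8), (3, 6)}" for p q i j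
  proof
    assume pq: "p \<in> Q i \<and> q \<in> Q j"
    have "E p q" by (rule blowup_G7_adjacent[OF B, of i j]) (use that(3) pq in auto)
    then show False using T(2)[OF that(1,2)] by blast
  qed
  show False
    using m e[OF m(1,5), of 1 7] e[OF m(1,7), of 2 8] e[OF m(3,5), of 5 7] e[OF m(3,7), of 4 8] e[OF m(1,3), of 3 6]
    by simp
qed

lemma blowup_G7_not_col:
  assumes "blowup E base_G7 Q S" "finite S" "card S > 3 * k" shows "\<not> col E S k"
proof
  assume "col E S k"
  then obtain c where "proper E S c {..<k}" by (auto simp: col_def)
  then show False using card_le_of_fibres[of E S c k 3] blowup_G7_stable[OF assms(1,2)] assms(2,3) by simp
qed

lemma blowup_G1_card:
  assumes B: "blowup E base_G1 Q S" and f: "finite S"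
  shows "card S = card (Q 1) + card (Q 2) + card (Q 3) + card (Q 4) + card (Q 5)"
proof -
  have "card S = (\<Sum>i\<in>uverts base_G1. card (Q i))"
    using B f unfolding blowup_def
    by (subst card_UN_disjoint[symmetric]) (auto simp: verts_G1)
  then show ?thesis by (simp add: verts_G1)
qed

lemma blowup_G7_card:
  assumes B: "blowup E base_G7 Q S" and f: "finite S"
  shows "card S = card (Q 1) + card (Q 2) + card (Q 3) + card (Q 4) + card (Q 5) + card (Q 6) + card (Q 7) + card (Q 8)"
proof -
  have "card S = (\<Sum>i\<in>uverts base_G7. card (Q i))"
    using B f unfolding blowup_def
    by (subst card_UN_disjoint[symmetric]) (auto simp: verts_G7)
  then show ?thesis by (simp add: verts_G7)
qed

lemma blowup_G1_clique_pairs: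
  assumes B: "blowup E base_G1 Q S"
  shows "clique E (Q 1 \<union> Q 2)" "clique E (Q 2 \<union> Q 3)" "clique E (Q 3 \<union> Q 4)" "clique E (Q 4 \<union> Q 5)" "clique E (Q 5 \<union> Q 1)"
proof -
  have "clique E (Q i \<union> Q j)" if "i \<in> uverts base_G1" "j \<in> uverts base_G1" "{i, j} \<in> uedges base_G1" for i j
  proof -
    have "clique E (\<Union>l\<in>{i, j}. Q l)"
      by (rule blowup_clique_Union[OF B]) (use that in \<open>auto simp: insert_commute[of j i]\<close>)
    then show ?thesis by simp
  qed
  then show "clique E (Q 1 \<union> Q 2)" "clique E (Q 2 \<union> Q 3)" "clique E (Q 3 \<union> Q 4)" "clique E (Q 4 \<union> Q 5)" "clique E (Q 5 \<union> Q 1)"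
    by (simp_all add: base_G1_def)
qed

lemma blowup_G1_not_col:
  assumes B: "blowup E base_G1 Q S" and f: "finite S" and "card S > 2 * k" shows "\<not> col E S k"
proof
  assume "col E S k"
  then obtain c where c: "proper E S c {..<k}" by (auto simp: col_def)
  have "card (Q 1) + card (Q 2) + card (Q 3) + card (Q 4) + card (Q 5) \<le> 2 * k"
  proof (rule five_cycle_blowup_bound[OF c])
    show "Q 1 \<union> Q 2 \<union> Q 3 \<union> Q 4 \<union> Q 5 \<subseteq> S" using B by (auto simp: blowup_def verts_G1)
  qed (use blowup_G1_clique_pairs[OF B] blowup_disjoint[OF B] in \<open>auto simp: verts_G1\<close>)
  then show False using blowup_G1_card[OF B f] assms(3) by simp
qed

lemma proper_disjoint_images:
  assumes "proper E R c P" "X \<subseteq> R" "Y \<subseteq> R" "\<And>x y. x \<in> X \<Longrightarrow> y \<in> Y \<Longrightarrow> E x y"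
  shows "c ` X \<inter> c ` Y = {}"
  using assms unfolding proper_def by (auto simp: image_iff) (metis subsetD)

text \<open>A colouring of a blow-up of \<^const>\<open>base_G7\<close>: let \<open>Q 1\<close> and \<open>Q 5\<close> share as many colours as
  \<open>Q 7\<close> needs, let \<open>Q 2\<close> and \<open>Q 4\<close> share as many as \<open>Q 8\<close> needs, and colour the rest of
  the prism, which contains no 5-cycle, optimally.\<close>

lemma blowup_G7_col:
  assumes B: "blowup E base_G7 Q S" and f: "finite S"
    and tri: "card (Q 1) + card (Q 2) + card (Q 3) \<le> k" "card (Q 4) + card (Q 5) + card (Q 6) \<le> k"
    and edg: "card (Q 1) + card (Q 4) \<le> k" "card (Q 2) + card (Q 5) \<le> k" "card (Q 3) + card (Q 6) \<le> k"
      "card (Q 1) + card (Q 7) \<le> k" "card (Q 5) + card (Q 7) \<le> k" "card (Q 2) + card (Q 8) \<le> k" "card (Q 4) + card (Q 8) \<le> k"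
    and cyc: "card (Q 7) + card (Q 1) + card (Q 3) + card (Q 6) + card (Q 5) \<le> 2 * k"
      "card (Q 8) + card (Q 2) + card (Q 3) + card (Q 6) + card (Q 4) \<le> 2 * k"
    and tot: "Q 8 = {} \<or> card S \<le> 3 * k"
  shows "col E S k"
proof -
  have U: "S = Q 1 \<union> Q 2 \<union> Q 3 \<union> Q 4 \<union> Q 5 \<union> Q 6 \<union> Q 7 \<union> Q 8"
    using B unfolding blowup_def verts_G7 by auto
  have fQ: "finite (Q 1)" "finite (Q 2)" "finite (Q 3)" "finite (Q 4)" "finite (Q 5)" "finite (Q 6)" "finite (Q 7)" "finite (Q 8)"
    using f unfolding U by auto
  define \<alpha> where "\<alpha> = card (Q 1) + card (Q 5) + card (Q 7) - k"
  define \<beta> where "\<beta> = (if Q 8 = {} then 0 else card (Q 2) + card (Q 4) + card (Q 8) - k)"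
  have \<alpha>: "\<alpha> \<le> card (Q 1)" "\<alpha> \<le> card (Q 5)" using edg by (simp_all add: \<alpha>_def)
  have \<beta>: "\<beta> \<le> card (Q 2)" "\<beta> \<le> card (Q 4)"
    unfolding \<beta>_def using edg by (cases "Q 8 = {}"; simp)+
  have 36: "card (Q 3) + card (Q 6) + \<alpha> + \<beta> \<le> k"
  proof (cases "Q 8 = {}")
    case True then show ?thesis using edg(3) cyc(1) by (simp add: \<alpha>_def \<beta>_def)
  next
    case False
    then have "card S \<le> 3 * k" using tot by blast
    then show ?thesis using edg(3) cyc blowup_G7_card[OF B f] False by (simp add: \<alpha>_def \<beta>_def)
  qed
  obtain A1 where A1: "A1 \<subseteq> Q 1" "card A1 = \<alpha>" using \<alpha>(1) by (meson obtain_subset_with_card_n)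
  obtain A5 where A5: "A5 \<subseteq> Q 5" "card A5 = \<alpha>" using \<alpha>(2) by (meson obtain_subset_with_card_n)
  obtain B2 where B2: "B2 \<subseteq> Q 2" "card B2 = \<beta>" using \<beta>(1) by (meson obtain_subset_with_card_n)
  obtain B4 where B4: "B4 \<subseteq> Q 4" "card B4 = \<beta>" using \<beta>(2) by (meson obtain_subset_with_card_n)
  have fin: "finite A1" "finite A5" "finite B2" "finite B4"
    using A1 A5 B2 B4 fQ finite_subset by metis+
  have cd: "card (Q 1 - A1) = card (Q 1) - \<alpha>" "card (Q 5 - A5) = card (Q 5) - \<alpha>"
    "card (Q 2 - B2) = card (Q 2) - \<beta>" "card (Q 4 - B4) = card (Q 4) - \<beta>"
    using A1 A5 B2 B4 fin by (simp_all add: card_Diff_subset)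
  let ?QA = "(Q 1 - A1) \<union> (Q 2 - B2) \<union> Q 3" and ?QB = "(Q 4 - B4) \<union> (Q 5 - A5) \<union> Q 6"
  let ?R = "?QA \<union> ?QB"
  note na = blowup_G7_nonadjacent[OF B] and ad = blowup_G7_adjacent[OF B]
  have cQ: "clique E ?QA" "clique E ?QB"
    using blowup_G7_cliques[OF B] by (auto elim: clique_subset)
  have le3: "card (X \<union> Y \<union> Z) \<le> card X + card Y + card Z" for X Y Z :: "'a set"
    using card_Un_le[of "X \<union> Y" Z] card_Un_le[of X Y] by linarith
  have "col E ?R (k - \<alpha> - \<beta>)"
  proof (rule perfect)
    show "finite ?R" using fQ by simp
    show "c5_free E ?R" unfolding c5_free_def
    proof (intro ballI notI)
      fix p q s t u assume m: "p \<in> ?R" "q \<in> ?R" "s \<in> ?R" "t \<in> ?R" "u \<in> ?R" and c: "cycle5 E p q s t u"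
      have ne: "p \<noteq> s" "p \<noteq> t" "q \<noteq> t" "q \<noteq> u" "s \<noteq> u" using c sym unfolding cycle5_def by blast+
      have "\<not> (x \<in> ?QA \<and> y \<in> ?QA)" "\<not> (x \<in> ?QB \<and> y \<in> ?QB)" if "x \<noteq> y" "\<not> E x y" for x y
        using cliqueD[OF cQ(1)] cliqueD[OF cQ(2)] that by blast+
      from this[of p s] this[of p t] this[of q t] this[of q u] this[of s u] ne c m
      show False unfolding cycle5_def Un_iff by argo
    qed
    fix K assume K: "K \<subseteq> ?R" "clique E K"
    have fR: "finite ?R" using fQ by simp
    have nb: "\<not> (K \<inter> Q i \<noteq> {} \<and> K \<inter> Q j \<noteq> {})"
      if ij: "(i, j) \<in> {(1::nat, 5::nat), (1, 6), (2, 4), (2, 6), (3, 4), (3, 5)}" for i j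
    proof
      assume "K \<inter> Q i \<noteq> {} \<and> K \<inter> Q j \<noteq> {}"
      then obtain x y where xy: "x \<in> K" "x \<in> Q i" "y \<in> K" "y \<in> Q j" by blast
      have "Q i \<inter> Q j = {}" using blowup_disjoint[OF B, of i j] ij by (auto simp: verts_G7)
      then have "E x y" using cliqueD[OF K(2)] xy by blast
      then show False using na[of i j x y] ij xy by auto
    qed
    have "K \<subseteq> ?QA \<or> K \<subseteq> ?QB \<or> K \<subseteq> (Q 1 - A1) \<union> (Q 4 - B4) \<or> K \<subseteq> (Q 2 - B2) \<union> (Q 5 - A5) \<or> K \<subseteq> Q 3 \<union> Q 6"
    proof -
      have d: "K \<inter> Q i = {} \<or> K \<inter> Q j = {}"
        if "(i, j) \<in> {(1::nat, 5::nat), (1, 6), (2, 4), (2, 6), (3, 4), (3, 5)}" for i j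
        using nb[OF that] by blast
      have d': "K \<inter> Q 1 = {} \<or> K \<inter> Q 5 = {}" "K \<inter> Q 1 = {} \<or> K \<inter> Q 6 = {}" "K \<inter> Q 2 = {} \<or> K \<inter> Q 4 = {}"
        "K \<inter> Q 2 = {} \<or> K \<inter> Q 6 = {}" "K \<inter> Q 3 = {} \<or> K \<inter> Q 4 = {}" "K \<inter> Q 3 = {} \<or> K \<inter> Q 5 = {}"
        by (rule d; simp)+
      consider "K \<inter> Q 4 = {}" "K \<inter> Q 5 = {}" "K \<inter> Q 6 = {}" | "K \<inter> Q 1 = {}" "K \<inter> Q 2 = {}" "K \<inter> Q 3 = {}"
        | "K \<inter> Q 2 = {}" "K \<inter> Q 3 = {}" "K \<inter> Q 5 = {}" "K \<inter> Q 6 = {}"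
        | "K \<inter> Q 1 = {}" "K \<inter> Q 3 = {}" "K \<inter> Q 4 = {}" "K \<inter> Q 6 = {}"
        | "K \<inter> Q 1 = {}" "K \<inter> Q 2 = {}" "K \<inter> Q 4 = {}" "K \<inter> Q 5 = {}"
        using d' by argo
      then show ?thesis
      proof cases
        case 1 then have "K \<subseteq> ?QA" using K(1) by blast then show ?thesis by (rule disjI1)
      next
        case 2 then have "K \<subseteq> ?QB" using K(1) by blast then show ?thesis by simp
      next
        case 3 then have "K \<subseteq> (Q 1 - A1) \<union> (Q 4 - B4)" using K(1) by blast then show ?thesis by simp
      next
        case 4 then have "K \<subseteq> (Q 2 - B2) \<union> (Q 5 - A5)" using K(1) by blast then show ?thesis by simp
      next
        case 5 then have "K \<subseteq> Q 3 \<union> Q 6" using K(1) by blast then show ?thesis by simp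
      qed
    qed
    then show "card K \<le> k - \<alpha> - \<beta>"
    proof (elim disjE)
      assume "K \<subseteq> ?QA"
      then have "card K \<le> card ?QA" using fQ by (intro card_mono) auto
      also have "\<dots> \<le> card (Q 1) - \<alpha> + (card (Q 2) - \<beta>) + card (Q 3)" using le3[of "Q 1 - A1" "Q 2 - B2" "Q 3"] cd by simp
      finally show ?thesis using tri \<alpha> \<beta> by linarith
    next
      assume "K \<subseteq> ?QB"
      then have "card K \<le> card ?QB" using fQ by (intro card_mono) auto
      also have "\<dots> \<le> card (Q 4) - \<beta> + (card (Q 5) - \<alpha>) + card (Q 6)" using le3[of "Q 4 - B4" "Q 5 - A5" "Q 6"] cd by simp
      finally show ?thesis using tri \<alpha> \<beta> by linarith
    next
      assume "K \<subseteq> (Q 1 - A1) \<union> (Q 4 - B4)"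
      then have "card K \<le> card ((Q 1 - A1) \<union> (Q 4 - B4))" using fQ by (intro card_mono) auto
      also have "\<dots> \<le> card (Q 1) - \<alpha> + (card (Q 4) - \<beta>)" using card_Un_le[of "Q 1 - A1" "Q 4 - B4"] cd by simp
      finally show ?thesis using edg \<alpha> \<beta> by linarith
    next
      assume "K \<subseteq> (Q 2 - B2) \<union> (Q 5 - A5)"
      then have "card K \<le> card ((Q 2 - B2) \<union> (Q 5 - A5))" using fQ by (intro card_mono) auto
      also have "\<dots> \<le> card (Q 2) - \<beta> + (card (Q 5) - \<alpha>)" using card_Un_le[of "Q 2 - B2" "Q 5 - A5"] cd by simp
      finally show ?thesis using edg \<alpha> \<beta> by linarith
    next
      assume "K \<subseteq> Q 3 \<union> Q 6"
      then have "card K \<le> card (Q 3 \<union> Q 6)" using fQ by (intro card_mono) auto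
      also have "\<dots> \<le> card (Q 3) + card (Q 6)" by (rule card_Un_le)
      finally show ?thesis using 36 by linarith
    qed
  qed
  then obtain c where c: "proper E ?R c {..<k - \<alpha> - \<beta>}" by (auto simp: col_def)
  define CA where "CA = {k - \<alpha> - \<beta>..<k - \<beta>}"
  define CB where "CB = {k - \<beta>..<k}"
  have C: "card CA = \<alpha>" "card CB = \<beta>" "CA \<inter> CB = {}" "CA \<subseteq> {..<k}" "CB \<subseteq> {..<k}" "finite CA" "finite CB"
    using 36 by (auto simp: CA_def CB_def)
  have im: "c ` X \<subseteq> {..<k - \<alpha> - \<beta>}" if "X \<subseteq> ?R" for X using proper_range[OF c] that by blast
  have imC: "c ` X \<inter> CA = {}" "c ` X \<inter> CB = {}" "c ` X \<subseteq> {..<k}" if "X \<subseteq> ?R" for X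
  proof -
    show "c ` X \<inter> CA = {}" using im[OF that] by (force simp: CA_def)
    show "c ` X \<inter> CB = {}" using im[OF that] by (force simp: CB_def)
    show "c ` X \<subseteq> {..<k}" using im[OF that] by force
  qed
  have ci: "card (c ` X) = card X" if "X \<subseteq> ?R" "X \<subseteq> Q i" "i \<in> {1,2,3,4,5,6}" for X i
    using proper_card_clique[OF c that(1) clique_subset[OF blowup_clique[OF B, of i] that(2)]] that(3)
    by (auto simp: verts_G7)
  define P1 where "P1 = c ` (Q 1 - A1) \<union> CA"
  define P2 where "P2 = c ` (Q 2 - B2) \<union> CB"
  define P3 where "P3 = c ` Q 3"
  define P4 where "P4 = c ` (Q 4 - B4) \<union> CB"
  define P5 where "P5 = c ` (Q 5 - A5) \<union> CA"
  define P6 where "P6 = c ` Q 6"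
  define P7 where "P7 = {..<k} - (P1 \<union> P5)"
  define P8 where "P8 = {..<k} - (P2 \<union> P4)"
  have sR: "Q 1 - A1 \<subseteq> ?R" "Q 2 - B2 \<subseteq> ?R" "Q 3 \<subseteq> ?R" "Q 4 - B4 \<subseteq> ?R" "Q 5 - A5 \<subseteq> ?R" "Q 6 \<subseteq> ?R" by auto
  have sub: "P1 \<subseteq> {..<k}" "P2 \<subseteq> {..<k}" "P3 \<subseteq> {..<k}" "P4 \<subseteq> {..<k}" "P5 \<subseteq> {..<k}" "P6 \<subseteq> {..<k}" "P7 \<subseteq> {..<k}" "P8 \<subseteq> {..<k}"
    unfolding P1_def P2_def P3_def P4_def P5_def P6_def P7_def P8_def
    by (intro Un_least imC(3) sR C(4,5) Diff_subset)+
  have fP: "finite P1" "finite P2" "finite P3" "finite P4" "finite P5" "finite P6" "finite P7" "finite P8"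
    by (rule sub[THEN finite_subset, OF finite_lessThan])+
  have k15: "card (P1 \<union> P5) \<le> card (Q 1) + card (Q 5) - \<alpha>"
  proof -
    have "P1 \<union> P5 = c ` (Q 1 - A1) \<union> c ` (Q 5 - A5) \<union> CA" unfolding P1_def P5_def by blast
    then have "card (P1 \<union> P5) \<le> card (c ` (Q 1 - A1)) + card (c ` (Q 5 - A5)) + card CA"
      using card_Un_le[of "c ` (Q 1 - A1) \<union> c ` (Q 5 - A5)" CA] card_Un_le[of "c ` (Q 1 - A1)" "c ` (Q 5 - A5)"] by simp
    then show ?thesis using ci[OF sR(1), of 1] ci[OF sR(5), of 5] cd C \<alpha> by auto
  qed
  have k24: "card (P2 \<union> P4) \<le> card (Q 2) + card (Q 4) - \<beta>"
  proof -
    have "P2 \<union> P4 = c ` (Q 2 - B2) \<union> c ` (Q 4 - B4) \<union> CB" unfolding P2_def P4_def by blast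
    then have "card (P2 \<union> P4) \<le> card (c ` (Q 2 - B2)) + card (c ` (Q 4 - B4)) + card CB"
      using card_Un_le[of "c ` (Q 2 - B2) \<union> c ` (Q 4 - B4)" CB] card_Un_le[of "c ` (Q 2 - B2)" "c ` (Q 4 - B4)"] by simp
    then show ?thesis using ci[OF sR(2), of 2] ci[OF sR(4), of 4] cd C \<beta> by auto
  qed
  have cP: "card (Q 1) \<le> card P1" "card (Q 2) \<le> card P2" "card (Q 3) \<le> card P3" "card (Q 4) \<le> card P4"
    "card (Q 5) \<le> card P5" "card (Q 6) \<le> card P6" "card (Q 7) \<le> card P7" "card (Q 8) \<le> card P8"
  proof -
    show "card (Q 1) \<le> card P1" unfolding P1_def
      using card_Un_disjoint[OF _ C(6) imC(1)[OF sR(1)]] ci[OF sR(1), of 1] fQ cd C \<alpha> by simp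
    show "card (Q 5) \<le> card P5" unfolding P5_def
      using card_Un_disjoint[OF _ C(6) imC(1)[OF sR(5)]] ci[OF sR(5), of 5] fQ cd C \<alpha> by simp
    show "card (Q 2) \<le> card P2" unfolding P2_def
      using card_Un_disjoint[OF _ C(7) imC(2)[OF sR(2)]] ci[OF sR(2), of 2] fQ cd C \<beta> by simp
    show "card (Q 4) \<le> card P4" unfolding P4_def
      using card_Un_disjoint[OF _ C(7) imC(2)[OF sR(4)]] ci[OF sR(4), of 4] fQ cd C \<beta> by simp
    show "card (Q 3) \<le> card P3" unfolding P3_def using ci[OF sR(3), of 3] by simp
    show "card (Q 6) \<le> card P6" unfolding P6_def using ci[OF sR(6), of 6] by simp
    have "card P7 \<ge> k - card (P1 \<union> P5)" unfolding P7_def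
      using diff_card_le_card_Diff[of "P1 \<union> P5" "{..<k}"] fP by simp
    then show "card (Q 7) \<le> card P7" using k15 edg \<alpha> by (simp add: \<alpha>_def)
    show "card (Q 8) \<le> card P8"
    proof (cases "Q 8 = {}")
      case False
      have "card P8 \<ge> k - card (P2 \<union> P4)" unfolding P8_def
        using diff_card_le_card_Diff[of "P2 \<union> P4" "{..<k}"] fP by simp
      then show ?thesis using k24 edg \<beta> False by (simp add: \<beta>_def)
    qed simp
  qed
  have dis: "c ` X \<inter> c ` Y = {}" if "X \<subseteq> ?R" "Y \<subseteq> ?R" "X \<subseteq> Q i" "Y \<subseteq> Q j"
    "(i, j) \<in> {(1::nat, 2::nat), (1, 3), (1, 4), (2, 3), (2, 5), (3, 6), (4, 5), (4, 6), (5, 6)}" for X Y i j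
    by (rule proper_disjoint_images[OF c that(1,2)], rule ad[of i j]) (use that in auto)
  have dP: "P1 \<inter> P2 = {}" "P1 \<inter> P3 = {}" "P1 \<inter> P4 = {}" "P1 \<inter> P7 = {}" "P2 \<inter> P3 = {}" "P2 \<inter> P5 = {}" "P2 \<inter> P8 = {}"
    "P3 \<inter> P6 = {}" "P4 \<inter> P5 = {}" "P4 \<inter> P6 = {}" "P4 \<inter> P8 = {}" "P5 \<inter> P6 = {}" "P5 \<inter> P7 = {}"
  proof -
    have du: "(X \<union> A) \<inter> (Y \<union> B) = {}" if "X \<inter> Y = {}" "X \<inter> B = {}" "Y \<inter> A = {}" "A \<inter> B = {}" for X Y A B :: "nat set"
      using that by blast
    have du1: "(X \<union> A) \<inter> Y = {}" "Y \<inter> (X \<union> A) = {}" if "X \<inter> Y = {}" "Y \<inter> A = {}" for X Y A :: "nat set"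
      using that by blast+
    have C3: "CB \<inter> CA = {}" using C(3) by blast
    have e12: "c ` (Q 1 - A1) \<inter> c ` (Q 2 - B2) = {}" by (rule dis[OF sR(1,2), of 1 2]) auto
    show "P1 \<inter> P2 = {}" unfolding P1_def P2_def by (rule du[OF e12 imC(2)[OF sR(1)] imC(1)[OF sR(2)] C(3)])
    have e13: "c ` (Q 1 - A1) \<inter> c ` Q 3 = {}" by (rule dis[OF sR(1,3), of 1 3]) auto
    show "P1 \<inter> P3 = {}" unfolding P1_def P3_def by (rule du1(1)[OF e13 imC(1)[OF sR(3)]])
    have e14: "c ` (Q 1 - A1) \<inter> c ` (Q 4 - B4) = {}" by (rule dis[OF sR(1,4), of 1 4]) auto
    show "P1 \<inter> P4 = {}" unfolding P1_def P4_def by (rule du[OF e14 imC(2)[OF sR(1)] imC(1)[OF sR(4)] C(3)])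
    have e23: "c ` (Q 2 - B2) \<inter> c ` Q 3 = {}" by (rule dis[OF sR(2,3), of 2 3]) auto
    show "P2 \<inter> P3 = {}" unfolding P2_def P3_def by (rule du1(1)[OF e23 imC(2)[OF sR(3)]])
    have e25: "c ` (Q 2 - B2) \<inter> c ` (Q 5 - A5) = {}" by (rule dis[OF sR(2,5), of 2 5]) auto
    show "P2 \<inter> P5 = {}" unfolding P2_def P5_def by (rule du[OF e25 imC(1)[OF sR(2)] imC(2)[OF sR(5)] C3])
    have e36: "c ` Q 3 \<inter> c ` Q 6 = {}" by (rule dis[OF sR(3,6), of 3 6]) auto
    show "P3 \<inter> P6 = {}" unfolding P3_def P6_def by (rule e36)
    have e45: "c ` (Q 4 - B4) \<inter> c ` (Q 5 - A5) = {}" by (rule dis[OF sR(4,5), of 4 5]) auto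
    show "P4 \<inter> P5 = {}" unfolding P4_def P5_def by (rule du[OF e45 imC(1)[OF sR(4)] imC(2)[OF sR(5)] C3])
    have e46: "c ` (Q 4 - B4) \<inter> c ` Q 6 = {}" by (rule dis[OF sR(4,6), of 4 6]) auto
    show "P4 \<inter> P6 = {}" unfolding P4_def P6_def by (rule du1(1)[OF e46 imC(2)[OF sR(6)]])
    have e56: "c ` (Q 5 - A5) \<inter> c ` Q 6 = {}" by (rule dis[OF sR(5,6), of 5 6]) auto
    show "P5 \<inter> P6 = {}" unfolding P5_def P6_def by (rule du1(1)[OF e56 imC(1)[OF sR(6)]])
  qed (auto simp: P7_def P8_def)
  let ?qs = "[(Q 1, P1), (Q 2, P2), (Q 3, P3), (Q 4, P4), (Q 5, P5), (Q 6, P6), (Q 7, P7), (Q 8, P8)]"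
  show ?thesis
  proof (rule col_by_palette_list[of ?qs])
    show "finite Q' \<and> finite P \<and> card Q' \<le> card P \<and> P \<subseteq> {..<k}" if "(Q', P) \<in> set ?qs" for Q' P
      using that fQ fP cP sub by auto
    show "S \<subseteq> (\<Union>(Q', P)\<in>set ?qs. Q')" unfolding U by auto
    have n: "\<forall>x\<in>Q i. \<forall>y\<in>Q j. \<not> E x y" if "(i, j) \<in> {(1, 5), (1, 6), (1, 8), (2, 4), (2, 6), (2, 7), (3, 4), (3, 5), (3, 7), (3, 8), (4, 7), (5, 8), (6, 7), (6, 8), (7, 8)}" for i j
      using na[OF that] by blast
    show "sorted_wrt (\<lambda>(Q, P) (Q', P'). P \<inter> P' = {} \<or> (\<forall>x\<in>Q. \<forall>y\<in>Q'. \<not> E x y)) ?qs"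
      using dP n[of 1 5] n[of 1 6] n[of 2 4] n[of 2 6] n[of 3 4] n[of 3 5] n[of 1 8] n[of 2 7] n[of 3 7] n[of 3 8]
        n[of 4 7] n[of 5 8] n[of 6 7] n[of 6 8] n[of 7 8] by simp
  qed
qed

end

section \<open>Clique sizes in the critical blow-ups\<close>

definition critical_G7 :: "nat list list" where
  "critical_G7 = [[1,3,1,3,1,1,4,2], [1,2,2,3,1,1,4,2], [1,1,3,3,1,1,4,2], [1,2,2,2,1,2,4,2], [2,2,1,2,2,1,3,3],
     [2,1,2,2,2,1,3,3], [1,1,3,2,2,1,3,3], [2,1,2,2,1,2,3,3], [1,2,2,2,1,1,4,3], [1,1,3,2,1,1,4,3],
     [1,2,2,1,1,2,4,3], [1,1,3,1,1,1,4,4], [1,1,2,1,1,2,4,4]]"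

definition critical_G1 :: "nat list list" where
  "critical_G1 = [[4,1,4,1,1], [4,1,3,2,1], [3,2,3,2,1], [3,2,2,3,1], [3,2,2,2,2]]"

lemma critical_G7_check33: "\<forall>n1\<in>{1,2}. \<forall>n5\<in>{1,2}. \<forall>n2\<in>{1,2}. \<forall>n4\<in>{1,2}. \<forall>n3\<in>{1,2,3}. \<forall>n6\<in>{1,2,3::nat}.
     (if n1 + n2 + n3 \<le> 5 \<and> n4 + n5 + n6 \<le> 5 \<and> n3 + n6 \<le> 5 \<and> 3 + n1 + n3 + n6 + n5 \<le> 10 \<and> 3 + n2 + n3 + n6 + n4 \<le> 10 \<and> n1 + n2 + n3 + n4 + n5 + n6 + 3 + 3 = 16
      then [n1,n2,n3,n4,n5,n6,3,3] \<in> set critical_G7 \<or> [n2,n1,n3,n5,n4,n6,3,3] \<in> set critical_G7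
          \<or> [n5,n4,n6,n2,n1,n3,3,3] \<in> set critical_G7 \<or> [n4,n5,n6,n1,n2,n3,3,3] \<in> set critical_G7 else True)"
  by (simp add: critical_G7_def)

lemma critical_G7_check42: "\<forall>n1\<in>{1}. \<forall>n5\<in>{1}. \<forall>n2\<in>{1,2,3}. \<forall>n4\<in>{1,2,3}. \<forall>n3\<in>{1,2,3}. \<forall>n6\<in>{1,2,3::nat}.
     (if n1 + n2 + n3 \<le> 5 \<and> n4 + n5 + n6 \<le> 5 \<and> n3 + n6 \<le> 5 \<and> 4 + n1 + n3 + n6 + n5 \<le> 10 \<and> 2 + n2 + n3 + n6 + n4 \<le> 10 \<and> n1 + n2 + n3 + n4 + n5 + n6 + 4 + 2 = 16
      then [n1,n2,n3,n4,n5,n6,4,2] \<in> set critical_G7 \<or> [n2,n1,n3,n5,n4,n6,2,4] \<in> set critical_G7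
          \<or> [n5,n4,n6,n2,n1,n3,4,2] \<in> set critical_G7 \<or> [n4,n5,n6,n1,n2,n3,2,4] \<in> set critical_G7 else True)"
  by (simp add: critical_G7_def)

lemma critical_G7_check43: "\<forall>n1\<in>{1}. \<forall>n5\<in>{1}. \<forall>n2\<in>{1,2}. \<forall>n4\<in>{1,2}. \<forall>n3\<in>{1,2,3}. \<forall>n6\<in>{1,2,3::nat}.
     (if n1 + n2 + n3 \<le> 5 \<and> n4 + n5 + n6 \<le> 5 \<and> n3 + n6 \<le> 5 \<and> 4 + n1 + n3 + n6 + n5 \<le> 10 \<and> 3 + n2 + n3 + n6 + n4 \<le> 10 \<and> n1 + n2 + n3 + n4 + n5 + n6 + 4 + 3 = 16
      then [n1,n2,n3,n4,n5,n6,4,3] \<in> set critical_G7 \<or> [n2,n1,n3,n5,n4,n6,3,4] \<in> set critical_G7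
          \<or> [n5,n4,n6,n2,n1,n3,4,3] \<in> set critical_G7 \<or> [n4,n5,n6,n1,n2,n3,3,4] \<in> set critical_G7 else True)"
  by (simp add: critical_G7_def)

lemma critical_G7_check44: "\<forall>n1\<in>{1}. \<forall>n5\<in>{1}. \<forall>n2\<in>{1}. \<forall>n4\<in>{1}. \<forall>n3\<in>{1,2,3}. \<forall>n6\<in>{1,2,3::nat}.
     (if n1 + n2 + n3 \<le> 5 \<and> n4 + n5 + n6 \<le> 5 \<and> n3 + n6 \<le> 5 \<and> 4 + n1 + n3 + n6 + n5 \<le> 10 \<and> 4 + n2 + n3 + n6 + n4 \<le> 10 \<and> n1 + n2 + n3 + n4 + n5 + n6 + 4 + 4 = 16
      then [n1,n2,n3,n4,n5,n6,4,4] \<in> set critical_G7 \<or> [n2,n1,n3,n5,n4,n6,4,4] \<in> set critical_G7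
          \<or> [n5,n4,n6,n2,n1,n3,4,4] \<in> set critical_G7 \<or> [n4,n5,n6,n1,n2,n3,4,4] \<in> set critical_G7 else True)"
  by (simp add: critical_G7_def)

lemma critical_G7_weights_aux:
  fixes n1 n2 n3 n4 n5 n6 n7 n8 :: nat
  assumes a: "n1 + n2 + n3 \<le> 5" "n4 + n5 + n6 \<le> 5" "n1 + n4 \<le> 5" "n2 + n5 \<le> 5" "n3 + n6 \<le> 5"
    "n1 + n7 \<le> 5" "n5 + n7 \<le> 5" "n2 + n8 \<le> 5" "n4 + n8 \<le> 5"
    "n7 + n1 + n3 + n6 + n5 \<le> 10" "n8 + n2 + n3 + n6 + n4 \<le> 10"
    "n1 + n2 + n3 + n4 + n5 + n6 + n7 + n8 = 16" and le: "n8 \<le> n7"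
  shows "[n1,n2,n3,n4,n5,n6,n7,n8] \<in> set critical_G7 \<or> [n2,n1,n3,n5,n4,n6,n8,n7] \<in> set critical_G7
          \<or> [n5,n4,n6,n2,n1,n3,n7,n8] \<in> set critical_G7 \<or> [n4,n5,n6,n1,n2,n3,n8,n7] \<in> set critical_G7"
proof -
  have p: "1 \<le> n1" "1 \<le> n2" "1 \<le> n3" "1 \<le> n4" "1 \<le> n5" "1 \<le> n6"
    using a(7,11,12) a(9,10,12) a(2,6,8,12) a(8,10,12) a(6,11,12) a(1,7,9,12) by linarith+
  have b0: "6 \<le> n7 + n8" "n7 \<le> 4" "n8 \<le> 4" using a(1,2,12) a(6) p(1) a(8) p(2) by linarith+
  then have b: "3 \<le> n7" "n7 \<le> 4" "2 \<le> n8" "n8 \<le> 4" "6 \<le> n7 + n8" using le by linarith+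
  have u: "n1 \<le> 2" "n5 \<le> 2" "n2 \<le> 3" "n4 \<le> 3" "n3 \<le> 3"
    using a(6,7) b(1) a(8,9) b(3) a(1) p(1,2) by linarith+
  have c: "n7 = 3 \<and> n8 = 3 \<or> n7 = 4 \<and> n8 = 2 \<or> n7 = 4 \<and> n8 = 3 \<or> n7 = 4 \<and> n8 = 4"
    using b le by presburger
  have u6: "n6 \<le> 3" using a(2) p(4,5) by linarith
  have m3: "n3 \<in> {1,2,3}" "n6 \<in> {1,2,3}" unfolding insert_iff empty_iff using p(3,6) u(5) u6 by presburger+
  have h: "n1 + n2 + n3 \<le> 5 \<and> n4 + n5 + n6 \<le> 5 \<and> n3 + n6 \<le> 5 \<and> n7 + n1 + n3 + n6 + n5 \<le> 10 \<and> n8 + n2 + n3 + n6 + n4 \<le> 10 \<and> n1 + n2 + n3 + n4 + n5 + n6 + n7 + n8 = 16"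
    using a(1,2,5,10-12) by blast
  from c show ?thesis
  proof (elim disjE conjE)
    assume n: "n7 = 3" "n8 = 3"
    have m: "n1 \<in> {1,2}" "n5 \<in> {1,2}" "n2 \<in> {1,2}" "n4 \<in> {1,2}"
      unfolding insert_iff empty_iff using a(6-9) p(1,2,4,5) n by presburger+
    show ?thesis
      using critical_G7_check33[THEN bspec, OF m(1), THEN bspec, OF m(2), THEN bspec, OF m(3), THEN bspec, OF m(4),
          THEN bspec, OF m3(1), THEN bspec, OF m3(2), unfolded if_P[OF h[unfolded n]]] unfolding n .
  next
    assume n: "n7 = 4" "n8 = 2"
    have m: "n1 \<in> {1}" "n5 \<in> {1}" "n2 \<in> {1,2,3}" "n4 \<in> {1,2,3}"
      unfolding insert_iff empty_iff using a(6-9) p(1,2,4,5) n by presburger+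
    show ?thesis
      using critical_G7_check42[THEN bspec, OF m(1), THEN bspec, OF m(2), THEN bspec, OF m(3), THEN bspec, OF m(4),
          THEN bspec, OF m3(1), THEN bspec, OF m3(2), unfolded if_P[OF h[unfolded n]]] unfolding n .
  next
    assume n: "n7 = 4" "n8 = 3"
    have m: "n1 \<in> {1}" "n5 \<in> {1}" "n2 \<in> {1,2}" "n4 \<in> {1,2}"
      unfolding insert_iff empty_iff using a(6-9) p(1,2,4,5) n by presburger+
    show ?thesis
      using critical_G7_check43[THEN bspec, OF m(1), THEN bspec, OF m(2), THEN bspec, OF m(3), THEN bspec, OF m(4),
          THEN bspec, OF m3(1), THEN bspec, OF m3(2), unfolded if_P[OF h[unfolded n]]] unfolding n .
  next
    assume n: "n7 = 4" "n8 = 4"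
    have m: "n1 \<in> {1}" "n5 \<in> {1}" "n2 \<in> {1}" "n4 \<in> {1}"
      unfolding insert_iff empty_iff using a(6-9) p(1,2,4,5) n by presburger+
    show ?thesis
      using critical_G7_check44[THEN bspec, OF m(1), THEN bspec, OF m(2), THEN bspec, OF m(3), THEN bspec, OF m(4),
          THEN bspec, OF m3(1), THEN bspec, OF m3(2), unfolded if_P[OF h[unfolded n]]] unfolding n .
  qed
qed

lemma critical_G7_weights:
  fixes n1 n2 n3 n4 n5 n6 n7 n8 :: nat
  assumes a: "n1 + n2 + n3 \<le> 5" "n4 + n5 + n6 \<le> 5" "n1 + n4 \<le> 5" "n2 + n5 \<le> 5" "n3 + n6 \<le> 5"
    "n1 + n7 \<le> 5" "n5 + n7 \<le> 5" "n2 + n8 \<le> 5" "n4 + n8 \<le> 5"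
    "n7 + n1 + n3 + n6 + n5 \<le> 10" "n8 + n2 + n3 + n6 + n4 \<le> 10"
    "n1 + n2 + n3 + n4 + n5 + n6 + n7 + n8 = 16"
  shows "[n1,n2,n3,n4,n5,n6,n7,n8] \<in> set critical_G7 \<or> [n2,n1,n3,n5,n4,n6,n8,n7] \<in> set critical_G7
          \<or> [n5,n4,n6,n2,n1,n3,n7,n8] \<in> set critical_G7 \<or> [n4,n5,n6,n1,n2,n3,n8,n7] \<in> set critical_G7"
proof (cases "n8 \<le> n7")
  case True then show ?thesis using critical_G7_weights_aux a by blast
next
  case False
  have "[n2,n1,n3,n5,n4,n6,n8,n7] \<in> set critical_G7 \<or> [n1,n2,n3,n4,n5,n6,n7,n8] \<in> set critical_G7
          \<or> [n4,n5,n6,n1,n2,n3,n8,n7] \<in> set critical_G7 \<or> [n5,n4,n6,n2,n1,n3,n7,n8] \<in> set critical_G7"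
    by (rule critical_G7_weights_aux) (use a False in linarith)+
  then show ?thesis by blast
qed

lemma critical_G1_check:
  "\<forall>n1\<in>{1,2,3,4::nat}. \<forall>n2\<in>{1,2,3,4}. if n1 + n2 \<le> 5 then \<forall>n3\<in>{1,2,3,4}. if n2 + n3 \<le> 5 then
     \<forall>n4\<in>{1,2,3,4}. if n3 + n4 \<le> 5 then \<forall>n5\<in>{1,2,3,4}.
       if n4 + n5 \<le> 5 \<and> n5 + n1 \<le> 5 \<and> n1 + n2 + n3 + n4 + n5 = 11
       then list_ex (\<lambda>ns. ns \<in> set critical_G1) [[n1,n2,n3,n4,n5], [n2,n3,n4,n5,n1], [n3,n4,n5,n1,n2], [n4,n5,n1,n2,n3], [n5,n1,n2,n3,n4],
          [n5,n4,n3,n2,n1], [n4,n3,n2,n1,n5], [n3,n2,n1,n5,n4], [n2,n1,n5,n4,n3], [n1,n5,n4,n3,n2]] else True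
     else True else True else True"
  by (simp add: critical_G1_def)

lemma critical_G1_weights:
  fixes n1 n2 n3 n4 n5 :: nat
  assumes a: "n1 + n2 \<le> 5" "n2 + n3 \<le> 5" "n3 + n4 \<le> 5" "n4 + n5 \<le> 5" "n5 + n1 \<le> 5"
    "n1 + n2 + n3 + n4 + n5 = 11"
  shows "list_ex (\<lambda>ns. ns \<in> set critical_G1) [[n1,n2,n3,n4,n5], [n2,n3,n4,n5,n1], [n3,n4,n5,n1,n2], [n4,n5,n1,n2,n3], [n5,n1,n2,n3,n4],
          [n5,n4,n3,n2,n1], [n4,n3,n2,n1,n5], [n3,n2,n1,n5,n4], [n2,n1,n5,n4,n3], [n1,n5,n4,n3,n2]]"
proof -
  have b: "1 \<le> n1" "n1 \<le> 4" "1 \<le> n2" "n2 \<le> 4" "1 \<le> n3" "n3 \<le> 4" "1 \<le> n4" "n4 \<le> 4" "1 \<le> n5" "n5 \<le> 4"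
    using a by presburger+
  have m: "n1 \<in> {1,2,3,4}" "n2 \<in> {1,2,3,4}" "n3 \<in> {1,2,3,4}" "n4 \<in> {1,2,3,4}" "n5 \<in> {1,2,3,4}"
    unfolding insert_iff empty_iff using b by presburger+
  have h: "n4 + n5 \<le> 5 \<and> n5 + n1 \<le> 5 \<and> n1 + n2 + n3 + n4 + n5 = 11" using a by blast
  from critical_G1_check[THEN bspec, OF m(1), THEN bspec, OF m(2), unfolded if_P[OF a(1)], THEN bspec, OF m(3),
      unfolded if_P[OF a(2)], THEN bspec, OF m(4), unfolded if_P[OF a(3)], THEN bspec, OF m(5), unfolded if_P[OF h]]
  show ?thesis .
qed

lemma base_G7_automorphism:
  assumes p: "p \<in> {[1,2,3,4,5,6,7,8], [2,1,3,5,4,6,8,7], [5,4,6,2,1,3,7,8], [4,5,6,1,2,3,8,7]}"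
    and ij: "i \<in> uverts base_G7" "j \<in> uverts base_G7"
  shows "p ! (i - 1) \<in> uverts base_G7" "p ! (i - 1) = p ! (j - 1) \<longleftrightarrow> i = j"
    "{i, j} \<in> uedges base_G7 \<longleftrightarrow> {p ! (i - 1), p ! (j - 1)} \<in> uedges base_G7"
  using p ij unfolding verts_G7
  by (elim insertE emptyE; simp add: base_G7_def doubleton_eq_iff)+

lemma base_G1_automorphism:
  assumes p: "p \<in> set [[1,2,3,4,5], [2,3,4,5,1], [3,4,5,1,2], [4,5,1,2,3], [5,1,2,3,4],
          [5,4,3,2,1], [4,3,2,1,5], [3,2,1,5,4], [2,1,5,4,3], [1,5,4,3,2]]"
    and ij: "i \<in> uverts base_G1" "j \<in> uverts base_G1"
  shows "p ! (i - 1) \<in> uverts base_G1" "p ! (i - 1) = p ! (j - 1) \<longleftrightarrow> i = j"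
    "{i, j} \<in> uedges base_G1 \<longleftrightarrow> {p ! (i - 1), p ! (j - 1)} \<in> uedges base_G1"
  using p ij unfolding verts_G1 list.set
  by (elim insertE emptyE; simp add: base_G1_def doubleton_eq_iff)+

lemma base_G1_in_base_G7:
  assumes p: "p \<in> {[7,1,3,6,5], [8,2,3,6,4]}" and ij: "i \<in> uverts base_G1" "j \<in> uverts base_G1"
  shows "p ! (i - 1) \<in> uverts base_G7" "p ! (i - 1) = p ! (j - 1) \<longleftrightarrow> i = j"
    "{i, j} \<in> uedges base_G1 \<longleftrightarrow> {p ! (i - 1), p ! (j - 1)} \<in> uedges base_G7"
  using p ij unfolding verts_G1
  by (elim insertE emptyE; simp add: verts_G7 base_G1_def base_G7_def doubleton_eq_iff)+

lemma blowup_G7_automorphism: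
  assumes B: "blowup E base_G7 Q S"
    and p: "p \<in> {[1,2,3,4,5,6,7,8], [2,1,3,5,4,6,8,7], [5,4,6,2,1,3,7,8], [4,5,6,1,2,3,8,7]}"
  shows "blowup E base_G7 (\<lambda>i. Q (p ! (i - 1))) S"
proof -
  have "blowup E base_G7 (\<lambda>i. Q (p ! (i - 1))) (\<Union>i\<in>uverts base_G7. Q (p ! (i - 1)))"
    by (rule blowup_reindex[OF B inj_onI]) (use base_G7_automorphism[OF p] in blast)+
  moreover have "(\<Union>i\<in>uverts base_G7. Q (p ! (i - 1))) = S"
    using p B unfolding blowup_def verts_G7 by (elim insertE emptyE) (simp_all add: Un_ac)
  ultimately show ?thesis by simp
qed

lemma blowup_G1_automorphism:
  assumes B: "blowup E base_G1 Q S"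
    and p: "p \<in> set [[1,2,3,4,5], [2,3,4,5,1], [3,4,5,1,2], [4,5,1,2,3], [5,1,2,3,4],
          [5,4,3,2,1], [4,3,2,1,5], [3,2,1,5,4], [2,1,5,4,3], [1,5,4,3,2]]"
  shows "blowup E base_G1 (\<lambda>i. Q (p ! (i - 1))) S"
proof -
  have "blowup E base_G1 (\<lambda>i. Q (p ! (i - 1))) (\<Union>i\<in>uverts base_G1. Q (p ! (i - 1)))"
    by (rule blowup_reindex[OF B inj_onI]) (use base_G1_automorphism[OF p] in blast)+
  moreover have "(\<Union>i\<in>uverts base_G1. Q (p ! (i - 1))) = S"
    using p B unfolding blowup_def verts_G1 list.set by (elim insertE emptyE) (simp_all add: Un_ac)
  ultimately show ?thesis by simp
qed

lemma blowup_G1_of_G7: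
  assumes B: "blowup E base_G7 Q S" and p: "p \<in> {[7,1,3,6,5], [8,2,3,6,4]}"
  shows "blowup E base_G1 (\<lambda>i. Q (p ! (i - 1))) (\<Union>i\<in>uverts base_G1. Q (p ! (i - 1)))"
  by (rule blowup_reindex[OF B inj_onI]) (use base_G1_in_base_G7[OF p] in blast)+

context critical_graph begin

lemma subset_not_col: "S \<subseteq> V \<Longrightarrow> \<not> col E S 5 \<Longrightarrow> S = V"
  using proper_exists unfolding col_def by blast

lemma blowup_G1_critical:
  assumes B: "blowup E base_G1 Q S" and S: "S \<subseteq> V" "card S > 10"
  shows "S = V \<and> card V = 11"
proof -
  have fS: "finite S" using S finV finite_subset by blast
  have "11 \<le> card S" using S by simp
  then obtain T where T: "T \<subseteq> S" "card T = 11" by (meson obtain_subset_with_card_n)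
  have "S \<inter> T = T" using T by blast
  then have "\<not> col E T 5"
    using blowup_G1_not_col[OF blowup_restrict[OF B, of T], of 5] T fS finite_subset by auto
  then show ?thesis using subset_not_col[of T] T S by auto
qed

theorem critical_blowup:
  "(\<exists>Q. \<exists>ns\<in>set critical_G7. blowup E base_G7 Q V \<and> (\<forall>i\<in>uverts base_G7. card (Q i) = ns ! (i - 1))) \<or>
   (\<exists>Q. \<exists>ns\<in>set critical_G1. blowup E base_G1 Q V \<and> (\<forall>i\<in>uverts base_G1. card (Q i) = ns ! (i - 1)))"
proof -
  obtain Q where B: "blowup E base_G7 Q V" using blowup_of_G7 by blast
  have sub: "Q i \<subseteq> V" if "i \<in> uverts base_G7" for i using B that unfolding blowup_def by blast
  have v: "1 \<in> uverts base_G7" "2 \<in> uverts base_G7" "3 \<in> uverts base_G7" "4 \<in> uverts base_G7"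
    "5 \<in> uverts base_G7" "6 \<in> uverts base_G7" "7 \<in> uverts base_G7" "8 \<in> uverts base_G7" by (simp_all add: verts_G7)
  note s = v[THEN sub] and c = v[THEN blowup_clique[OF B]]
  have ad: "\<forall>x\<in>Q i. \<forall>y\<in>Q j. E x y" if "(i, j) \<in> {(1, 2), (1, 3), (1, 4), (1, 7), (2, 3), (2, 5), (2, 8), (3, 6), (4, 5), (4, 6), (4, 8), (5, 6), (5, 7)}" for i j
    using blowup_G7_adjacent[OF B that] by blast
  have tri: "card (Q 1) + card (Q 2) + card (Q 3) \<le> 5" "card (Q 4) + card (Q 5) + card (Q 6) \<le> 5"
    using clique3_bound[OF s(1,2,3) c(1,2,3)] ad[of 1 2] ad[of 1 3] ad[of 2 3]
      clique3_bound[OF s(4,5,6) c(4,5,6)] ad[of 4 5] ad[of 4 6] ad[of 5 6] by simp_all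
  have edge: "card (Q i) + card (Q j) \<le> 5"
    if "(i, j) \<in> {(1, 2), (1, 3), (1, 4), (1, 7), (2, 3), (2, 5), (2, 8), (3, 6), (4, 5), (4, 6), (4, 8), (5, 6), (5, 7)}" "i \<in> uverts base_G7" "j \<in> uverts base_G7" for i j
    by (rule clique2_bound[OF sub sub blowup_clique[OF B] blowup_clique[OF B]]) (use that ad[OF that(1)] in blast)+
  have edg: "card (Q 1) + card (Q 4) \<le> 5" "card (Q 2) + card (Q 5) \<le> 5" "card (Q 3) + card (Q 6) \<le> 5"
      "card (Q 1) + card (Q 7) \<le> 5" "card (Q 5) + card (Q 7) \<le> 5" "card (Q 2) + card (Q 8) \<le> 5" "card (Q 4) + card (Q 8) \<le> 5"
    using edge[of 1 4] edge[of 2 5] edge[of 3 6] edge[of 1 7] edge[of 5 7] edge[of 2 8] edge[of 4 8] v by simp_all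
  show ?thesis
  proof (cases "\<exists>p\<in>{[7,1,3,6,5], [8,2,3,6,4]}. card (\<Union>i\<in>uverts base_G1. Q (p ! (i - 1))) > 10")
    case True
    then obtain p where p: "p \<in> {[7,1,3,6,5], [8,2,3,6,4]}" "card (\<Union>i\<in>uverts base_G1. Q (p ! (i - 1))) > 10" by blast
    let ?S = "\<Union>i\<in>uverts base_G1. Q (p ! (i - 1))"
    have "?S \<subseteq> V" using base_G1_in_base_G7(1)[OF p(1)] sub by blast
    then have SV: "?S = V" "card V = 11" using blowup_G1_critical[OF blowup_G1_of_G7[OF B p(1)] _ p(2)] by blast+
    define R where "R = (\<lambda>i. Q (p ! (i - 1)))"
    have BR: "blowup E base_G1 R V" using blowup_G1_of_G7[OF B p(1)] SV unfolding R_def by simp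
    have subR: "R i \<subseteq> V" if "i \<in> uverts base_G1" for i using BR that unfolding blowup_def by blast
    have cb: "card (R i) + card (R j) \<le> 5" if "i \<in> uverts base_G1" "j \<in> uverts base_G1" "{i, j} \<in> uedges base_G1" "i \<noteq> j" for i j
      by (rule clique2_bound[OF subR subR blowup_clique[OF BR] blowup_clique[OF BR]])
        (use that blowup_adjacent[OF BR] in blast)+
    have "list_ex (\<lambda>ns. ns \<in> set critical_G1) [[card (R 1), card (R 2), card (R 3), card (R 4), card (R 5)],
      [card (R 2), card (R 3), card (R 4), card (R 5), card (R 1)], [card (R 3), card (R 4), card (R 5), card (R 1), card (R 2)],
      [card (R 4), card (R 5), card (R 1), card (R 2), card (R 3)], [card (R 5), card (R 1), card (R 2), card (R 3), card (R 4)],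
      [card (R 5), card (R 4), card (R 3), card (R 2), card (R 1)], [card (R 4), card (R 3), card (R 2), card (R 1), card (R 5)],
      [card (R 3), card (R 2), card (R 1), card (R 5), card (R 4)], [card (R 2), card (R 1), card (R 5), card (R 4), card (R 3)],
      [card (R 1), card (R 5), card (R 4), card (R 3), card (R 2)]]"
    proof (rule critical_G1_weights)
      show "card (R 1) + card (R 2) \<le> 5" "card (R 2) + card (R 3) \<le> 5" "card (R 3) + card (R 4) \<le> 5"
        "card (R 4) + card (R 5) \<le> 5" "card (R 5) + card (R 1) \<le> 5"
        by (rule cb; simp add: base_G1_def)+
      show "card (R 1) + card (R 2) + card (R 3) + card (R 4) + card (R 5) = 11"
        using blowup_G1_card[OF BR finV] SV by simp
    qed
    then have "list_ex (\<lambda>ns. ns \<in> set critical_G1) (map (map (\<lambda>i. card (R i)))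
      [[1,2,3,4,5], [2,3,4,5,1], [3,4,5,1,2], [4,5,1,2,3], [5,1,2,3,4],
       [5,4,3,2,1], [4,3,2,1,5], [3,2,1,5,4], [2,1,5,4,3], [1,5,4,3,2]])"
      unfolding list.map .
    then obtain q where q: "q \<in> set [[1,2,3,4,5], [2,3,4,5,1], [3,4,5,1,2], [4,5,1,2,3], [5,1,2,3,4],
          [5,4,3,2,1], [4,3,2,1,5], [3,2,1,5,4], [2,1,5,4,3], [1,5,4,3,2::nat]]"
      "map (\<lambda>i. card (R i)) q \<in> set critical_G1"
      unfolding list_ex_iff set_map by blast
    have lq: "length q = 5" using q(1) by auto
    have "\<forall>i\<in>uverts base_G1. card (R (q ! (i - 1))) = map (\<lambda>i. card (R i)) q ! (i - 1)"
      using lq by (auto simp: verts_G1)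
    then show ?thesis using blowup_G1_automorphism[OF BR q(1)] q(2) by blast
  next
    case False
    let ?p = "[7,1,3,6,5::nat]" and ?q = "[8,2,3,6,4::nat]"
    have "card (\<Union>i\<in>uverts base_G1. Q (?p ! (i - 1))) \<le> 10" "card (\<Union>i\<in>uverts base_G1. Q (?q ! (i - 1))) \<le> 10"
      using False by auto
    moreover have "finite (\<Union>i\<in>uverts base_G1. Q (p ! (i - 1)))" if "p \<in> {?p, ?q}" for p
      using base_G1_in_base_G7(1)[OF that] sub finV by (meson UN_least finite_subset)
    ultimately have cyc: "card (Q 7) + card (Q 1) + card (Q 3) + card (Q 6) + card (Q 5) \<le> 10"
      "card (Q 8) + card (Q 2) + card (Q 3) + card (Q 6) + card (Q 4) \<le> 10"
      using blowup_G1_card[OF blowup_G1_of_G7[OF B, of ?p]] blowup_G1_card[OF blowup_G1_of_G7[OF B, of ?q]]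
      by simp_all
    have "\<not> card V \<le> 15"
    proof
      assume "card V \<le> 15"
      then have "col E V 5" by (intro blowup_G7_col[OF B finV tri edg]) (use cyc in simp_all)
      then show False using ncol by simp
    qed
    then have "16 \<le> card V" by simp
    then obtain T where T: "T \<subseteq> V" "card T = 16" by (meson obtain_subset_with_card_n)
    have "V \<inter> T = T" using T by blast
    then have "\<not> col E T 5"
      using blowup_G7_not_col[OF blowup_restrict[OF B, of T], of 5] T finV finite_subset by auto
    then have c16: "card V = 16" using subset_not_col[of T] T by auto
    have "[card (Q 1), card (Q 2), card (Q 3), card (Q 4), card (Q 5), card (Q 6), card (Q 7), card (Q 8)] \<in> set critical_G7
      \<or> [card (Q 2), card (Q 1), card (Q 3), card (Q 5), card (Q 4), card (Q 6), card (Q 8), card (Q 7)] \<in> set critical_G7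
      \<or> [card (Q 5), card (Q 4), card (Q 6), card (Q 2), card (Q 1), card (Q 3), card (Q 7), card (Q 8)] \<in> set critical_G7
      \<or> [card (Q 4), card (Q 5), card (Q 6), card (Q 1), card (Q 2), card (Q 3), card (Q 8), card (Q 7)] \<in> set critical_G7"
      by (rule critical_G7_weights[OF tri edg cyc]) (use c16 blowup_G7_card[OF B finV] in simp)
    then have "\<exists>q\<in>{[1,2,3,4,5,6,7,8], [2,1,3,5,4,6,8,7], [5,4,6,2,1,3,7,8], [4,5,6,1,2,3,8,7::nat]}.
        map (\<lambda>i. card (Q i)) q \<in> set critical_G7"
      unfolding bex_simps list.map by blast
    then obtain q where q: "q \<in> {[1,2,3,4,5,6,7,8], [2,1,3,5,4,6,8,7], [5,4,6,2,1,3,7,8], [4,5,6,1,2,3,8,7::nat]}"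
      "map (\<lambda>i. card (Q i)) q \<in> set critical_G7"
      by (elim bexE)
    have lq: "length q = 8" using q(1) by auto
    have "\<forall>i\<in>uverts base_G7. card (Q (q ! (i - 1))) = map (\<lambda>i. card (Q i)) q ! (i - 1)"
      using lq by (auto simp: verts_G7)
    then show ?thesis using blowup_G7_automorphism[OF B q(1)] q(2) by blast
  qed
qed

end

section \<open>Graphs and the adjacency relation\<close>

definition adj :: "'a ugraph \<Rightarrow> 'a \<Rightarrow> 'a \<Rightarrow> bool" where
  "adj G u v \<longleftrightarrow> {u, v} \<in> uedges G"

lemma adj_commute: "adj G u v \<longleftrightarrow> adj G v u"
  by (simp add: adj_def insert_commute)

lemma adj_irrefl: "simple_graph G \<Longrightarrow> \<not> adj G u u"
  by (auto simp: adj_def simple_graph_def)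

lemma adj_uverts: "simple_graph G \<Longrightarrow> adj G u v \<Longrightarrow> u \<in> uverts G \<and> v \<in> uverts G"
  by (auto simp: adj_def simple_graph_def)

lemma col_mono: "col E S k \<Longrightarrow> k \<le> l \<Longrightarrow> col E S l"
  unfolding col_def using proper_mono[of E S _ "{..<k}" "{..<l}"] by auto

lemma proper_colouring_iff_proper: "proper_colouring G k c \<longleftrightarrow> proper (adj G) (uverts G) c {..<k}"
  by (auto simp: proper_colouring_def proper_def adj_def)

lemma proper_colouring_delete_vertex:
  "proper_colouring (delete_vertex G v) k c \<longleftrightarrow> proper (adj G) (uverts G - {v}) c {..<k}"
  by (auto simp: proper_colouring_def proper_def adj_def delete_vertex_def induced_ugraph_def)

lemma finite_imp_col:
  assumes "simple_graph G" "S \<subseteq> uverts G" shows "\<exists>k. col (adj G) S k"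
proof -
  have "finite S" using assms finite_subset unfolding simple_graph_def by blast
  then obtain f :: "'a \<Rightarrow> nat" where "inj_on f S" using finite_imp_inj_to_nat_seg by blast
  then have "proper (adj G) S f (f ` S)"
    using adj_irrefl[OF assms(1)] unfolding proper_def inj_on_def by blast
  then show ?thesis using proper_imp_col \<open>finite S\<close> by blast
qed

lemma Least_le_iff: "(LEAST k. P k) \<le> n \<longleftrightarrow> P n"
  if "\<exists>k. P k" "\<And>k l. P k \<Longrightarrow> k \<le> l \<Longrightarrow> P l" for P :: "nat \<Rightarrow> bool"
  using that LeastI_ex[of P] Least_le[of P n] by blast

lemma chromatic_number_le_iff:
  assumes "simple_graph G"
  shows "chromatic_number G \<le> k \<longleftrightarrow> col (adj G) (uverts G) k"
    "chromatic_number (delete_vertex G v) \<le> k \<longleftrightarrow> col (adj G) (uverts G - {v}) k"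
  unfolding chromatic_number_def proper_colouring_delete_vertex unfolding proper_colouring_iff_proper col_def[symmetric]
  by (intro Least_le_iff finite_imp_col[OF assms]; use col_mono in blast)+

lemma col_insert_new_colour:
  assumes "col E (V - {v}) k" "\<not> E v v" shows "col E V (Suc k)"
proof -
  obtain c where c: "proper E (V - {v}) c {..<k}" using assms(1) unfolding col_def by blast
  have "proper E V (c(v := k)) {..<Suc k}"
    using c assms(2) unfolding proper_def by (force simp: less_Suc_eq)
  then show ?thesis unfolding col_def by blast
qed

lemma vertex_critical_Suc_iff:
  assumes "simple_graph G"
  shows "vertex_critical (Suc k) G \<longleftrightarrow>
    \<not> col (adj G) (uverts G) k \<and> (\<forall>v\<in>uverts G. col (adj G) (uverts G - {v}) k)"
proof
  assume "vertex_critical (Suc k) G"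
  then show "\<not> col (adj G) (uverts G) k \<and> (\<forall>v\<in>uverts G. col (adj G) (uverts G - {v}) k)"
    unfolding vertex_critical_def chromatic_number_le_iff[OF assms, symmetric] by auto
next
  assume c: "\<not> col (adj G) (uverts G) k \<and> (\<forall>v\<in>uverts G. col (adj G) (uverts G - {v}) k)"
  then have "uverts G \<noteq> {}" by (auto simp: col_def proper_def)
  then have "col (adj G) (uverts G) (Suc k)"
    using c col_insert_new_colour adj_irrefl[OF assms] by (metis ex_in_conv)
  then show "vertex_critical (Suc k) G"
    using c unfolding vertex_critical_def chromatic_number_le_iff[OF assms, symmetric] by auto
qed

lemma contains_induced_iff:
  "contains_induced G H \<longleftrightarrow> (\<exists>g. inj_on g (uverts H) \<and> g ` uverts H \<subseteq> uverts G \<and>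
     (\<forall>i\<in>uverts H. \<forall>j\<in>uverts H. adj H i j \<longleftrightarrow> adj G (g i) (g j)))"
proof
  assume "contains_induced G H"
  then obtain S f where S: "S \<subseteq> uverts G" and f: "bij_betw f S (uverts H)"
    "\<And>u v. u \<in> S \<Longrightarrow> v \<in> S \<Longrightarrow> adj G u v \<longleftrightarrow> adj H (f u) (f v)"
    unfolding contains_induced_def ugraph_iso_def induced_ugraph_def adj_def by auto
  let ?g = "the_inv_into S f"
  have g: "bij_betw ?g (uverts H) S" using f(1) by (rule bij_betw_the_inv_into)
  have "adj H i j \<longleftrightarrow> adj G (?g i) (?g j)" if "i \<in> uverts H" "j \<in> uverts H" for i j
  proof -
    have "?g i \<in> S" "?g j \<in> S" using that g unfolding bij_betw_def by blast+
    moreover have "f (?g i) = i" "f (?g j) = j"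
      using that f(1) f_the_inv_into_f[of f S] unfolding bij_betw_def by simp_all
    ultimately show ?thesis using f(2)[of "?g i" "?g j"] by simp
  qed
  moreover have "inj_on ?g (uverts H)" "?g ` uverts H \<subseteq> uverts G" using g S unfolding bij_betw_def by simp_all
  ultimately show "\<exists>g. inj_on g (uverts H) \<and> g ` uverts H \<subseteq> uverts G \<and>
     (\<forall>i\<in>uverts H. \<forall>j\<in>uverts H. adj H i j \<longleftrightarrow> adj G (g i) (g j))"
    by (intro exI[of _ ?g]) simp
next
  assume "\<exists>g. inj_on g (uverts H) \<and> g ` uverts H \<subseteq> uverts G \<and>
     (\<forall>i\<in>uverts H. \<forall>j\<in>uverts H. adj H i j \<longleftrightarrow> adj G (g i) (g j))"
  then obtain g where g: "inj_on g (uverts H)" "g ` uverts H \<subseteq> uverts G"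
    "\<And>i j. i \<in> uverts H \<Longrightarrow> j \<in> uverts H \<Longrightarrow> adj H i j \<longleftrightarrow> adj G (g i) (g j)" by auto
  let ?f = "the_inv_into (uverts H) g"
  have f: "bij_betw ?f (g ` uverts H) (uverts H)"
    using g(1) by (intro bij_betw_the_inv_into) (simp add: bij_betw_def)
  have "ugraph_iso (induced_ugraph G (g ` uverts H)) H"
    unfolding ugraph_iso_def
    by (rule exI[of _ ?f]) (use f g(3) in \<open>auto simp: induced_ugraph_def adj_def the_inv_into_f_f[OF g(1)]\<close>)
  then show "contains_induced G H" using g(2) unfolding contains_induced_def by blast
qed

lemma path_ugraph_verts: "uverts (path_ugraph 5) = {1, 2, 3, 4, 5}" "uverts (path_ugraph 4) = {1, 2, 3, 4}"
  by (auto simp: path_ugraph_def)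

lemma path_ugraph_adj: "i \<in> uverts (path_ugraph n) \<Longrightarrow> j \<in> uverts (path_ugraph n) \<Longrightarrow>
    adj (path_ugraph n) i j \<longleftrightarrow> j = i + 1 \<or> i = j + 1"
  by (auto simp: adj_def path_ugraph_def doubleton_eq_iff)

lemma gem_ugraph_verts: "uverts gem_ugraph = {0, 1, 2, 3, 4}"
  by (simp add: gem_ugraph_def path_ugraph_verts)

lemma gem_ugraph_adj: "i \<in> uverts gem_ugraph \<Longrightarrow> j \<in> uverts gem_ugraph \<Longrightarrow>
    adj gem_ugraph i j \<longleftrightarrow> i \<noteq> j \<and> (i = 0 \<or> j = 0 \<or> j = i + 1 \<or> i = j + 1)"
  by (auto simp: adj_def gem_ugraph_def path_ugraph_def doubleton_eq_iff)

lemma P5_gem_free_iff: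
  assumes "simple_graph G" shows "P5_gem_free G \<longleftrightarrow> P5_gem_free_graph (adj G)"
proof
  assume f: "P5_gem_free G"
  note v = adj_uverts[OF assms] and i = adj_irrefl[OF assms]
  show "P5_gem_free_graph (adj G)"
  proof
    fix p q r s t
    assume a: "adj G p q" "adj G q r" "adj G r s" "adj G s t" "\<not> adj G p r" "\<not> adj G p s" "\<not> adj G p t"
      "\<not> adj G q s" "\<not> adj G q t" "\<not> adj G r t"
    let ?g = "\<lambda>i. [p, q, r, s, t] ! (i - 1)"
    have d: "distinct [p, q, r, s, t]" using a i adj_commute[of G] by auto
    have b: "adj G q p" "adj G r q" "adj G s r" "adj G t s" "\<not> adj G r p" "\<not> adj G s p" "\<not> adj G t p"
      "\<not> adj G s q" "\<not> adj G t q" "\<not> adj G t r" using a adj_commute[of G] by blast+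
    have "contains_induced G (path_ugraph 5)"
      unfolding contains_induced_iff
    proof (intro exI[of _ ?g] conjI ballI)
      show "inj_on ?g (uverts (path_ugraph 5))"
        using d unfolding path_ugraph_verts by (auto simp: inj_on_def)
      show "?g ` uverts (path_ugraph 5) \<subseteq> uverts G"
        using v[OF a(1)] v[OF a(3)] v[OF a(4)] unfolding path_ugraph_verts by simp
      fix j k assume jk: "j \<in> uverts (path_ugraph 5)" "k \<in> uverts (path_ugraph 5)"
      show "adj (path_ugraph 5) j k \<longleftrightarrow> adj G (?g j) (?g k)"
        unfolding path_ugraph_adj[OF jk] using jk a b i unfolding path_ugraph_verts
        by (elim insertE emptyE; simp)
    qed
    then show False using f unfolding P5_gem_free_def by blast
  next
    fix x p q r s
    assume a: "adj G x p" "adj G x q" "adj G x r" "adj G x s" "adj G p q" "adj G q r" "adj G r s"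
      "\<not> adj G p r" "\<not> adj G p s" "\<not> adj G q s"
    let ?g = "\<lambda>i. [x, p, q, r, s] ! i"
    have b: "adj G p x" "adj G q x" "adj G r x" "adj G s x" "adj G q p" "adj G r q" "adj G s r"
      "\<not> adj G r p" "\<not> adj G s p" "\<not> adj G s q" using a adj_commute[of G] by blast+
    have d: "distinct [x, p, q, r, s]" using a b i by auto
    have "contains_induced G gem_ugraph"
      unfolding contains_induced_iff
    proof (intro exI[of _ ?g] conjI ballI)
      show "inj_on ?g (uverts gem_ugraph)"
        using d unfolding gem_ugraph_verts by (auto simp: inj_on_def)
      show "?g ` uverts gem_ugraph \<subseteq> uverts G"
        using v[OF a(1)] v[OF a(2)] v[OF a(3)] v[OF a(4)] unfolding gem_ugraph_verts by simp
      fix j k assume jk: "j \<in> uverts gem_ugraph" "k \<in> uverts gem_ugraph"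
      show "adj gem_ugraph j k \<longleftrightarrow> adj G (?g j) (?g k)"
        unfolding gem_ugraph_adj[OF jk] using jk a b i unfolding gem_ugraph_verts
        by (elim insertE emptyE; simp)
    qed
    then show False using f unfolding P5_gem_free_def by blast
  qed (metis adj_commute, rule i)
next
  assume "P5_gem_free_graph (adj G)"
  then interpret P5_gem_free_graph "adj G" .
  have False if c: "contains_induced G (path_ugraph 5)"
  proof -
    obtain g where g: "\<And>i j. i \<in> uverts (path_ugraph 5) \<Longrightarrow> j \<in> uverts (path_ugraph 5) \<Longrightarrow>
        adj (path_ugraph 5) i j \<longleftrightarrow> adj G (g i) (g j)"
      using c unfolding contains_induced_iff by auto
    have h: "adj G (g i) (g j) \<longleftrightarrow> j = i + 1 \<or> i = j + 1" if "i \<in> {1, 2, 3, 4, 5}" "j \<in> {1, 2, 3, 4, 5}" for i j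
      using g[of i j] path_ugraph_adj[of i 5 j] that unfolding path_ugraph_verts by blast
    show False by (rule P5[of "g 1" "g 2" "g 3" "g 4" "g 5"]) (simp_all add: h)
  qed
  moreover have False if c: "contains_induced G gem_ugraph"
  proof -
    obtain g where g: "\<And>i j. i \<in> uverts gem_ugraph \<Longrightarrow> j \<in> uverts gem_ugraph \<Longrightarrow>
        adj gem_ugraph i j \<longleftrightarrow> adj G (g i) (g j)"
      using c unfolding contains_induced_iff by auto
    have h: "adj G (g i) (g j) \<longleftrightarrow> i \<noteq> j \<and> (i = 0 \<or> j = 0 \<or> j = i + 1 \<or> i = j + 1)"
      if "i \<in> {0, 1, 2, 3, 4}" "j \<in> {0, 1, 2, 3, 4}" for i j
      using g[of i j] gem_ugraph_adj[of i j] that unfolding gem_ugraph_verts by blast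
    show False by (rule gem[of "g 0" "g 1" "g 2" "g 3" "g 4"]) (simp_all add: h)
  qed
  ultimately show "P5_gem_free G" unfolding P5_gem_free_def by blast
qed

lemma clique_expansion_uverts: "uverts (clique_expansion H n) = Sigma (uverts H) (\<lambda>v. {1..n v})"
  by (simp add: clique_expansion_def Let_def)

lemma clique_expansion_adj: "adj (clique_expansion H n) x y \<longleftrightarrow>
    x \<in> uverts (clique_expansion H n) \<and> y \<in> uverts (clique_expansion H n) \<and> x \<noteq> y \<and> (fst x = fst y \<or> adj H (fst x) (fst y))"
proof -
  let ?V = "uverts (clique_expansion H n)"
  let ?P = "\<lambda>a b. a \<in> ?V \<and> b \<in> ?V \<and> a \<noteq> b \<and> (fst a = fst b \<or> {fst a, fst b} \<in> uedges H)"
  have "adj (clique_expansion H n) x y \<longleftrightarrow> (\<exists>a b. {x, y} = {a, b} \<and> ?P a b)"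
    by (simp add: adj_def clique_expansion_def Let_def)
  moreover have "?P a b \<Longrightarrow> ?P b a" for a b by (auto simp: insert_commute)
  ultimately show ?thesis unfolding adj_def doubleton_eq_iff by blast
qed

lemma simple_clique_expansion:
  assumes "simple_graph H" shows "simple_graph (clique_expansion H n)"
proof -
  have "finite (uverts (clique_expansion H n))"
    using assms unfolding clique_expansion_uverts simple_graph_def by simp
  moreover have "e \<subseteq> uverts (clique_expansion H n) \<and> card e = 2" if "e \<in> uedges (clique_expansion H n)" for e
    using that by (auto simp: clique_expansion_def Let_def)
  ultimately show ?thesis unfolding simple_graph_def by blast
qed

lemma blowup_clique_expansion:
  "blowup (adj (clique_expansion H n)) H (\<lambda>i. {i} \<times> {1..n i}) (uverts (clique_expansion H n))"
  unfolding blowup_def clique_expansion_adj clique_expansion_uverts by (auto simp: adj_def)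

lemma ugraph_iso_clique_expansion:
  assumes G: "simple_graph G" and B: "blowup (adj G) H Q (uverts G)"
    and n: "\<forall>i\<in>uverts H. card (Q i) = n i"
  shows "ugraph_iso G (clique_expansion H n)"
proof -
  have U: "uverts G = (\<Union>i\<in>uverts H. Q i)" using B by (simp add: blowup_def)
  have "\<forall>i\<in>uverts H. \<exists>h. bij_betw h (Q i) {1..n i}"
  proof
    fix i assume "i \<in> uverts H"
    moreover have "finite (Q i)" using G U \<open>i \<in> uverts H\<close> unfolding simple_graph_def by (metis UN_upper finite_subset)
    ultimately show "\<exists>h. bij_betw h (Q i) {1..n i}" using n by (intro finite_same_card_bij) auto
  qed
  then obtain h where h: "\<And>i. i \<in> uverts H \<Longrightarrow> bij_betw (h i) (Q i) {1..n i}" by metis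
  obtain c where c: "\<And>x. x \<in> uverts G \<Longrightarrow> c x \<in> uverts H \<and> x \<in> Q (c x)" using U by (metis UN_iff)
  have cu: "c x = i" if "x \<in> Q i" "i \<in> uverts H" for x i
    using c[of x] blowup_disjoint[OF B, of i "c x"] that U by blast
  define f where "f = (\<lambda>x. (c x, h (c x) x))"
  have bij: "bij_betw f (uverts G) (uverts (clique_expansion H n))"
    unfolding bij_betw_def
  proof
    show "inj_on f (uverts G)"
      unfolding inj_on_def f_def using c h unfolding bij_betw_def inj_on_def by (metis prod.inject)
    show "f ` uverts G = uverts (clique_expansion H n)"
    proof (intro set_eqI iffI)
      fix y assume "y \<in> f ` uverts G"
      then obtain x where x: "x \<in> uverts G" "y = f x" by blast
      then have "h (c x) x \<in> {1..n (c x)}" using bij_betwE[OF h[of "c x"]] c by simp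
      then show "y \<in> uverts (clique_expansion H n)"
        unfolding clique_expansion_uverts x(2) f_def using c[OF x(1)] by simp
    next
      fix y assume "y \<in> uverts (clique_expansion H n)"
      then have y: "fst y \<in> uverts H" "snd y \<in> {1..n (fst y)}"
        unfolding clique_expansion_uverts by (cases y; simp)+
      have "snd y \<in> h (fst y) ` Q (fst y)" using h[OF y(1)] y(2) unfolding bij_betw_def by simp
      then obtain x where x: "x \<in> Q (fst y)" "snd y = h (fst y) x" by (elim imageE) simp
      have "f x = y" using cu[OF x(1) y(1)] x(2) unfolding f_def by (simp add: prod_eq_iff)
      moreover have "x \<in> uverts G" using U x(1) y(1) by simp (rule bexI)
      ultimately show "y \<in> f ` uverts G" by (rule image_eqI[OF sym])
    qed
  qed
  have "adj G u v \<longleftrightarrow> adj (clique_expansion H n) (f u) (f v)" if uv: "u \<in> uverts G" "v \<in> uverts G" for u v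
  proof (cases "u = v")
    case True then show ?thesis using adj_irrefl[OF G] by (simp add: clique_expansion_adj)
  next
    case False
    then have "f u \<noteq> f v" "f u \<in> uverts (clique_expansion H n)" "f v \<in> uverts (clique_expansion H n)"
      using bij uv unfolding bij_betw_def inj_on_def by blast+
    moreover have "adj G u v \<longleftrightarrow> c u = c v \<or> {c u, c v} \<in> uedges H"
      using B c[OF uv(1)] c[OF uv(2)] False unfolding blowup_def by blast
    ultimately show ?thesis unfolding clique_expansion_adj f_def by (simp add: adj_def)
  qed
  then show ?thesis using bij unfolding ugraph_iso_def adj_def by blast
qed

lemma ugraph_iso_complete_ugraph:
  assumes G: "simple_graph G" and K: "clique (adj G) (uverts G)" and W: "finite W" "card W = card (uverts G)"
  shows "ugraph_iso G (complete_ugraph W)"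
proof -
  have "finite (uverts G)" using G by (simp add: simple_graph_def)
  then obtain f where f: "bij_betw f (uverts G) W" using finite_same_card_bij W by metis
  have "{u, v} \<in> uedges G \<longleftrightarrow> {f u, f v} \<in> uedges (complete_ugraph W)" if "u \<in> uverts G" "v \<in> uverts G" for u v
  proof -
    have "f u \<in> W" "f v \<in> W" "f u = f v \<longleftrightarrow> u = v"
      using f that unfolding bij_betw_def inj_on_def by blast+
    moreover have "{u, v} \<in> uedges G \<longleftrightarrow> u \<noteq> v"
      using K that adj_irrefl[OF G] unfolding clique_def adj_def by blast
    ultimately show ?thesis by (auto simp: complete_ugraph_def card_insert_if)
  qed
  then show ?thesis using f unfolding ugraph_iso_def by (auto simp: complete_ugraph_def)
qed

lemma clique_not_col:
  assumes "clique E K" "finite K" "card K > k" shows "\<not> col E K k"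
proof
  assume "col E K k"
  then obtain c where c: "proper E K c {..<k}" unfolding col_def by blast
  have "c ` K \<subseteq> {..<k}" using c unfolding proper_def by blast
  then have "card (c ` K) \<le> k" using card_mono[of "{..<k}" "c ` K"] by simp
  then show False using proper_card_clique[OF c _ assms(1)] assms(3) by simp
qed

lemma critical_graphs_6_eq:
  "critical_graphs_6 = complete_ugraph ({1} \<times> {1..6}) # map expansion_G1 critical_G1 @ map expansion_G7 critical_G7"
  by (simp add: critical_graphs_6_def critical_G1_def critical_G7_def)

theorem P5_gem_free_6_critical:
  assumes G: "simple_graph G" and crit: "vertex_critical 6 G" and free: "P5_gem_free G"
  shows "\<exists>H\<in>set critical_graphs_6. ugraph_iso G H"
proof -
  have c: "\<not> col (adj G) (uverts G) 5" "\<And>v. v \<in> uverts G \<Longrightarrow> col (adj G) (uverts G - {v}) 5"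
    using crit vertex_critical_Suc_iff[OF G, of 5] by simp_all
  have fin: "finite (uverts G)" using G by (simp add: simple_graph_def)
  show ?thesis
  proof (cases "\<exists>K\<subseteq>uverts G. clique (adj G) K \<and> card K > 5")
    case True
    then obtain K' where K': "K' \<subseteq> uverts G" "clique (adj G) K'" "card K' \<ge> 6" by auto
    then obtain K where K: "K \<subseteq> K'" "card K = 6" by (meson obtain_subset_with_card_n)
    have kK: "clique (adj G) K" "K \<subseteq> uverts G" using K K' clique_subset by blast+
    have "\<not> col (adj G) K 5" using clique_not_col[OF kK(1)] K fin kK finite_subset by fastforce
    then have "K = uverts G" using c(2) col_subset[of "adj G" "uverts G - {_}" 5 K] kK(2) by blast
    then have "ugraph_iso G (complete_ugraph ({1::nat} \<times> {1..6::nat}))"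
      by (intro ugraph_iso_complete_ugraph[OF G]) (use K kK in auto)
    then show ?thesis unfolding critical_graphs_6_eq by auto
  next
    case False
    interpret P5_gem_free_graph "adj G" using P5_gem_free_iff[OF G] free by blast
    interpret critical_graph "adj G" "uverts G"
      by unfold_locales (use fin adj_uverts[OF G] c False in \<open>auto simp: not_less\<close>)
    from critical_blowup show ?thesis
    proof (elim disjE exE bexE conjE)
      fix Q ns assume "ns \<in> set critical_G7" "blowup (adj G) base_G7 Q (uverts G)" "\<forall>i\<in>uverts base_G7. card (Q i) = ns ! (i - 1)"
      then have "ugraph_iso G (expansion_G7 ns)" "expansion_G7 ns \<in> set critical_graphs_6"
        using ugraph_iso_clique_expansion[OF G] unfolding expansion_G7_def critical_graphs_6_eq by auto
      then show ?thesis by blast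
    next
      fix Q ns assume "ns \<in> set critical_G1" "blowup (adj G) base_G1 Q (uverts G)" "\<forall>i\<in>uverts base_G1. card (Q i) = ns ! (i - 1)"
      then have "ugraph_iso G (expansion_G1 ns)" "expansion_G1 ns \<in> set critical_graphs_6"
        using ugraph_iso_clique_expansion[OF G] unfolding expansion_G1_def critical_graphs_6_eq by auto
      then show ?thesis by blast
    qed
  qed
qed

section \<open>The expansions are critical\<close>

lemma P5_gem_free_graph_pullback:
  assumes "P5_gem_free_graph E" and v: "\<And>x y. E' x y \<Longrightarrow> x \<in> V \<and> y \<in> V"
    and e: "\<And>x y. x \<in> V \<Longrightarrow> y \<in> V \<Longrightarrow> E' x y \<longleftrightarrow> E (f x) (f y)"
  shows "P5_gem_free_graph E'"
proof -
  interpret P5_gem_free_graph E by fact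
  show ?thesis
  proof
    show "E' y x" if "E' x y" for x y using that v[OF that] e sym by blast
    show "\<not> E' x x" for x using v[of x x] e[of x x] irr by blast
    show False if h: "E' p q" "E' q r" "E' r s" "E' s t" "\<not> E' p r" "\<not> E' p s" "\<not> E' p t"
      "\<not> E' q s" "\<not> E' q t" "\<not> E' r t" for p q r s t
    proof -
      have m: "p \<in> V" "q \<in> V" "r \<in> V" "s \<in> V" "t \<in> V" using v[OF h(1)] v[OF h(3)] v[OF h(4)] by simp_all
      show False by (rule P5[of "f p" "f q" "f r" "f s" "f t"]) (use h in \<open>simp_all add: e[symmetric] m\<close>)
    qed
    show False if h: "E' x p" "E' x q" "E' x r" "E' x s" "E' p q" "E' q r" "E' r s"
      "\<not> E' p r" "\<not> E' p s" "\<not> E' q s" for x p q r s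
    proof -
      have m: "x \<in> V" "p \<in> V" "q \<in> V" "r \<in> V" "s \<in> V" using v[OF h(1)] v[OF h(2)] v[OF h(3)] v[OF h(4)] by simp_all
      show False by (rule gem[of "f x" "f p" "f q" "f r" "f s"]) (use h in \<open>simp_all add: e[symmetric] m\<close>)
    qed
  qed
qed

text \<open>Adjacent vertices of \<open>P\<^sub>5\<close> and of the gem are distinguished by a third vertex,
  so an induced copy of either in an expansion has its vertices in distinct cliques.\<close>

lemma clique_expansion_P5_gem_free:
  assumes "P5_gem_free_graph (adj H)" shows "P5_gem_free_graph (adj (clique_expansion H n))"
proof -
  interpret P5_gem_free_graph "adj H" by fact
  let ?E = "adj (clique_expansion H n)"
  define R where "R = (\<lambda>a b. a = b \<or> adj H a b)"
  have R: "?E x y \<longleftrightarrow> x \<in> uverts (clique_expansion H n) \<and> y \<in> uverts (clique_expansion H n) \<and> x \<noteq> y \<and> R (fst x) (fst y)" for x y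
    unfolding clique_expansion_adj R_def by blast
  have v: "x \<in> uverts (clique_expansion H n)" "y \<in> uverts (clique_expansion H n)" "x \<noteq> y" "R (fst x) (fst y)"
    if "?E x y" for x y
    using that unfolding R by blast+
  have nR: "\<not> R (fst x) (fst y)" if "\<not> ?E x y" "x \<in> uverts (clique_expansion H n)" "y \<in> uverts (clique_expansion H n)" "x \<noteq> y" for x y
    using that unfolding R by blast
  have s: "R a b \<Longrightarrow> R b a" for a b unfolding R_def using sym by blast
  have adjR: "adj H a b" if "R a b" "R b c" "\<not> R a c" for a b c
    using that unfolding R_def by blast
  have nadj: "\<not> R a b \<Longrightarrow> \<not> adj H a b" for a b unfolding R_def by blast
  have Es: "?E y x" if "?E x y" for x y using that unfolding R using s by blast
  show ?thesis
  proof
    show "?E y x" if "?E x y" for x y using Es[OF that] .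
    show "\<not> ?E x x" for x unfolding R by blast
    show False if h: "?E p q" "?E q r" "?E r s" "?E s t" "\<not> ?E p r" "\<not> ?E p s" "\<not> ?E p t"
      "\<not> ?E q s" "\<not> ?E q t" "\<not> ?E r t" for p q r s t
    proof -
      have d: "p \<noteq> r" "p \<noteq> s" "p \<noteq> t" "q \<noteq> s" "q \<noteq> t" "r \<noteq> t" using h Es by blast+
      note m = v(1,2)[OF h(1)] v(1,2)[OF h(3)] v(2)[OF h(4)]
      note r = v(4)[OF h(1)] v(4)[OF h(2)] v(4)[OF h(3)] v(4)[OF h(4)]
      note nr = nR[OF h(5) m(1,3) d(1)] nR[OF h(6) m(1,4) d(2)] nR[OF h(7) m(1,5) d(3)]
        nR[OF h(8) m(2,4) d(4)] nR[OF h(9) m(2,5) d(5)] nR[OF h(10) m(3,5) d(6)]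
      have st: "adj H (fst s) (fst t)" using adjR[OF s[OF r(4)] s[OF r(3)]] nr(6) s sym by blast
      show False
        by (rule P5[OF adjR[OF r(1,2) nr(1)] adjR[OF r(2,3) nr(4)] adjR[OF r(3,4) nr(6)] st nr[THEN nadj]])
    qed
    show False if h: "?E x p" "?E x q" "?E x r" "?E x s" "?E p q" "?E q r" "?E r s"
      "\<not> ?E p r" "\<not> ?E p s" "\<not> ?E q s" for x p q r s
    proof -
      have d: "p \<noteq> r" "p \<noteq> s" "q \<noteq> s" using h Es by blast+
      note m = v(2)[OF h(1)] v(2)[OF h(2)] v(2)[OF h(3)] v(2)[OF h(4)]
      note r = v(4)[OF h(1)] v(4)[OF h(2)] v(4)[OF h(3)] v(4)[OF h(4)] v(4)[OF h(5)] v(4)[OF h(6)] v(4)[OF h(7)]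
      note nr = nR[OF h(8) m(1,3) d(1)] nR[OF h(9) m(1,4) d(2)] nR[OF h(10) m(2,4) d(3)]
      have sr: "adj H (fst r) (fst s)" using adjR[OF s[OF r(7)] s[OF r(6)]] nr(3) s sym by blast
      have x: "adj H (fst x) (fst p)" "adj H (fst x) (fst q)" "adj H (fst x) (fst r)" "adj H (fst x) (fst s)"
        using adjR[OF s[OF r(1)] r(3) nr(1)] adjR[OF s[OF r(2)] r(4) nr(3)]
          adjR[OF s[OF r(3)] r(1)] adjR[OF s[OF r(4)] r(1)] nr s sym by blast+
      show False
        by (rule gem[OF x adjR[OF r(5,6) nr(1)] adjR[OF r(6,7) nr(3)] sr nr[THEN nadj]])
    qed
  qed
qed

definition nbr :: "'a ugraph \<Rightarrow> 'a \<Rightarrow> 'a set" where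
  "nbr G v = {u. adj G v u}"

lemma nbr_G7:
  "nbr base_G7 1 = {2, 3, 4, 7}" "nbr base_G7 2 = {1, 3, 5, 8}" "nbr base_G7 3 = {1, 2, 6}" "nbr base_G7 4 = {1, 5, 6, 8}"
  "nbr base_G7 5 = {2, 4, 6, 7}" "nbr base_G7 6 = {3, 4, 5}" "nbr base_G7 7 = {1, 5}" "nbr base_G7 8 = {2, 4}"
  unfolding nbr_def adj_def base_G7_def
  by (rule set_eqI, simp add: doubleton_eq_iff, presburger?)+

lemma nbr_G1:
  "nbr base_G1 1 = {2, 5}" "nbr base_G1 2 = {1, 3}" "nbr base_G1 3 = {2, 4}" "nbr base_G1 4 = {3, 5}" "nbr base_G1 5 = {1, 4}"
  unfolding nbr_def adj_def base_G1_def
  by (rule set_eqI, simp add: doubleton_eq_iff, presburger?)+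

lemma simple_base: "simple_graph base_G7" "simple_graph base_G1"
  by (simp_all add: simple_graph_def base_G7_def base_G1_def)

lemma P5_check_G7:
  "\<forall>p\<in>{1,2,3,4,5,6,7,8}. \<forall>q\<in>nbr base_G7 p. \<forall>r\<in>nbr base_G7 q. if r \<in> nbr base_G7 p then True else
     \<forall>s\<in>nbr base_G7 r. if s \<in> nbr base_G7 p \<or> s \<in> nbr base_G7 q then True else
     \<forall>t\<in>nbr base_G7 s. t \<in> nbr base_G7 p \<or> t \<in> nbr base_G7 q \<or> t \<in> nbr base_G7 r"
  by (simp add: nbr_G7 nbr_G7(1)[unfolded One_nat_def])

lemma gem_check_G7:
  "\<forall>x\<in>{1,2,3,4,5,6,7,8}. \<forall>p\<in>nbr base_G7 x. \<forall>q\<in>nbr base_G7 p. if q \<in> nbr base_G7 x then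
     \<forall>r\<in>nbr base_G7 q. if r \<in> nbr base_G7 x \<and> r \<notin> nbr base_G7 p then
     \<forall>s\<in>nbr base_G7 r. s \<in> nbr base_G7 x \<longrightarrow> s \<in> nbr base_G7 p \<or> s \<in> nbr base_G7 q else True else True"
  by (simp add: nbr_G7 nbr_G7(1)[unfolded One_nat_def])

lemma base_G7_P5_gem_free: "P5_gem_free_graph (adj base_G7)"
proof
  have v: "x \<in> {1,2,3,4,5,6,7,8}" if "adj base_G7 x y" for x y
    using adj_uverts[OF simple_base(1) that] by (simp add: verts_G7)
  have n: "adj base_G7 x y \<longleftrightarrow> y \<in> nbr base_G7 x" for x y by (simp add: nbr_def)
  show False if h: "adj base_G7 p q" "adj base_G7 q r" "adj base_G7 r s" "adj base_G7 s t"
    "\<not> adj base_G7 p r" "\<not> adj base_G7 p s" "\<not> adj base_G7 p t" "\<not> adj base_G7 q s" "\<not> adj base_G7 q t" "\<not> adj base_G7 r t"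
    for p q r s t
    using P5_check_G7[THEN bspec, OF v[OF h(1)], THEN bspec, OF h(1)[unfolded n], THEN bspec, OF h(2)[unfolded n]] h[unfolded n]
    by (simp split: if_splits) blast
  show False if h: "adj base_G7 x p" "adj base_G7 x q" "adj base_G7 x r" "adj base_G7 x s"
    "adj base_G7 p q" "adj base_G7 q r" "adj base_G7 r s"
    "\<not> adj base_G7 p r" "\<not> adj base_G7 p s" "\<not> adj base_G7 q s"
    for x p q r s
    using gem_check_G7[THEN bspec, OF v[OF h(1)], THEN bspec, OF h(1)[unfolded n], THEN bspec, OF h(5)[unfolded n]] h[unfolded n]
    by (simp split: if_splits) blast
qed (metis adj_commute, rule adj_irrefl[OF simple_base(1)])

lemma base_G1_P5_gem_free: "P5_gem_free_graph (adj base_G1)"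
proof (rule P5_gem_free_graph_pullback[OF base_G7_P5_gem_free, where V = "uverts base_G1" and f = "\<lambda>i. [7,1,3,6,5] ! (i - 1)"])
  show "adj base_G1 i j \<longleftrightarrow> adj base_G7 ([7,1,3,6,5] ! (i - 1)) ([7,1,3,6,5] ! (j - 1))"
    if "i \<in> uverts base_G1" "j \<in> uverts base_G1" for i j
    using base_G1_in_base_G7(3)[OF _ that, of "[7,1,3,6,5]"] unfolding adj_def by simp
qed (use adj_uverts[OF simple_base(2)] in blast)

text \<open>The list places the five cliques along the induced cycle 7, 1, 3, 6, 5 of \<^const>\<open>base_G7\<close>.\<close>

lemma blowup_G1_in_G7:
  assumes "blowup E base_G1 Q S"
  shows "blowup E base_G7 (\<lambda>i. [Q 2, {}, Q 3, {}, Q 5, Q 4, Q 1, {}] ! (i - 1)) S"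
  using assms unfolding blowup_def verts_G7 verts_G1
  by (simp add: base_G1_def base_G7_def doubleton_eq_iff Un_ac)

lemma critical_G7_bounds:
  "\<forall>ns\<in>set critical_G7. ns!0 + ns!1 + ns!2 \<le> 5 \<and> ns!3 + ns!4 + ns!5 \<le> 5 \<and> ns!0 + ns!3 \<le> 5 \<and> ns!1 + ns!4 \<le> 5 \<and>
     ns!2 + ns!5 \<le> 5 \<and> ns!0 + ns!6 \<le> 5 \<and> ns!4 + ns!6 \<le> 5 \<and> ns!1 + ns!7 \<le> 5 \<and> ns!3 + ns!7 \<le> 5 \<and>
     ns!6 + ns!0 + ns!2 + ns!5 + ns!4 \<le> 10 \<and> ns!7 + ns!1 + ns!2 + ns!5 + ns!3 \<le> 10 \<and>
     ns!0 + ns!1 + ns!2 + ns!3 + ns!4 + ns!5 + ns!6 + ns!7 = 16"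
  by (simp add: critical_G7_def)

lemma critical_G1_bounds:
  "\<forall>ns\<in>set critical_G1. ns!0 + ns!1 \<le> 5 \<and> ns!1 + ns!2 \<le> 5 \<and> ns!2 + ns!3 \<le> 5 \<and> ns!3 + ns!4 \<le> 5 \<and> ns!4 + ns!0 \<le> 5 \<and>
     ns!0 + ns!1 + ns!2 + ns!3 + ns!4 = 11"
  by (simp add: critical_G1_def)

lemma expansion_G7_critical:
  assumes "ns \<in> set critical_G7"
  shows "simple_graph (expansion_G7 ns)" "P5_gem_free (expansion_G7 ns)" "vertex_critical 6 (expansion_G7 ns)"
proof -
  let ?G = "expansion_G7 ns"
  let ?Q = "\<lambda>i. {i} \<times> {1..ns ! (i - 1)}"
  show simple: "simple_graph ?G" unfolding expansion_G7_def by (rule simple_clique_expansion[OF simple_base(1)])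
  have "P5_gem_free_graph (adj ?G)"
    unfolding expansion_G7_def by (rule clique_expansion_P5_gem_free[OF base_G7_P5_gem_free])
  then interpret P5_gem_free_graph "adj ?G" .
  show "P5_gem_free ?G" unfolding P5_gem_free_iff[OF simple] by unfold_locales
  have B: "blowup (adj ?G) base_G7 ?Q (uverts ?G)" unfolding expansion_G7_def by (rule blowup_clique_expansion)
  have f: "finite (uverts ?G)" using simple by (simp add: simple_graph_def)
  have b: "ns!0 + ns!1 + ns!2 \<le> 5" "ns!3 + ns!4 + ns!5 \<le> 5" "ns!0 + ns!3 \<le> 5" "ns!1 + ns!4 \<le> 5"
    "ns!2 + ns!5 \<le> 5" "ns!0 + ns!6 \<le> 5" "ns!4 + ns!6 \<le> 5" "ns!1 + ns!7 \<le> 5" "ns!3 + ns!7 \<le> 5"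
    "ns!6 + ns!0 + ns!2 + ns!5 + ns!4 \<le> 10" "ns!7 + ns!1 + ns!2 + ns!5 + ns!3 \<le> 10"
    "ns!0 + ns!1 + ns!2 + ns!3 + ns!4 + ns!5 + ns!6 + ns!7 = 16"
    using critical_G7_bounds[THEN bspec, OF assms] by blast+
  have s: "card (uverts ?G) = 16" using blowup_G7_card[OF B f] b(12) by simp
  have "col (adj ?G) (uverts ?G - {v}) 5" if v: "v \<in> uverts ?G" for v
  proof -
    let ?T = "uverts ?G - {v}"
    have "uverts ?G \<inter> ?T = ?T" by blast
    then have BT: "blowup (adj ?G) base_G7 (\<lambda>i. ?Q i \<inter> ?T) ?T" using blowup_restrict[OF B, of ?T] by simp
    define R where "R = (\<lambda>i. ?Q i \<inter> ?T)"
    have le: "card (R i) \<le> ns ! (i - 1)" for i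
      unfolding R_def using card_mono[of "?Q i" "?Q i \<inter> ?T"] by simp
    have l: "card (R 1) \<le> ns ! 0" "card (R 2) \<le> ns ! 1" "card (R 3) \<le> ns ! 2" "card (R 4) \<le> ns ! 3"
      "card (R 5) \<le> ns ! 4" "card (R 6) \<le> ns ! 5" "card (R 7) \<le> ns ! 6" "card (R 8) \<le> ns ! 7"
      using le[of 1] le[of 2] le[of 3] le[of 4] le[of 5] le[of 6] le[of 7] le[of 8] by simp_all
    have BR: "blowup (adj ?G) base_G7 R ?T" using BT unfolding R_def .
    have "card (R 1) + card (R 2) + card (R 3) \<le> 5" "card (R 4) + card (R 5) + card (R 6) \<le> 5"
      using b(1,2) l by linarith+
    moreover have "card (R 1) + card (R 4) \<le> 5" "card (R 2) + card (R 5) \<le> 5" "card (R 3) + card (R 6) \<le> 5"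
      "card (R 1) + card (R 7) \<le> 5" "card (R 5) + card (R 7) \<le> 5" "card (R 2) + card (R 8) \<le> 5" "card (R 4) + card (R 8) \<le> 5"
      using b(3-9) l by linarith+
    moreover have "card (R 7) + card (R 1) + card (R 3) + card (R 6) + card (R 5) \<le> 2 * 5"
      "card (R 8) + card (R 2) + card (R 3) + card (R 6) + card (R 4) \<le> 2 * 5"
      using b(10,11) l by linarith+
    moreover have "finite ?T" "card ?T \<le> 3 * 5" using f s v by simp_all
    ultimately show ?thesis by (intro blowup_G7_col[OF BR] disjI2)
  qed
  moreover have "\<not> col (adj ?G) (uverts ?G) 5" by (rule blowup_G7_not_col[OF B f]) (simp add: s)
  ultimately show "vertex_critical 6 ?G" using vertex_critical_Suc_iff[OF simple, of 5] by simp
qed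

lemma expansion_G1_critical:
  assumes "ns \<in> set critical_G1"
  shows "simple_graph (expansion_G1 ns)" "P5_gem_free (expansion_G1 ns)" "vertex_critical 6 (expansion_G1 ns)"
proof -
  let ?G = "expansion_G1 ns"
  let ?Q = "\<lambda>i. {i} \<times> {1..ns ! (i - 1)}"
  show simple: "simple_graph ?G" unfolding expansion_G1_def by (rule simple_clique_expansion[OF simple_base(2)])
  have "P5_gem_free_graph (adj ?G)"
    unfolding expansion_G1_def by (rule clique_expansion_P5_gem_free[OF base_G1_P5_gem_free])
  then interpret P5_gem_free_graph "adj ?G" .
  show "P5_gem_free ?G" unfolding P5_gem_free_iff[OF simple] by unfold_locales
  have B: "blowup (adj ?G) base_G1 ?Q (uverts ?G)" unfolding expansion_G1_def by (rule blowup_clique_expansion)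
  have f: "finite (uverts ?G)" using simple by (simp add: simple_graph_def)
  have s: "card (uverts ?G) = 11" using blowup_G1_card[OF B f] critical_G1_bounds[THEN bspec, OF assms] by simp
  have "col (adj ?G) (uverts ?G - {v}) 5" if v: "v \<in> uverts ?G" for v
  proof -
    let ?T = "uverts ?G - {v}"
    have "uverts ?G \<inter> ?T = ?T" by blast
    then have BT: "blowup (adj ?G) base_G1 (\<lambda>i. ?Q i \<inter> ?T) ?T" using blowup_restrict[OF B, of ?T] by simp
    have c: "card ?T = 10" using s v f by simp
    define R where "R = (\<lambda>i. ?Q i \<inter> ?T)"
    have sum: "card (R 1) + card (R 2) + card (R 3) + card (R 4) + card (R 5) = 10"
      using blowup_G1_card[OF BT] f c unfolding R_def by simp
    have le: "card (R i) \<le> ns ! (i - 1)" for i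
      unfolding R_def using card_mono[of "?Q i" "?Q i \<inter> ?T"] by simp
    have l: "card (R 1) \<le> ns ! 0" "card (R 2) \<le> ns ! 1" "card (R 3) \<le> ns ! 2" "card (R 4) \<le> ns ! 3"
      "card (R 5) \<le> ns ! 4"
      using le[of 1] le[of 2] le[of 3] le[of 4] le[of 5] by simp_all
    have BR: "blowup (adj ?G) base_G7 (\<lambda>i. [R 2, {}, R 3, {}, R 5, R 4, R 1, {}] ! (i - 1)) ?T"
      using blowup_G1_in_G7[OF BT] unfolding R_def .
    show ?thesis
      by (rule blowup_G7_col[OF BR])
        (use critical_G1_bounds[THEN bspec, OF assms] l sum f in simp_all)
  qed
  moreover have "\<not> col (adj ?G) (uverts ?G) 5" by (rule blowup_G1_not_col[OF B f]) (simp add: s)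
  ultimately show "vertex_critical 6 ?G" using vertex_critical_Suc_iff[OF simple, of 5] by simp
qed

lemma complete_ugraph_critical:
  fixes W :: "'a set"
  assumes W: "finite W" "card W = 6"
  shows "simple_graph (complete_ugraph W)" "P5_gem_free (complete_ugraph W)" "vertex_critical 6 (complete_ugraph W)"
proof -
  let ?G = "complete_ugraph W"
  show simple: "simple_graph ?G" using W by (auto simp: simple_graph_def complete_ugraph_def)
  have u: "uverts ?G = W" by (simp add: complete_ugraph_def)
  have e: "adj ?G x y \<longleftrightarrow> x \<in> W \<and> y \<in> W \<and> x \<noteq> y" for x y
    by (auto simp: adj_def complete_ugraph_def card_insert_if)
  show "P5_gem_free ?G" unfolding P5_gem_free_iff[OF simple] by unfold_locales (auto simp: e)
  have "\<not> col (adj ?G) W 5" by (rule clique_not_col) (use W in \<open>auto simp: clique_def e\<close>)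
  obtain h :: "'a \<Rightarrow> nat" where h: "inj_on h W" using finite_imp_inj_to_nat_seg[OF W(1)] by blast
  have "col (adj ?G) (W - {v}) 5" if "v \<in> W" for v
  proof (rule proper_imp_col)
    show "proper (adj ?G) (W - {v}) h (h ` (W - {v}))"
      using h unfolding proper_def e inj_on_def by blast
    show "finite (h ` (W - {v}))" using W by simp
    show "card (h ` (W - {v})) \<le> 5" using card_image_le[of "W - {v}" h] W that by simp
  qed
  with \<open>\<not> col (adj ?G) W 5\<close> show "vertex_critical 6 ?G" using vertex_critical_Suc_iff[OF simple, of 5] u by simp
qed

section \<open>Degree counts\<close>

text \<open>Closed neighbourhoods keep truncated subtraction out of the degree formulas below.\<close>

definition closed_nbhd :: "'a ugraph \<Rightarrow> 'a \<Rightarrow> 'a set" where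
  "closed_nbhd G v = {u \<in> uverts G. u = v \<or> adj G v u}"

definition degree_counts :: "'a ugraph \<Rightarrow> nat list" where
  "degree_counts G = card (uverts G) # map (\<lambda>d. card {v \<in> uverts G. card (closed_nbhd G v) = d}) [6, 7, 8, 9, 10, 11, 12]"

lemma degree_counts_iso:
  assumes "ugraph_iso G H" shows "degree_counts G = degree_counts H"
proof -
  obtain f where f: "bij_betw f (uverts G) (uverts H)"
    and e: "\<And>u v. u \<in> uverts G \<Longrightarrow> v \<in> uverts G \<Longrightarrow> adj G u v \<longleftrightarrow> adj H (f u) (f v)"
    using assms unfolding ugraph_iso_def adj_def by blast
  have inj: "inj_on f (uverts G)" and im: "uverts H = f ` uverts G"
    using f unfolding bij_betw_def by simp_all
  have "closed_nbhd H (f v) = f ` closed_nbhd G v" if v: "v \<in> uverts G" for v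
    unfolding closed_nbhd_def im using e[OF v] v inj_onD[OF inj] by blast
  moreover have "card (f ` closed_nbhd G v) = card (closed_nbhd G v)" for v
    by (rule card_image, rule inj_on_subset[OF inj]) (auto simp: closed_nbhd_def)
  ultimately have "{w \<in> uverts H. card (closed_nbhd H w) = d} = f ` {v \<in> uverts G. card (closed_nbhd G v) = d}" for d
    unfolding im by auto
  then have "card {w \<in> uverts H. card (closed_nbhd H w) = d} = card {v \<in> uverts G. card (closed_nbhd G v) = d}" for d
    using inj by (simp add: card_image inj_on_subset)
  then show ?thesis unfolding degree_counts_def bij_betw_same_card[OF f] by simp
qed

lemma card_closed_nbhd_clique_expansion:
  assumes "finite (uverts H)" "x \<in> uverts (clique_expansion H n)"
  shows "card (closed_nbhd (clique_expansion H n) x) = (\<Sum>j\<in>uverts H. if j = fst x \<or> {fst x, j} \<in> uedges H then n j else 0)"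
proof -
  have "closed_nbhd (clique_expansion H n) x = Sigma {j \<in> uverts H. j = fst x \<or> {fst x, j} \<in> uedges H} (\<lambda>j. {1..n j})"
    using assms(2) unfolding closed_nbhd_def clique_expansion_adj unfolding adj_def clique_expansion_uverts by auto
  also have "card \<dots> = (\<Sum>j\<in>{j \<in> uverts H. j = fst x \<or> {fst x, j} \<in> uedges H}. n j)"
    using assms(1) by (simp add: card_SigmaI)
  also have "\<dots> = (\<Sum>j\<in>uverts H. if j = fst x \<or> {fst x, j} \<in> uedges H then n j else 0)"
    using assms(1) by (simp add: sum.inter_filter)
  finally show ?thesis .
qed

lemma degree_counts_clique_expansion:
  assumes f: "finite (uverts H)"
  shows "degree_counts (clique_expansion H n) = (\<Sum>i\<in>uverts H. n i) # map (\<lambda>d. \<Sum>i\<in>uverts H.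
    if (\<Sum>j\<in>uverts H. if j = i \<or> {i, j} \<in> uedges H then n j else 0) = d then n i else 0) [6, 7, 8, 9, 10, 11, 12]"
proof -
  let ?s = "\<lambda>i. \<Sum>j\<in>uverts H. if j = i \<or> {i, j} \<in> uedges H then n j else 0"
  have "card {x \<in> uverts (clique_expansion H n). card (closed_nbhd (clique_expansion H n) x) = d} =
      (\<Sum>i\<in>uverts H. if ?s i = d then n i else 0)" for d
  proof -
    have "{x \<in> uverts (clique_expansion H n). card (closed_nbhd (clique_expansion H n) x) = d} =
        {x \<in> uverts (clique_expansion H n). ?s (fst x) = d}"
      using card_closed_nbhd_clique_expansion[OF f, of _ n] by (intro Collect_cong conj_cong refl) simp
    also have "\<dots> = Sigma {i \<in> uverts H. ?s i = d} (\<lambda>i. {1..n i})"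
      unfolding clique_expansion_uverts by auto
    finally show ?thesis using f by (simp add: card_SigmaI sum.inter_filter)
  qed
  then show ?thesis unfolding degree_counts_def clique_expansion_uverts using f by (simp add: card_SigmaI)
qed

lemma uedges_iff_nbr: "{u, v} \<in> uedges G \<longleftrightarrow> v \<in> nbr G u"
  by (simp add: nbr_def adj_def)

lemma degree_counts_expansion_G1:
  "degree_counts (expansion_G1 [a, b, c, d, e]) = (a + b + c + d + e) # map (\<lambda>k.
     (if a + b + e = k then a else 0) + (if a + b + c = k then b else 0) + (if b + c + d = k then c else 0) +
     (if c + d + e = k then d else 0) + (if a + d + e = k then e else 0)) [6, 7, 8, 9, 10, 11, 12]"
  unfolding expansion_G1_def
  by (subst degree_counts_clique_expansion) (simp_all add: verts_G1 uedges_iff_nbr nbr_G1 nbr_G1(1)[unfolded One_nat_def] add_ac split del: if_split cong del: if_weak_cong)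

lemma degree_counts_expansion_G7:
  "degree_counts (expansion_G7 [a, b, c, d, e, f, g, h]) = (a + b + c + d + e + f + g + h) # map (\<lambda>k.
     (if a + b + c + d + g = k then a else 0) + (if a + b + c + e + h = k then b else 0) + (if a + b + c + f = k then c else 0) +
     (if a + d + e + f + h = k then d else 0) + (if b + d + e + f + g = k then e else 0) + (if c + d + e + f = k then f else 0) +
     (if a + e + g = k then g else 0) + (if b + d + h = k then h else 0)) [6, 7, 8, 9, 10, 11, 12]"
  unfolding expansion_G7_def
  by (subst degree_counts_clique_expansion) (simp_all add: verts_G7 uedges_iff_nbr nbr_G7 nbr_G7(1)[unfolded One_nat_def] add_ac split del: if_split cong del: if_weak_cong)

lemma distinct_degree_counts: "distinct (map degree_counts critical_graphs_6)"
proof -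
  have "degree_counts (complete_ugraph ({1::nat} \<times> {1..6::nat})) = 6 # tl (degree_counts (complete_ugraph ({1::nat} \<times> {1..6::nat})))"
    by (simp add: degree_counts_def complete_ugraph_def)
  then obtain xs where "degree_counts (complete_ugraph ({1::nat} \<times> {1..6::nat})) = 6 # xs" by blast
  then show ?thesis
    unfolding critical_graphs_6_def list.map degree_counts_expansion_G1 degree_counts_expansion_G7
    by simp
qed

theorem mainTheorem3:
  shows "length critical_graphs_6 = 19 \<and>
    (\<forall>i<length critical_graphs_6. \<forall>j<length critical_graphs_6.
       i \<noteq> j \<longrightarrow> \<not> ugraph_iso (critical_graphs_6 ! i) (critical_graphs_6 ! j)) \<and>
    (\<forall>H\<in>set critical_graphs_6. simple_graph H \<and> vertex_critical 6 H \<and> P5_gem_free H) \<and>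
    (\<forall>G :: 'a ugraph. simple_graph G \<and> vertex_critical 6 G \<and> P5_gem_free G \<longrightarrow>
       (\<exists>H\<in>set critical_graphs_6. ugraph_iso G H))"
proof (intro conjI allI impI ballI)
  show "length critical_graphs_6 = 19" by (simp add: critical_graphs_6_def)
next
  fix i j assume ij: "i < length critical_graphs_6" "j < length critical_graphs_6" "i \<noteq> j"
  then have "degree_counts (critical_graphs_6 ! i) \<noteq> degree_counts (critical_graphs_6 ! j)"
    using distinct_degree_counts nth_eq_iff_index_eq[of "map degree_counts critical_graphs_6" i j] by simp
  then show "\<not> ugraph_iso (critical_graphs_6 ! i) (critical_graphs_6 ! j)"
    using degree_counts_iso by blast
next
  fix H assume "H \<in> set critical_graphs_6"
  then consider "H = complete_ugraph ({1} \<times> {1..6})" | ns where "ns \<in> set critical_G1" "H = expansion_G1 ns"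
    | ns where "ns \<in> set critical_G7" "H = expansion_G7 ns"
    unfolding critical_graphs_6_eq by auto
  then have "simple_graph H \<and> vertex_critical 6 H \<and> P5_gem_free H"
  proof cases
    case 1
    have "finite ({1::nat} \<times> {1..6::nat})" "card ({1::nat} \<times> {1..6::nat}) = 6" by simp_all
    then show ?thesis using complete_ugraph_critical unfolding 1 by blast
  next
    case 2 then show ?thesis using expansion_G1_critical by blast
  next
    case 3 then show ?thesis using expansion_G7_critical by blast
  qed
  then show "simple_graph H" "vertex_critical 6 H" "P5_gem_free H" by blast+
next
  fix G :: "'a ugraph" assume "simple_graph G \<and> vertex_critical 6 G \<and> P5_gem_free G"
  then show "\<exists>H\<in>set critical_graphs_6. ugraph_iso G H" using P5_gem_free_6_critical by blast
qed

end
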